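(* Let $K$ be a field, let $V$ be a $K$-vector space of finite dimension $n\ge 1$, and let $V_1,\dots,V_m$ ($m\ge 1$) be linear subspaces of $V$ (no further assumptions). Let $J=I_1I_2\cdots I_m\subseteq R=K[V]$ be the product of the linear ideals $I_j$ of the subspaces $V_j$. Then the Hilbert series of $J$ is $$\mathcal{H}(J,t)=\frac{p(t)\,t^m}{(1-t)^n},$$ where $p(t)=p_{\{1,2,\dots,m\}}(t)$ and the polynomials $p_S(t)$, $S\subseteq\{1,\dots,m\}$, are defined recursively as follows: $p_\emptyset(t)=1$, and for $S\neq\emptyset$, $p_S(t)$ is the unique polynomial satisfying $$\sum_{X\subseteq S}(-t)^{|X|}p_X(t)\equiv 0 \bmod (1-t)^{c_S},\qquad \deg(p_S(t))<c_S .$$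
   Context: $R=K[V]\cong K[x_1,\dots,x_n]$ is the polynomial coordinate ring of $V$ with its standard grading. $I_j\subseteq R$ is the ideal generated by the linear forms vanishing on $V_j$ (this is the vanishing ideal of $V_j$ when $K$ is infinite). For $S\subseteq\{1,\dots,m\}$, $V_S=\bigcap_{i\in S}V_i$ (with $V_\emptyset=V$), $n_S=\dim V_S$, and $c_S=n-n_S$ is the codimension of $V_S$ in $V$. For a finitely generated graded $R$-module $M=\bigoplus_{d\in\mathbb{Z}} M_d$, the Hilbert series is $\mathcal{H}(M,t)=\sum_{d\in\mathbb{Z}}(\dim_K M_d)t^d$. The polynomials $p_S$ are taken in $\mathbb{Q}[t]$, and the zero polynomial has degree $-\infty$ (so $p_S=0$ if $S\ne\emptyset$ and $c_S=0$). *)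

theory Defs
  imports
    "HOL-Library.Poly_Mapping"
    "HOL-Algebra.Ideal_Product"
    "HOL-Computational_Algebra.Computational_Algebra"
    "HOL-Number_Theory.Cong"
begin

section \<open>Polynomial coordinate rings and Hilbert series\<close>

text \<open>
  Polynomials in commuting variables indexed by \<open>'x\<close>: finitely supported coefficient functions on
  exponent vectors.
\<close>

type_synonym ('x, 'k) mpol = "('x \<Rightarrow>\<^sub>0 nat) \<Rightarrow>\<^sub>0 'k"

text \<open>
  For a basis \<open>B\<close> of \<open>V\<close>, the coordinate ring \<open>K[V]\<close> is the polynomial ring in the variables
  \<open>x\<^sub>b\<close>, \<open>b \<in> B\<close>, where \<open>x\<^sub>b\<close> stands for the coordinate function of \<open>b\<close> (the dual basis vector).
\<close>

definition coord_ring :: "'x set \<Rightarrow> ('x, 'k::field) mpol ring" where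
  "coord_ring B = \<lparr>carrier = {f. \<forall>\<alpha>\<in>Poly_Mapping.keys f. Poly_Mapping.keys \<alpha> \<subseteq> B},
                   monoid.mult = (*), one = 1, zero = 0, add = (+)\<rparr>"

lemma cring_coord_ring: "cring (coord_ring B :: ('x, 'k::field) mpol ring)"
proof (rule cringI)
  show "abelian_group (coord_ring B :: ('x, 'k) mpol ring)"
  proof (rule abelian_groupI)
    fix f :: "('x, 'k) mpol" assume "f \<in> carrier (coord_ring B)"
    then show "\<exists>g\<in>carrier (coord_ring B). g \<oplus>\<^bsub>coord_ring B\<^esub> f = \<zero>\<^bsub>coord_ring B\<^esub>"
      by (intro bexI[of _ "- f"]) (auto simp: coord_ring_def)
  qed (use keys_add in \<open>fastforce simp: coord_ring_def algebra_simps\<close>)+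
  show "comm_monoid (coord_ring B :: ('x, 'k) mpol ring)"
  proof (rule comm_monoidI)
    fix f g :: "('x, 'k) mpol"
    assume fg: "f \<in> carrier (coord_ring B)" "g \<in> carrier (coord_ring B)"
    have "Poly_Mapping.keys \<gamma> \<subseteq> B" if \<gamma>: "\<gamma> \<in> Poly_Mapping.keys (f * g)" for \<gamma>
    proof -
      obtain \<alpha> \<beta> where "\<gamma> = \<alpha> + \<beta>" "\<alpha> \<in> Poly_Mapping.keys f" "\<beta> \<in> Poly_Mapping.keys g"
        using keys_mult[of f g] \<gamma> by blast
      then show ?thesis using fg keys_add[of \<alpha> \<beta>] by (simp add: coord_ring_def) blast
    qed
    then show "f \<otimes>\<^bsub>coord_ring B\<^esub> g \<in> carrier (coord_ring B)"
      by (auto simp: coord_ring_def)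
  qed (auto simp: coord_ring_def algebra_simps)
qed (auto simp: coord_ring_def algebra_simps)

definition mpol_scale :: "'k::field \<Rightarrow> ('x, 'k) mpol \<Rightarrow> ('x, 'k) mpol" where
  "mpol_scale c f = Poly_Mapping.single 0 c * f"

lemma vector_space_mpol_scale: "vector_space mpol_scale"
  by unfold_locales
    (simp_all add: mpol_scale_def algebra_simps single_add mult_single flip: mult.assoc)

definition homogeneous :: "nat \<Rightarrow> ('x, 'k::field) mpol \<Rightarrow> bool" where
  "homogeneous d f \<longleftrightarrow>
     (\<forall>\<alpha>\<in>Poly_Mapping.keys f. (\<Sum>x\<in>Poly_Mapping.keys \<alpha>. Poly_Mapping.lookup \<alpha> x) = d)"

text \<open>
  Intended for homogeneous ideals \<open>M\<close> of a polynomial ring in finitely many variables;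
  these have no components of negative degree.
\<close>

definition hilbert_series :: "('x, 'k::field) mpol set \<Rightarrow> rat fps" where
  "hilbert_series M =
     Abs_fps (\<lambda>d. of_nat (vector_space.dim mpol_scale {f \<in> M. homogeneous d f}))"


section \<open>Linear ideals of subspaces\<close>

text \<open>
  The polynomial of a linear form \<open>l : V \<rightarrow> K\<close> is \<open>\<Sum>b\<in>B. l(b) x\<^sub>b\<close>.
\<close>

definition linear_form_mpol :: "'v set \<Rightarrow> ('v \<Rightarrow> 'k::field) \<Rightarrow> ('v, 'k) mpol" where
  "linear_form_mpol B l = (\<Sum>b\<in>B. Poly_Mapping.single (Poly_Mapping.single b 1) (l b))"

definition linear_ideal ::
  "('k::field \<Rightarrow> 'v::ab_group_add \<Rightarrow> 'v) \<Rightarrow> 'v set \<Rightarrow> 'v set \<Rightarrow> ('v, 'k) mpol set" where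
  "linear_ideal scale B W =
     Idl\<^bsub>coord_ring B\<^esub>
       {linear_form_mpol B l | l. Vector_Spaces.linear scale (*) l \<and> (\<forall>w\<in>W. l w = 0)}"

definition product_ideal ::
  "('k::field \<Rightarrow> 'v::ab_group_add \<Rightarrow> 'v) \<Rightarrow> 'v set \<Rightarrow> (nat \<Rightarrow> 'v set) \<Rightarrow> nat
    \<Rightarrow> ('v, 'k) mpol set" where
  "product_ideal scale B V m =
     foldr (ideal_prod (coord_ring B)) (map (\<lambda>j. linear_ideal scale B (V j)) [1..<Suc m])
       (carrier (coord_ring B))"

text \<open>For \<open>S = {}\<close> the intersection is the whole space, so the codimension is \<open>0\<close>.\<close>

definition codim ::
  "('k::field \<Rightarrow> 'v::ab_group_add \<Rightarrow> 'v) \<Rightarrow> (nat \<Rightarrow> 'v set) \<Rightarrow> nat set \<Rightarrow> nat" where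
  "codim scale V S =
     vector_space.dim scale (UNIV :: 'v set) - vector_space.dim scale (\<Inter>i\<in>S. V i)"


section \<open>The polynomials \<open>p\<^sub>S\<close>\<close>

text \<open>
  \<open>p_condition c p S q\<close> is the condition defining \<open>p\<^sub>S = q\<close> in terms of the \<open>p\<^sub>X\<close>, \<open>X \<subset> S\<close>
  (the value of \<open>p\<close> at \<open>S\<close> itself is not used).  The zero polynomial has degree \<open>-\<infinity>\<close>, while the
  library sets its degree to \<open>0\<close>.
\<close>

definition p_condition ::
  "(nat set \<Rightarrow> nat) \<Rightarrow> (nat set \<Rightarrow> rat poly) \<Rightarrow> nat set \<Rightarrow> rat poly \<Rightarrow> bool" where
  "p_condition c p S q \<longleftrightarrow>
     [(\<Sum>X\<in>Pow S. [:0, -1:] ^ card X * (if X = S then q else p X)) = 0] (mod [:1, -1:] ^ c S) \<and>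
     (q = 0 \<or> degree q < c S)"

lemma p_condition_cong [fundef_cong]:
  assumes "c = c'" "S = S'" "\<And>X. X \<subset> S' \<Longrightarrow> p X = p' X"
  shows "p_condition c p S = p_condition c' p' S'"
proof -
  have "(\<Sum>X\<in>Pow S'. [:0, -1:] ^ card X * (if X = S' then q else p X)) =
        (\<Sum>X\<in>Pow S'. [:0, -1:] ^ card X * (if X = S' then q else p' X))" for q
    using assms(3) by (intro sum.cong) auto
  then show ?thesis
    using assms(1,2) by (simp add: p_condition_def fun_eq_iff)
qed

function p_poly :: "(nat set \<Rightarrow> nat) \<Rightarrow> nat set \<Rightarrow> rat poly" where
  "p_poly c S = (if finite S \<and> S \<noteq> {} then THE q. p_condition c (\<lambda>X. p_poly c X) S q else 1)"
  by auto
termination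
  by (relation "measure (\<lambda>(c, S). card S)") (auto intro: psubset_card_mono)

declare p_poly.simps [simp del]

lemma ex1_p_condition:
  assumes "finite S"
  shows "\<exists>!q. p_condition c p S q"
proof -
  define M :: "rat poly" where "M = [:1, -1:] ^ c S"
  define A :: "rat poly" where "A = (\<Sum>X\<in>Pow S - {S}. [:0, -1:] ^ card X * p X)"
  define u :: "rat poly" where "u = [:0, -1:] ^ card S"
  define a :: "rat poly" where "a = (- (\<Sum>i<c S. [:1, -1:] ^ i)) ^ card S"
  have sum: "(\<Sum>X\<in>Pow S. [:0, -1:] ^ card X * (if X = S then q else p X)) = A + u * q" for q
  proof -
    have "(\<Sum>X\<in>Pow S. [:0, -1:] ^ card X * (if X = S then q else p X)) =
          u * q + (\<Sum>X\<in>Pow S - {S}. [:0, -1:] ^ card X * (if X = S then q else p X))"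
      using assms by (subst sum.remove[of _ S]) (auto simp: u_def)
    also have "(\<Sum>X\<in>Pow S - {S}. [:0, -1:] ^ card X * (if X = S then q else p X)) = A"
      unfolding A_def by (intro sum.cong) auto
    finally show ?thesis by simp
  qed
  have degM: "degree M = c S" and M0: "M \<noteq> 0"
    by (simp_all add: M_def degree_power_eq)
  have char: "p_condition c p S q \<longleftrightarrow> M dvd A + u * q \<and> (q = 0 \<or> degree q < degree M)" for q
    unfolding p_condition_def sum degM by (simp add: cong_0_iff M_def)
  have "[:0, -1:] * (- (\<Sum>i<c S. [:1, -1:] ^ i)) = 1 - M"
    using one_diff_power_eq[of "[:1, -1:] :: rat poly" "c S"]
    by (simp add: M_def one_pCons)
  then have ua: "u * a = (1 - M) ^ card S"
    by (simp add: u_def a_def flip: power_mult_distrib)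
  have inv: "M dvd 1 - u * a"
    unfolding ua using one_diff_power_eq[of "1 - M" "card S"] by simp
  have "p_condition c p S ((- A * a) mod M)"
  proof -
    have "A + u * ((- A * a) mod M) = A * (1 - u * a) - u * M * ((- A * a) div M)"
      by (simp add: minus_div_mult_eq_mod[symmetric] algebra_simps)
    moreover have "M dvd \<dots>"
      using inv by (intro dvd_diff) (auto simp: mult.assoc)
    ultimately show ?thesis
      using degree_mod_less[OF M0, of "- A * a"] unfolding char by simp
  qed
  moreover have "q = q'" if "p_condition c p S q" "p_condition c p S q'" for q q'
  proof (rule ccontr)
    assume "q \<noteq> q'"
    have "M dvd (A + u * q) - (A + u * q')"
      using that unfolding char by (intro dvd_diff) auto
    then have "M dvd u * (q - q')" by (simp add: algebra_simps)
    then have "M dvd a * (u * (q - q')) + (1 - u * a) * (q - q')"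
      using inv by (intro dvd_add) auto
    then have "M dvd q - q'" by (simp add: algebra_simps)
    then have "degree M \<le> degree (q - q')"
      using \<open>q \<noteq> q'\<close> by (intro dvd_imp_degree_le) auto
    moreover have "degree (q - q') < degree M"
      using that \<open>q \<noteq> q'\<close> degree_diff_less[of q "degree M" q'] unfolding char by auto
    ultimately show False by simp
  qed
  ultimately show ?thesis by blast
qed

lemma p_poly_empty: "p_poly c {} = 1"
  by (simp add: p_poly.simps)

lemma p_condition_p_poly:
  assumes "finite S" "S \<noteq> {}"
  shows "p_condition c (p_poly c) S (p_poly c S)"
proof -
  have "p_poly c S = (THE q. p_condition c (p_poly c) S q)"
    using assms by (subst p_poly.simps) simp
  then show ?thesis
    using theI'[OF ex1_p_condition[OF assms(1)], of c "p_poly c"] by simp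
qed

end

theory Submission
  imports Defs "HOL-Library.Function_Algebras"
begin

text \<open>
  Write \<open>J X\<close> for the product of the ideals \<open>I j\<close>, \<open>j \<in> X\<close>. All these products are studied
  together, through the complex on the cube of subsets \<open>X \<subseteq> S\<close> whose term at \<open>X\<close> is \<open>J X\<close> and
  whose maps are the signed inclusions of \<open>J (insert s X)\<close> in \<open>J X\<close>. Multiplication by a linear
  form \<open>u\<close> of \<open>I s\<close> is null-homotopic on it: the homotopy multiplies by \<open>u\<close> and moves from \<open>X\<close> to
  \<open>insert s X\<close>. Hence the homology is killed by every linear form in the sum of the \<open>I s\<close>.

  The heart of the proof is that the complex is exact in all degrees \<open>d \<ge> card S\<close> if the \<open>I s\<close>
  together contain all linear forms (\<open>exactness\<close>). It is the part of the linearity of the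
  resolutions of the products that the Hilbert series needs, and it has a direct inductive proof.
  Let \<open>x\<close> be a generic linear form. Modulo \<open>x\<close> the complex is exact by induction, so a cycle \<open>z\<close>
  is a boundary up to a multiple \<open>x q\<close>. The form \<open>x\<close> can be cancelled modulo \<open>J X\<close> in degrees at
  least \<open>card X\<close> (\<open>regular_cancel\<close>), so \<open>q\<close> is a cycle of degree \<open>d - 1\<close> of the same complex, and
  then \<open>x q\<close> is a boundary because \<open>x\<close> is null-homotopic. The cancellation property for \<open>X\<close>
  follows in turn from the exactness for \<open>X\<close> and from the cancellation property for the sets
  \<open>X - {i}\<close>: exactness at the next to last place says that a form of degree at least \<open>card X\<close> in
  all \<open>J (X - {i})\<close> lies in \<open>J X\<close>. If the forms in the \<open>I j\<close>, \<open>j \<in> X\<close>, do not span, then \<open>x\<close> is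
  not in their span, and it is a nonzerodivisor modulo \<open>J X\<close> by a translation argument
  (\<open>ideal_part_nonzerodivisor\<close>). In order to stay in one ring, quotients by generic linear forms
  are replaced by computations modulo the ideal generated by a space \<open>N\<close> of linear forms.

  Taking Euler characteristics, \<open>(\<Sum>X\<subseteq>S. (-1)\<^sup>|\<^sup>X\<^sup>| H (J X))\<close> has no terms of degree \<open>\<ge> card S\<close> in
  the spanning case. In general one first passes to the quotient by \<open>n - c S\<close> linear forms that
  are independent modulo the span of the \<open>I s\<close>; each is a nonzerodivisor and multiplies the series
  by \<open>1 - t\<close>. Thus \<open>(1 - t)\<^sup>n (\<Sum>X\<subseteq>S. (-1)\<^sup>|\<^sup>X\<^sup>| H (J X)) = (1 - t)\<^bsup>c S\<^esup> Q\<close> for a polynomial \<open>Q\<close>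
  with \<open>deg Q < card S\<close> (\<open>alternating_mpol_series\<close>). By induction on \<open>S\<close> the terms for \<open>X \<noteq> S\<close> are
  \<open>(-t)\<^sup>|\<^sup>X\<^sup>| p X\<close>, of degree less than \<open>card S + c S\<close>. So the last term is a polynomial of degree
  less than \<open>card S + c S\<close>; it is divisible by \<open>t\<close> to the power \<open>card S\<close>, as \<open>J S\<close> starts in that
  degree. The quotient satisfies both conditions that define \<open>p S\<close> (\<open>hilbert_series_recursion\<close>).

  Generic linear forms exist over infinite fields only. An arbitrary field \<open>K\<close> is therefore
  extended to the rational function field \<open>K(t)\<close>, which changes no dimension. Finally, \<open>c S\<close> is
  the dimension of the span of the linear forms in the \<open>I s\<close>, since every form vanishing on an
  intersection of subspaces is a sum of forms vanishing on one of them.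
\<close>

section \<open>Dimensions of finitely spanned subspaces\<close>

context vector_space
begin

definition fin_span :: "'b set \<Rightarrow> bool" where
  "fin_span S \<longleftrightarrow> (\<exists>F. finite F \<and> S \<subseteq> span F)"

end

context vector_space
begin

lemma fin_span_subset: "fin_span T \<Longrightarrow> S \<subseteq> T \<Longrightarrow> fin_span S"
  unfolding fin_span_def by blast

lemma fin_span_independent:
  assumes "fin_span S" "A \<subseteq> S" "independent A"
  shows "finite A"
  using assms independent_span_bound unfolding fin_span_def by blast

lemma dim_mono_fin_span:
  assumes "fin_span T" "S \<subseteq> T"
  shows "dim S \<le> dim T"
proof -
  obtain A where A: "A \<subseteq> S" "independent A" "S \<subseteq> span A" "card A = dim S"
    by (rule basis_exists)
  have "A \<subseteq> T" using A(1) assms(2) by blast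
  then obtain B where B: "A \<subseteq> B" "B \<subseteq> T" "independent B" "T \<subseteq> span B"
    using A(2) by (rule maximal_independent_subset_extend)
  have "card B = dim T" using B basis_card_eq_dim by metis
  then show ?thesis
    using A(4) card_mono[OF fin_span_independent[OF assms(1) B(2,3)] B(1)] by simp
qed

lemma dim_span_insert:
  assumes "subspace N" "fin_span N" "x \<notin> N"
  shows "dim (span (insert x N)) = Suc (dim N)"
proof -
  obtain A where A: "A \<subseteq> N" "independent A" "N \<subseteq> span A" "card A = dim N"
    by (rule basis_exists)
  have AN: "span A = N" using A(1,3) assms(1) span_minimal by blast
  have "independent (insert x A)" using A(2) AN assms(3) by (intro independent_insertI) auto
  moreover have "span (insert x A) = span (insert x N)"
    using A(1,3) by (metis AN span_insert span_span)
  ultimately have "dim (span (insert x N)) = card (insert x A)"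
    by (metis dim_span_eq_card_independent)
  also have "\<dots> = Suc (card A)"
    using fin_span_independent[OF assms(2) A(1,2)] A(1) assms(3)
      by (subst card_insert_disjoint) auto
  finally show ?thesis using A(4) by simp
qed

text \<open>
  This produces the generic linear forms. In the step, \<open>x\<close> avoids the old subspaces, \<open>y\<close> avoids
  the new one \<open>W\<close>, and the line \<open>y + c x\<close> meets each old subspace in at most one point; if \<open>x\<close>
  lies in \<open>W\<close>, then the whole line avoids \<open>W\<close>.
\<close>

lemma ex_avoiding_subspaces:
  assumes "infinite (UNIV :: 'a set)" "subspace E" "finite \<U>"
    and "\<And>U. U \<in> \<U> \<Longrightarrow> subspace U \<and> \<not> E \<subseteq> U"
  shows "\<exists>x\<in>E. \<forall>U\<in>\<U>. x \<notin> U"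
  using assms(3,4)
proof (induction \<U>)
  case empty
  then show ?case using subspace_0[OF assms(2)] by blast
next
  case (insert W \<U>)
  then obtain x where x: "x \<in> E" "\<forall>U\<in>\<U>. x \<notin> U" by blast
  obtain y where y: "y \<in> E" "y \<notin> W" using insert.prems by blast
  show ?case
  proof (cases "x \<in> W")
    case True
    let ?C = "\<lambda>U. {c. y + scale c x \<in> U}"
    have "finite (?C U)" if U: "U \<in> \<U>" for U
    proof -
      have "c = c'" if "c \<in> ?C U" "c' \<in> ?C U" for c c'
      proof (rule ccontr)
        assume "c \<noteq> c'"
        have sU: "subspace U" using insert.prems U by blast
        have "(y + scale c x) - (y + scale c' x) \<in> U"
          using that sU by (intro subspace_diff) auto
        then have "scale (c - c') x \<in> U" by (simp add: scale_left_diff_distrib)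
        then have "scale (inverse (c - c')) (scale (c - c') x) \<in> U"
          by (rule subspace_scale[OF sU])
        then show False using x(2) U \<open>c \<noteq> c'\<close> by simp
      qed
      then have "?C U \<subseteq> {c}" if "c \<in> ?C U" for c using that by blast
      then show ?thesis by (metis finite.emptyI finite.insertI finite_subset ex_in_conv)
    qed
    then have "finite (\<Union>U\<in>\<U>. ?C U)" using insert.hyps by blast
    then obtain c where c: "c \<notin> (\<Union>U\<in>\<U>. ?C U)" using assms(1) ex_new_if_finite by blast
    have "y + scale c x \<notin> W"
    proof
      assume "y + scale c x \<in> W"
      then have "(y + scale c x) - scale c x \<in> W"
        using True insert.prems by (intro subspace_diff subspace_scale) auto
      then show False using y(2) by simp
    qed
    moreover have "y + scale c x \<in> E"
      using x(1) y(1) assms(2) by (intro subspace_add subspace_scale)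
    ultimately show ?thesis using c by blast
  qed (use x in blast)
qed

lemma fin_span_sums:
  assumes "fin_span S" "fin_span T"
  shows "fin_span {x + y | x y. x \<in> S \<and> y \<in> T}"
proof -
  obtain F G where "finite F" "S \<subseteq> span F" "finite G" "T \<subseteq> span G"
    using assms unfolding fin_span_def by blast
  then have "{x + y | x y. x \<in> S \<and> y \<in> T} \<subseteq> span (F \<union> G)"
    using span_mono[of F "F \<union> G"] span_mono[of G "F \<union> G"] by (blast intro: span_add)
  then show ?thesis
    unfolding fin_span_def using \<open>finite F\<close> \<open>finite G\<close> by blast
qed

end

context vector_space_pair
begin

lemma fin_span_image:
  assumes "Vector_Spaces.linear s1 s2 T" "vs1.fin_span S"
  shows "vs2.fin_span (T ` S)"
proof -
  obtain F where "finite F" "S \<subseteq> vs1.span F"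
    using assms(2) unfolding vs1.fin_span_def by blast
  then have "T ` S \<subseteq> vs2.span (T ` F)"
    using linear_span_image[OF assms(1), of F] by auto
  then show ?thesis
    unfolding vs2.fin_span_def using \<open>finite F\<close> by blast
qed

lemma rank_nullity:
  assumes T: "Vector_Spaces.linear s1 s2 T" and E: "vs1.subspace E" "vs1.fin_span E"
  shows "vs1.dim E = vs2.dim (T ` E) + vs1.dim {e \<in> E. T e = 0}"
proof -
  interpret T: Vector_Spaces.linear s1 s2 T by (rule T)
  define K where "K = {e \<in> E. T e = 0}"
  have K: "vs1.subspace K"
    using E(1) unfolding K_def vs1.subspace_def by (auto simp: T.add T.scale T.zero)
  obtain A where A: "A \<subseteq> K" "vs1.independent A" "K \<subseteq> vs1.span A" "card A = vs1.dim K"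
    using vs1.basis_exists by blast
  have AE: "A \<subseteq> E" using A(1) unfolding K_def by blast
  obtain B where B: "A \<subseteq> B" "B \<subseteq> E" "vs1.independent B" "E \<subseteq> vs1.span B"
    using vs1.maximal_independent_subset_extend[OF AE A(2)] by blast
  have finB: "finite B" using vs1.fin_span_independent[OF E(2) B(2,3)] .
  let ?C = "B - A"
  have inj: "inj_on T (vs1.span ?C)"
    unfolding linear_inj_on_iff_eq_0[OF T vs1.subspace_span]
  proof (intro ballI impI)
    fix v assume v: "v \<in> vs1.span ?C" and "T v = 0"
    moreover have "vs1.span ?C \<subseteq> E"
      using B(2) E(1) by (intro vs1.span_minimal) auto
    ultimately have "v \<in> vs1.span A" using A(3) unfolding K_def by blast
    then have vA: "v \<in> vs1.span A" and vB: "v \<in> vs1.span B"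
      using v vs1.span_mono[of ?C B] by blast+
    have "vs1.representation B v b = 0" for b
    proof (cases "b \<in> A")
      case True
      have "vs1.representation B v = vs1.representation ?C v"
        by (rule vs1.representation_extend[OF B(3) v]) simp
      then show ?thesis using vs1.representation_ne_zero[of ?C v b] True by auto
    next
      case False
      have "vs1.representation B v = vs1.representation A v"
        by (rule vs1.representation_extend[OF B(3) vA B(1)])
      then show ?thesis using vs1.representation_ne_zero[of A v b] False by auto
    qed
    then show "v = 0"
      using vs1.sum_nonzero_representation_eq[OF B(3) vB] by simp
  qed
  have "vs1.independent ?C" using B(3) vs1.independent_mono by blast
  then have ind: "vs2.independent (T ` ?C)"
    using linear_independent_injective_image[OF T _ inj] by blast
  have "T ` E \<subseteq> vs2.span (T ` ?C)"
  proof -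
    have "T ` E \<subseteq> T ` vs1.span B" using B(4) by blast
    also have "\<dots> = vs2.span (T ` B)" using linear_span_image[OF T] by simp
    also have "\<dots> \<subseteq> vs2.span (insert 0 (T ` ?C))"
      using A(1) unfolding K_def by (intro vs2.span_mono) auto
    finally show ?thesis by simp
  qed
  moreover have "T ` ?C \<subseteq> T ` E" using B(2) by blast
  ultimately have "vs2.dim (T ` E) = card (T ` ?C)"
    using ind vs2.basis_card_eq_dim by metis
  also have "\<dots> = card ?C"
    using inj by (intro card_image inj_on_subset[OF inj] vs1.span_superset)
  also have "\<dots> = card B - card A"
    using B(1) finB by (meson card_Diff_subset finite_subset)
  also have "card B = vs1.dim E" using vs1.basis_card_eq_dim B by metis
  finally show ?thesis
    using A(4) card_mono[OF finB B(1)] vs1.basis_card_eq_dim[OF B(2,4,3)] unfolding K_def by simp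
qed


end

context vector_space
begin

text \<open>
  A map with kernel \<open>U\<close> serves as a quotient by \<open>U\<close> with values in the same space.
\<close>

lemma ex_linear_kernel:
  assumes "subspace U"
  shows "\<exists>g. Vector_Spaces.linear scale scale g \<and> (\<forall>v. g v = 0 \<longleftrightarrow> v \<in> U)"
proof -
  interpret vector_space_pair scale scale by unfold_locales
  obtain A where A: "A \<subseteq> U" "independent A" "U \<subseteq> span A"
    by (rule basis_exists[of U]) (rule that)
  obtain B where B: "A \<subseteq> B" "independent B" "UNIV \<subseteq> span B"
    using maximal_independent_subset_extend[of A UNIV] A(2) by auto
  obtain g where g: "Vector_Spaces.linear scale scale g" "\<And>b. b \<in> B \<Longrightarrow> g b = (if b \<in> A then 0 else b)"
    using linear_independent_extend[OF B(2), of "\<lambda>b. if b \<in> A then 0 else b"] by auto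
  interpret g: Vector_Spaces.linear scale scale g by (rule g(1))
  have gA: "g v = 0" if "v \<in> span A" for v
    using that g(2) B(1) by (induction rule: span_induct_alt) (auto simp: g.add g.scale g.zero)
  have gB: "v - g v \<in> span A" if "v \<in> span B" for v
    using that
  proof (induction rule: span_induct_alt)
    case (step c x y)
    have "x - g x \<in> span A"
      using step(1) g(2) by (auto simp: span_zero intro: span_base)
    then have "scale c (x - g x) + (y - g y) \<in> span A"
      using step(2) by (intro span_add span_scale)
    then show ?case by (simp add: g.add g.scale algebra_simps)
  qed (simp add: g.zero span_zero)
  have "g v = 0 \<longleftrightarrow> v \<in> U" for v
  proof
    assume "g v = 0"
    then have "v \<in> span A" using gB[of v] B(3) by auto
    then show "v \<in> U" using A(1) assms span_minimal by blast
  next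
    assume "v \<in> U"
    then show "g v = 0" using A(3) gA by blast
  qed
  then show ?thesis using g(1) by blast
qed

lemma ex_separating_functional:
  assumes "subspace U" "x \<notin> U"
  shows "\<exists>l. Vector_Spaces.linear scale (*) l \<and> (\<forall>u\<in>U. l u = 0) \<and> l x = 1"
proof -
  interpret vector_space_pair scale "(*) :: 'a \<Rightarrow> 'a \<Rightarrow> 'a"
    by unfold_locales (auto simp: algebra_simps)
  obtain A where A: "A \<subseteq> U" "independent A" "U \<subseteq> span A"
    by (rule basis_exists[of U]) (rule that)
  have xA: "x \<notin> span A" using assms span_minimal[OF A(1) assms(1)] by blast
  then have ind: "independent (insert x A)" using A(2) by (rule independent_insertI)
  obtain l where l: "Vector_Spaces.linear scale (*) l"
    "\<And>b. b \<in> insert x A \<Longrightarrow> l b = (if b = x then 1 else 0)"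
    using linear_independent_extend[OF ind, of "\<lambda>b. if b = x then 1 else 0"] by blast
  interpret l: Vector_Spaces.linear scale "(*)" l by (rule l(1))
  have "x \<notin> A" using xA span_base by blast
  have "l v = 0" if "v \<in> span A" for v
    using that
  proof (induction rule: span_induct_alt)
    case (step c y z)
    then show ?case using \<open>x \<notin> A\<close> l(2) by (auto simp: l.add l.scale)
  qed (rule l.zero)
  then show ?thesis using l A(3) by (intro exI[of _ l]) auto
qed

end

context vector_space_pair
begin

text \<open>
  Rank-nullity for the map that \<open>T\<close> induces from \<open>E\<close> to the quotient by \<open>U\<close>.
\<close>

lemma dim_image_sum:
  assumes T: "Vector_Spaces.linear s1 s2 T"
    and E: "vs1.subspace E" "vs1.fin_span E" and U: "vs2.subspace U" "vs2.fin_span U"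
  shows "vs2.dim {T e + u | e u. e \<in> E \<and> u \<in> U} + vs1.dim {e \<in> E. T e \<in> U} = vs2.dim U + vs1.dim E"
proof -
  interpret T: Vector_Spaces.linear s1 s2 T by (rule T)
  let ?W = "{T e + u | e u. e \<in> E \<and> u \<in> U}"
  have TE: "vs2.subspace (T ` E)" "vs2.fin_span (T ` E)"
    using linear_subspace_image[OF T E(1)] fin_span_image[OF T E(2)] .
  have W_eq: "?W = {x + y | x y. x \<in> T ` E \<and> y \<in> U}" by blast
  have W: "vs2.subspace ?W" "vs2.fin_span ?W"
    unfolding W_eq using vs2.subspace_sums TE U vs2.fin_span_sums by blast+
  obtain g where g: "Vector_Spaces.linear s2 s2 g" "\<And>v. g v = 0 \<longleftrightarrow> v \<in> U"
    using vs2.ex_linear_kernel[OF U(1)] by blast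
  interpret g: Vector_Spaces.linear s2 s2 g by (rule g(1))
  interpret p: vector_space_pair s2 s2 by unfold_locales
  have gT: "Vector_Spaces.linear s1 s2 (g \<circ> T)"
    using T g(1) Vector_Spaces.linear_compose by blast
  have "vs2.dim ?W = vs2.dim (g ` ?W) + vs2.dim {w \<in> ?W. g w = 0}"
    by (rule p.rank_nullity[OF g(1) W])
  also have "{w \<in> ?W. g w = 0} = U"
  proof
    show "U \<subseteq> {w \<in> ?W. g w = 0}"
    proof
      fix u assume u: "u \<in> U"
      have "0 \<in> E" using E(1) vs1.subspace_0 by blast
      moreover have "u = T 0 + u" by (simp add: T.zero)
      ultimately show "u \<in> {w \<in> ?W. g w = 0}" using u g(2) by blast
    qed
  qed (use g(2) in blast)
  also have "g ` ?W = (g \<circ> T) ` E"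
  proof
    show "g ` ?W \<subseteq> (g \<circ> T) ` E"
    proof
      fix y assume "y \<in> g ` ?W"
      then obtain e u where "y = g (T e + u)" "e \<in> E" "u \<in> U" by blast
      then show "y \<in> (g \<circ> T) ` E" using g(2)[of u] by (auto simp: g.add)
    qed
    show "(g \<circ> T) ` E \<subseteq> g ` ?W"
    proof
      fix y assume "y \<in> (g \<circ> T) ` E"
      then obtain e where "e \<in> E" "y = g (T e + 0)" by auto
      then show "y \<in> g ` ?W" using vs2.subspace_0[OF U(1)] by blast
    qed
  qed
  also have "vs2.dim ((g \<circ> T) ` E) + vs1.dim {e \<in> E. (g \<circ> T) e = 0} = vs1.dim E"
    using rank_nullity[OF gT E] by simp
  moreover have "{e \<in> E. (g \<circ> T) e = 0} = {e \<in> E. T e \<in> U}" using g(2) by simp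
  ultimately show ?thesis by simp
qed

end

section \<open>Spaces of families of vectors\<close>

definition fun_scale :: "('k \<Rightarrow> 'a \<Rightarrow> 'a) \<Rightarrow> 'k \<Rightarrow> ('i \<Rightarrow> 'a) \<Rightarrow> 'i \<Rightarrow> 'a" where
  "fun_scale scale c g = (\<lambda>i. scale c (g i))"

context vector_space
begin

lemma vector_space_fun_scale: "vector_space (fun_scale scale :: _ \<Rightarrow> ('i \<Rightarrow> 'b) \<Rightarrow> _)"
  by unfold_locales (auto simp: fun_scale_def fun_eq_iff algebra_simps)

lemma subspace_families:
  assumes "\<And>i. i \<in> T \<Longrightarrow> subspace (F i)"
  shows "module.subspace (fun_scale scale) {g. (\<forall>i\<in>T. g i \<in> F i) \<and> (\<forall>i. i \<notin> T \<longrightarrow> g i = 0)}"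
proof -
  interpret f: vector_space "fun_scale scale :: _ \<Rightarrow> ('c \<Rightarrow> 'b) \<Rightarrow> _" by (rule vector_space_fun_scale)
  show ?thesis
    using assms by (auto simp: f.subspace_def fun_scale_def subspace_0 subspace_add subspace_scale)
qed

lemma fin_span_families:
  assumes "finite T" "\<And>i. i \<in> T \<Longrightarrow> fin_span (F i)"
  shows "vector_space.fin_span (fun_scale scale) {g. (\<forall>i\<in>T. g i \<in> F i) \<and> (\<forall>i. i \<notin> T \<longrightarrow> g i = 0)}"
proof -
  interpret f: vector_space "fun_scale scale :: _ \<Rightarrow> ('c \<Rightarrow> 'b) \<Rightarrow> _" by (rule vector_space_fun_scale)
  interpret p: vector_space_pair scale "fun_scale scale :: _ \<Rightarrow> ('c \<Rightarrow> 'b) \<Rightarrow> _" by unfold_locales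
  define \<delta> :: "'c \<Rightarrow> 'b \<Rightarrow> 'c \<Rightarrow> 'b" where "\<delta> i v = (\<lambda>j. if j = i then v else 0)" for i v
  have \<delta>: "Vector_Spaces.linear scale (fun_scale scale) (\<delta> i)" for i
    by unfold_locales (auto simp: \<delta>_def fun_scale_def fun_eq_iff)
  obtain A where A: "\<And>i. i \<in> T \<Longrightarrow> finite (A i) \<and> F i \<subseteq> span (A i)"
    using assms(2) unfolding fin_span_def by metis
  let ?C = "\<Union>i\<in>T. \<delta> i ` A i"
  have "g \<in> f.span ?C" if g: "\<forall>i\<in>T. g i \<in> F i" "\<forall>i. i \<notin> T \<longrightarrow> g i = 0" for g
  proof -
    have "\<delta> i (g i) \<in> f.span ?C" if "i \<in> T" for i
    proof -
      have "\<delta> i (g i) \<in> \<delta> i ` span (A i)" using A g(1) that by blast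
      also have "\<dots> = f.span (\<delta> i ` A i)" using p.linear_span_image[OF \<delta>] by simp
      also have "\<dots> \<subseteq> f.span ?C" using that by (intro f.span_mono) blast
      finally show ?thesis .
    qed
    then have "(\<Sum>i\<in>T. \<delta> i (g i)) \<in> f.span ?C" by (rule f.span_sum)
    moreover have "(\<Sum>i\<in>T. \<delta> i (g i)) = g"
    proof
      fix j
      have *: "(\<Sum>i\<in>T'. \<delta> i (g i)) j = (\<Sum>i\<in>T'. \<delta> i (g i) j)" if "finite T'" for T'
        using that by (induction T') auto
      show "(\<Sum>i\<in>T. \<delta> i (g i)) j = g j"
        unfolding *[OF assms(1)] using assms(1) g(2) by (simp add: \<delta>_def)
    qed
    ultimately show ?thesis by simp
  qed
  moreover have "finite ?C" using assms(1) A by blast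
  ultimately show ?thesis unfolding f.fin_span_def by blast
qed

lemma dim_families:
  assumes "finite T" "\<And>i. i \<in> T \<Longrightarrow> subspace (F i)" "\<And>i. i \<in> T \<Longrightarrow> fin_span (F i)"
  shows "vector_space.dim (fun_scale scale) {g. (\<forall>i\<in>T. g i \<in> F i) \<and> (\<forall>i. i \<notin> T \<longrightarrow> g i = 0)} =
    (\<Sum>i\<in>T. dim (F i))"
  using assms
proof (induction T)
  case empty
  interpret f: vector_space "fun_scale scale :: _ \<Rightarrow> ('c \<Rightarrow> 'b) \<Rightarrow> _" by (rule vector_space_fun_scale)
  have "{g :: 'c \<Rightarrow> 'b. (\<forall>i\<in>{}. g i \<in> F i) \<and> (\<forall>i. i \<notin> {} \<longrightarrow> g i = 0)} = {0}"
    by (auto simp: fun_eq_iff)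
  then show ?case using f.dim_le_card[of "{0}" "{}"] by simp
next
  case (insert t T)
  interpret f: vector_space "fun_scale scale :: _ \<Rightarrow> ('c \<Rightarrow> 'b) \<Rightarrow> _" by (rule vector_space_fun_scale)
  interpret p: vector_space_pair "fun_scale scale :: _ \<Rightarrow> ('c \<Rightarrow> 'b) \<Rightarrow> _" scale by unfold_locales
  let ?G = "\<lambda>T. {g. (\<forall>i\<in>T. g i \<in> F i) \<and> (\<forall>i. i \<notin> T \<longrightarrow> g i = 0)}"
  have ev: "Vector_Spaces.linear (fun_scale scale) scale (\<lambda>g :: 'c \<Rightarrow> 'b. g t)"
    by unfold_locales (auto simp: fun_scale_def)
  have "f.dim (?G (insert t T)) =
      dim ((\<lambda>g. g t) ` ?G (insert t T)) + f.dim {g \<in> ?G (insert t T). g t = 0}"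
    using insert.prems insert.hyps
    by (intro p.rank_nullity[OF ev] subspace_families fin_span_families) auto
  also have "{g \<in> ?G (insert t T). g t = 0} = ?G T"
    using insert.prems(1)[THEN subspace_0] insert.hyps by (auto, metis)
  also have "(\<lambda>g. g t) ` ?G (insert t T) = F t"
  proof (intro equalityI subsetI)
    fix v assume "v \<in> F t"
    then have "(\<lambda>j. if j = t then v else 0) \<in> ?G (insert t T)"
      using insert.prems(1)[THEN subspace_0] by auto
    then show "v \<in> (\<lambda>g. g t) ` ?G (insert t T)" by (rule rev_image_eqI) simp
  qed auto
  also have "f.dim (?G T) = (\<Sum>i\<in>T. dim (F i))"
    using insert by blast
  finally show ?case using insert.hyps by simp
qed

end

section \<open>Graded algebras with translations\<close>

text \<open>
  The pairs \<open>(k, a)\<close> where \<open>a\<close> is a product of \<open>k\<close> elements of \<open>L\<close>. The degree is kept with the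
  element since a homogeneous element such as \<open>0\<close> does not determine it.
\<close>

inductive_set form_products :: "'a::comm_ring_1 set \<Rightarrow> (nat \<times> 'a) set" for L where
  one: "(0, 1) \<in> form_products L"
| mult: "a \<in> L \<Longrightarrow> (k, b) \<in> form_products L \<Longrightarrow> (Suc k, a * b) \<in> form_products L"

lemma form_products_mono:
  assumes "L \<subseteq> L'"
  shows "form_products L \<subseteq> form_products L'"
proof clarify
  fix k a assume "(k, a) \<in> form_products L"
  then show "(k, a) \<in> form_products L'"
    by induction (use assms in \<open>auto intro: form_products.intros\<close>)
qed

lemma form_products_single: "a \<in> L \<Longrightarrow> (1, a) \<in> form_products L"
  using form_products.mult[OF _ form_products.one, of a L] by simp

lemma form_products_prod:
  assumes "finite X" "\<And>i. i \<in> X \<Longrightarrow> g i \<in> L"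
  shows "(card X, prod g X) \<in> form_products L"
  using assms by (induction X) (auto intro: form_products.intros)

text \<open>
  The last assumption is satisfied in polynomial rings: choose a point \<open>v\<close> at which the forms in
  \<open>L\<close> vanish and \<open>x\<close> takes the value \<open>1\<close>, and let \<open>\<theta>\<close> map a polynomial \<open>f\<close> to the Taylor expansion
  of \<open>f (y + T v)\<close> in \<open>T\<close>. Its \<open>i\<close>-th coefficient lowers the degree by \<open>i\<close>.
\<close>

locale graded_algebra = vector_space scale
  for scale :: "'k::field \<Rightarrow> 'a::comm_ring_1 \<Rightarrow> 'a" +
  fixes gr :: "nat \<Rightarrow> 'a set"
  assumes scale_mult: "scale c (a * b) = scale c a * b"
    and subspace_gr: "subspace (gr d)"
    and fin_span_gr: "fin_span (gr d)"
    and gr_mult: "a \<in> gr i \<Longrightarrow> b \<in> gr j \<Longrightarrow> a * b \<in> gr (i + j)"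
    and gr_0: "gr 0 = range (\<lambda>c. scale c 1)"
    and gr_Suc: "gr (Suc d) \<subseteq> span {a * b | a b. a \<in> gr 1 \<and> b \<in> gr d}"
    and infinite_field: "infinite (UNIV :: 'k set)"
    and translation: "\<lbrakk>subspace L; L \<subseteq> gr 1; x \<in> gr 1; x \<notin> L\<rbrakk> \<Longrightarrow>
      \<exists>\<theta> :: 'a \<Rightarrow> 'a poly.
        (\<forall>a b. \<theta> (a + b) = \<theta> a + \<theta> b) \<and> (\<forall>a b. \<theta> (a * b) = \<theta> a * \<theta> b) \<and> \<theta> 1 = 1 \<and>
        (\<forall>a\<in>L. \<theta> a = [:a:]) \<and> \<theta> x = [:x, 1:] \<and>
        (\<forall>d. \<forall>f\<in>gr d. coeff (\<theta> f) 0 = f \<and>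
           (\<forall>i. if i \<le> d then coeff (\<theta> f) i \<in> gr (d - i) else coeff (\<theta> f) i = 0))"
begin

lemma one_in_gr: "1 \<in> gr 0"
  unfolding gr_0 by (rule range_eqI[of _ _ 1]) simp

lemma scale_conv_mult: "scale c a = scale c 1 * a"
  using scale_mult[of c 1 a] by simp

lemma linear_mult: "Vector_Spaces.linear scale scale ((*) u)"
  by unfold_locales (auto simp: algebra_simps, metis mult.commute scale_mult)

lemma mult_in_span:
  assumes "\<And>v. v \<in> A \<Longrightarrow> u * v \<in> span B" "v \<in> span A"
  shows "u * v \<in> span B"
  using assms(2)
proof (induction rule: span_induct_alt)
  case (step c x y)
  have "u * (scale c x + y) = scale c (u * x) + u * y"
    by (metis distrib_left mult.commute scale_mult)
  then show ?case using step assms(1) by (auto intro: span_add span_scale)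
qed (simp add: span_zero)

lemma form_products_gr:
  assumes "L \<subseteq> gr 1" "(k, a) \<in> form_products L"
  shows "a \<in> gr k"
  using assms(2) by induction (use assms(1) gr_mult[of _ 1] one_in_gr in \<open>auto\<close>)

text \<open>
  The homogeneous part of degree \<open>d\<close> of the ideal with the generators \<open>a\<close>, \<open>(k, a) \<in> P\<close>, where \<open>a\<close>
  is homogeneous of degree \<open>k\<close>.
\<close>

definition ideal_part :: "(nat \<times> 'a) set \<Rightarrow> nat \<Rightarrow> 'a set" where
  "ideal_part P d = span {a * r | k a e r. (k, a) \<in> P \<and> r \<in> gr e \<and> d = k + e}"

lemma subspace_ideal_part: "subspace (ideal_part P d)"
  unfolding ideal_part_def by (rule subspace_span)

lemma ideal_part_mult_gen: "(k, a) \<in> P \<Longrightarrow> r \<in> gr e \<Longrightarrow> a * r \<in> ideal_part P (k + e)"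
  unfolding ideal_part_def by (rule span_base) blast

lemma ideal_part_gen: "(k, a) \<in> P \<Longrightarrow> a \<in> ideal_part P k"
  using ideal_part_mult_gen[OF _ one_in_gr] by force

lemma ideal_part_mono: "P \<subseteq> Q \<Longrightarrow> ideal_part P d \<subseteq> ideal_part Q d"
  unfolding ideal_part_def by (rule span_mono) blast

lemma ideal_part_mult:
  assumes "r \<in> gr e" "v \<in> ideal_part P d"
  shows "r * v \<in> ideal_part P (e + d)"
  using assms(2) unfolding ideal_part_def[of P d]
  unfolding ideal_part_def
proof (rule mult_in_span[rotated])
  fix v assume "v \<in> {a * r | k a e r. (k, a) \<in> P \<and> r \<in> gr e \<and> d = k + e}"
  then obtain k a e' r' where *: "v = a * r'" "(k, a) \<in> P" "r' \<in> gr e'" "d = k + e'" by blast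
  have "r * v = a * (r * r')" "e + d = k + (e + e')" using * by (simp_all add: ac_simps)
  then show "r * v \<in> span {a * r | k a e' r. (k, a) \<in> P \<and> r \<in> gr e' \<and> e + d = k + e'}"
    using *(2) gr_mult[OF assms(1) *(3)] by (intro span_base) blast
qed

lemma ideal_part_le:
  assumes "\<And>k a. (k, a) \<in> P \<Longrightarrow> a \<in> ideal_part Q k"
  shows "ideal_part P d \<subseteq> ideal_part Q d"
  unfolding ideal_part_def[of P]
proof (rule span_minimal[OF _ subspace_ideal_part])
  show "{a * r | k a e r. (k, a) \<in> P \<and> r \<in> gr e \<and> d = k + e} \<subseteq> ideal_part Q d"
    using assms ideal_part_mult by (force simp: ac_simps)
qed

lemma ideal_part_subset_gr:
  assumes "\<And>k a. (k, a) \<in> P \<Longrightarrow> a \<in> gr k"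
  shows "ideal_part P d \<subseteq> gr d"
  unfolding ideal_part_def using assms gr_mult by (intro span_minimal subspace_gr) blast

lemma ideal_part_UnE:
  assumes "v \<in> ideal_part (P \<union> Q) d"
  obtains a b where "a \<in> ideal_part P d" "b \<in> ideal_part Q d" "v = a + b"
proof -
  have *: "{a * r | k a e r. (k, a) \<in> P \<union> Q \<and> r \<in> gr e \<and> d = k + e} =
      {a * r | k a e r. (k, a) \<in> P \<and> r \<in> gr e \<and> d = k + e} \<union>
      {a * r | k a e r. (k, a) \<in> Q \<and> r \<in> gr e \<and> d = k + e}" by blast
  have "v \<in> {x + y | x y. x \<in> ideal_part P d \<and> y \<in> ideal_part Q d}"
    using assms unfolding ideal_part_def * span_Un .
  then show ?thesis by (elim CollectE exE conjE) (rule that)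
qed

text \<open>
  The translation \<open>\<theta>\<close> fixes the generators, so all coefficients of \<open>\<theta> v\<close> lie in the ideal if \<open>v\<close>
  does. As \<open>\<theta> (x f) = (x + T) \<theta> f\<close>, the coefficients \<open>f\<^sub>i\<close> of \<open>\<theta> f\<close> satisfy \<open>x f\<^sub>i\<^sub>+\<^sub>1 + f\<^sub>i \<equiv> 0\<close>
  modulo the ideal. Since \<open>f\<^sub>i\<^sub>+\<^sub>1 = 0\<close> for \<open>i = d\<close>, descending from there gives \<open>f\<^sub>i \<equiv> 0\<close> for all
  \<open>i\<close>, and \<open>f\<^sub>0 = f\<close>.
\<close>

lemma ideal_part_nonzerodivisor:
  assumes L: "subspace L" "L \<subseteq> gr 1" and x: "x \<in> gr 1" "x \<notin> L"
    and P: "P \<subseteq> form_products L" and f: "f \<in> gr d" "x * f \<in> ideal_part P (Suc d)"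
  shows "f \<in> ideal_part P d"
proof -
  from translation[OF L x] obtain \<theta> :: "'a \<Rightarrow> 'a poly" where
    \<theta>: "(\<forall>a b. \<theta> (a + b) = \<theta> a + \<theta> b) \<and> (\<forall>a b. \<theta> (a * b) = \<theta> a * \<theta> b) \<and> \<theta> 1 = 1 \<and>
        (\<forall>a\<in>L. \<theta> a = [:a:]) \<and> \<theta> x = [:x, 1:] \<and>
        (\<forall>d. \<forall>f\<in>gr d. coeff (\<theta> f) 0 = f \<and>
           (\<forall>i. if i \<le> d then coeff (\<theta> f) i \<in> gr (d - i) else coeff (\<theta> f) i = 0))"
    by (elim exE)
  have add: "\<theta> (a + b) = \<theta> a + \<theta> b" and mult: "\<theta> (a * b) = \<theta> a * \<theta> b" for a b
    using \<theta> by blast+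
  have one: "\<theta> 1 = 1" and \<theta>x: "\<theta> x = [:x, 1:]"
    using \<theta> by blast+
  have fixL: "\<theta> a = [:a:]" if "a \<in> L" for a
    using \<theta> that by blast
  have const: "coeff (\<theta> f) 0 = f" if "f \<in> gr d" for f d
    using \<theta> that by blast
  have grade: "coeff (\<theta> f) i \<in> gr (d - i)" if "f \<in> gr d" "i \<le> d" for f d i
    using \<theta> that by presburger
  have vanish: "coeff (\<theta> f) i = 0" if "f \<in> gr d" "i > d" for f d i
    using \<theta> that by (metis leD)
  have zero: "\<theta> 0 = 0" using add[of 0 0] by simp
  have fixP: "\<theta> a = [:a:]" if "(k, a) \<in> P" for k a
  proof -
    have "(k, a) \<in> form_products L" using that P by blast
    then show ?thesis by induction (auto simp: one mult fixL)
  qed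
  have fix0: "\<theta> (scale c 1) = [:scale c 1:]" for c
  proof (rule poly_eqI)
    have c: "scale c 1 \<in> gr 0" unfolding gr_0 by blast
    show "coeff (\<theta> (scale c 1)) i = coeff [:scale c 1:] i" for i
      using const[OF c] vanish[OF c, of i] by (cases i) auto
  qed
  have stable: "if i \<le> d then coeff (\<theta> v) i \<in> ideal_part P (d - i) else coeff (\<theta> v) i = 0"
    if "v \<in> ideal_part P d" for v d i
    using that unfolding ideal_part_def[of P d]
  proof (induction rule: span_induct_alt)
    case base
    then show ?case using subspace_0[OF subspace_ideal_part] by (simp add: zero)
  next
    case (step c v y)
    then obtain k a e r where *: "v = a * r" "(k, a) \<in> P" "r \<in> gr e" "d = k + e" by blast
    have eq: "coeff (\<theta> (scale c v + y)) i = scale c (a * coeff (\<theta> r) i) + coeff (\<theta> y) i"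
      by (subst scale_conv_mult[of c v], subst scale_conv_mult)
        (simp add: add mult fix0 *(1) fixP[OF *(2)])
    show ?case
    proof (cases "i \<le> e")
      case True
      then have "a * coeff (\<theta> r) i \<in> ideal_part P (d - i)"
        using ideal_part_mult_gen[OF *(2) grade[OF *(3) True]] *(4) by simp
      then show ?thesis
        unfolding eq using step(2) True *(4)
          by (auto intro!: subspace_add subspace_scale subspace_ideal_part)
    next
      case False
      then show ?thesis unfolding eq using step(2) vanish[OF *(3)] by simp
    qed
  qed
  have "coeff (\<theta> f) i \<in> ideal_part P (d - i)" if "i \<le> d" for i
    using that
  proof (induction "d - i" arbitrary: i)
    case 0
    then have "i = d" by simp
    have "coeff (\<theta> (x * f)) (Suc d) \<in> ideal_part P 0" using stable[OF f(2), of "Suc d"] by simp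
    then show ?case
      unfolding \<open>i = d\<close> using vanish[OF f(1)] by (simp add: mult \<theta>x)
  next
    case (Suc k)
    then have "coeff (\<theta> f) (Suc i) \<in> ideal_part P (d - Suc i)" by simp
    then have "x * coeff (\<theta> f) (Suc i) \<in> ideal_part P (d - i)"
      using ideal_part_mult[OF x(1)] Suc
        by (metis Suc_diff_Suc plus_1_eq_Suc zero_less_Suc zero_less_diff)
    moreover have "coeff (\<theta> (x * f)) (Suc i) \<in> ideal_part P (d - i)"
      using stable[OF f(2), of "Suc i"] Suc by simp
    ultimately have "coeff (\<theta> (x * f)) (Suc i) - x * coeff (\<theta> f) (Suc i) \<in> ideal_part P (d - i)"
      by (intro subspace_diff subspace_ideal_part)
    then show ?case by (simp add: mult \<theta>x)
  qed
  from this[of 0] show ?thesis using const[OF f(1)] by simp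
qed

end

section \<open>The cube complex\<close>

text \<open>
  The sign of the map from \<open>insert s X\<close> to \<open>X\<close>: a Koszul sign, counting the elements of \<open>X\<close> before
  \<open>s\<close>.
\<close>

definition csign :: "nat \<Rightarrow> nat set \<Rightarrow> 'a::comm_ring_1" where
  "csign s X = (- 1) ^ card {j \<in> X. j < s}"

definition boundary :: "nat set \<Rightarrow> (nat set \<Rightarrow> 'a::comm_ring_1) \<Rightarrow> nat set \<Rightarrow> 'a" where
  "boundary S z X = (\<Sum>s\<in>S - X. csign s X * z (insert s X))"

definition homotopy :: "'a::comm_ring_1 \<Rightarrow> nat \<Rightarrow> (nat set \<Rightarrow> 'a) \<Rightarrow> nat set \<Rightarrow> 'a" where
  "homotopy u s z X = (if s \<in> X then csign s X * (u * z (X - {s})) else 0)"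

lemma csign_cases: "(csign s X :: 'a::comm_ring_1) = 1 \<or> (csign s X :: 'a) = - 1"
  unfolding csign_def by (rule minus_one_power_iff[THEN ssubst]) auto

lemma csign_square: "csign s X * (csign s X * v) = (v :: 'a::comm_ring_1)"
  by (simp add: csign_def flip: mult.assoc power_mult_distrib)

lemma csign_insert:
  assumes "finite X" "t \<notin> X"
  shows "csign s (insert t X) = (if t < s then - csign s X else csign s X)"
proof -
  have "{j \<in> insert t X. j < s} = (if t < s then insert t {j \<in> X. j < s} else {j \<in> X. j < s})"
    by auto
  then show ?thesis using assms by (simp add: csign_def)
qed

lemma csign_insert_self: "csign s (insert s X) = csign s X"
  unfolding csign_def by (rule arg_cong[where f = "\<lambda>A. (- 1) ^ card A"]) auto

lemma csign_swap:
  assumes "finite X" "s \<notin> X" "t \<notin> X" "s \<noteq> t"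
  shows "csign s X * csign t (insert s X) = - (csign t X * csign s (insert t X))"
  using assms by (auto simp: csign_insert)

lemma boundary_diff: "boundary S (\<lambda>X. z X - w X) X = boundary S z X - boundary S w X"
  by (simp add: boundary_def right_diff_distrib sum_subtractf)

lemma boundary_add: "boundary S (\<lambda>X. z X + w X) X = boundary S z X + boundary S w X"
  by (simp add: boundary_def distrib_left sum.distrib)

lemma boundary_sum: "boundary S (\<lambda>X. \<Sum>i\<in>I. z i X) X = (\<Sum>i\<in>I. boundary S (z i) X)"
  unfolding boundary_def by (subst sum.swap) (simp add: sum_distrib_left)

lemma boundary_mult: "boundary S (\<lambda>X. x * z X) X = x * boundary S z X"
  by (simp add: boundary_def sum_distrib_left ac_simps)

text \<open>
  Removing two elements in the two possible orders gives opposite signs, so the double sum cancels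
  in pairs \<open>t < s\<close> and \<open>s < t\<close>.
\<close>

lemma boundary_boundary:
  fixes z :: "nat set \<Rightarrow> 'a::comm_ring_1"
  assumes "finite S" "X \<subseteq> S"
  shows "boundary S (boundary S z) X = 0"
proof -
  define D where "D = S - X"
  define f where "f s t = csign s X * (csign t (insert s X) * z (insert t (insert s X)))" for s t
  have fin: "finite D" "finite X" using assms finite_subset unfolding D_def by auto
  have "boundary S (boundary S z) X = (\<Sum>s\<in>D. \<Sum>t\<in>D - {s}. f s t)"
    unfolding boundary_def D_def f_def sum_distrib_left Diff_insert[of S _ X] ..
  also have "\<dots> = (\<Sum>s\<in>D. \<Sum>t\<in>{t \<in> D. t < s}. f s t) + (\<Sum>s\<in>D. \<Sum>t\<in>{t \<in> D. s < t}. f s t)"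
  proof -
    have split: "D - {s} = {t \<in> D. t < s} \<union> {t \<in> D. s < t}" for s by auto
    have "(\<Sum>t\<in>D - {s}. f s t) = (\<Sum>t\<in>{t \<in> D. t < s}. f s t) + (\<Sum>t\<in>{t \<in> D. s < t}. f s t)" for s
      unfolding split using fin(1) by (intro sum.union_disjoint) auto
    then show ?thesis by (simp add: sum.distrib)
  qed
  also have "(\<Sum>s\<in>D. \<Sum>t\<in>{t \<in> D. t < s}. f s t) = (\<Sum>t\<in>D. \<Sum>s\<in>{s \<in> D. t < s}. f s t)"
    using fin by (intro sum.swap_restrict)
  also have "\<dots> = (\<Sum>s\<in>D. \<Sum>t\<in>{t \<in> D. s < t}. - f s t)"
  proof (intro sum.cong refl)
    fix t s assume "t \<in> D" "s \<in> {s \<in> D. t < s}"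
    then show "f s t = - f t s"
      using csign_swap[OF fin(2), of s t, where 'a = 'a]
      by (simp add: f_def D_def insert_commute[of t s] flip: mult.assoc)
  qed
  also have "\<dots> + (\<Sum>s\<in>D. \<Sum>t\<in>{t \<in> D. s < t}. f s t) = 0"
    by (simp add: sum_negf)
  finally show ?thesis .
qed

text \<open>
  The homotopy puts \<open>s\<close> into the set and the boundary takes an element out. Taking \<open>s\<close> out again
  contributes \<open>u z\<close>; the terms for \<open>t \<noteq> s\<close> occur in both orders, with opposite signs.
\<close>

lemma homotopy_boundary:
  fixes z :: "nat set \<Rightarrow> 'a::comm_ring_1"
  assumes "finite S" "X \<subseteq> S" "s \<in> S"
  shows "boundary S (homotopy u s z) X + homotopy u s (boundary S z) X = u * z X"
proof (cases "s \<in> X")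
  case False
  have "boundary S (homotopy u s z) X =
      (\<Sum>t\<in>S - X. if t = s then csign t X * homotopy u s z (insert t X) else 0)"
    unfolding boundary_def using False by (intro sum.cong) (auto simp: homotopy_def)
  also have "\<dots> = csign s X * homotopy u s z (insert s X)"
    using assms False by simp
  also have "\<dots> = u * z X"
    using False by (simp add: homotopy_def csign_insert_self csign_square)
  finally show ?thesis using False by (simp add: homotopy_def)
next
  case True
  define Y where "Y = X - {s}"
  have Y: "X = insert s Y" "s \<notin> Y" "finite Y"
    using True assms finite_subset unfolding Y_def by auto
  have SY: "S - Y = insert s (S - X)" "s \<notin> S - X" "finite (S - X)"
    using assms Y by auto
  have "boundary S (homotopy u s z) X =
      (\<Sum>t\<in>S - X. csign t X * (csign s (insert t X) * (u * z (insert t Y))))"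
    unfolding boundary_def
  proof (intro sum.cong refl)
    fix t assume "t \<in> S - X"
    then have "insert t X - {s} = insert t Y" using Y by auto
    then show "csign t X * homotopy u s z (insert t X) =
        csign t X * (csign s (insert t X) * (u * z (insert t Y)))"
      using True by (simp add: homotopy_def)
  qed
  also have "\<dots> = (\<Sum>t\<in>S - X. - (csign s Y * (u * (csign t Y * z (insert t Y)))))"
  proof (intro sum.cong refl)
    fix t assume t: "t \<in> S - X"
    then have ts: "t \<noteq> s" "t \<notin> Y" using Y by auto
    have "csign s (insert t X) = (csign s (insert t Y) :: 'a)"
      unfolding Y(1) insert_commute[of t s] by (rule csign_insert_self)
    moreover have "csign t X * csign s (insert t Y) = (- (csign s Y * csign t Y) :: 'a)"
      unfolding Y(1) using ts Y by (auto simp: csign_insert)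
    ultimately have "csign t X * csign s (insert t X) = (- (csign s Y * csign t Y) :: 'a)"
      by simp
    then show "csign t X * (csign s (insert t X) * (u * z (insert t Y))) =
        - (csign s Y * (u * (csign t Y * z (insert t Y))))"
      by (simp add: algebra_simps)
        (metis (no_types, opaque_lifting) mult.assoc mult.commute mult_minus_left)
  qed
  also have "\<dots> = - (csign s Y * (u * (\<Sum>t\<in>S - X. csign t Y * z (insert t Y))))"
    by (simp add: sum_negf sum_distrib_left)
  finally have 1: "boundary S (homotopy u s z) X = \<dots>" .
  have "boundary S z Y = csign s Y * z X + (\<Sum>t\<in>S - X. csign t Y * z (insert t Y))"
    unfolding boundary_def SY(1) using SY(2,3) Y(1) by simp
  then have "homotopy u s (boundary S z) X =
      csign s Y * (u * (csign s Y * z X + (\<Sum>t\<in>S - X. csign t Y * z (insert t Y))))"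
    using True Y unfolding homotopy_def Y_def[symmetric] by (simp add: csign_insert_self)
  then have "homotopy u s (boundary S z) X =
      u * z X + csign s Y * (u * (\<Sum>t\<in>S - X. csign t Y * z (insert t Y)))"
    by (simp add: distrib_left mult.left_commute[of u] csign_square)
  then show ?thesis unfolding 1 by simp
qed

section \<open>Exactness for products of linear ideals\<close>

locale linear_ideals = graded_algebra scale gr
  for scale :: "'k::field \<Rightarrow> 'a::comm_ring_1 \<Rightarrow> 'a" and gr :: "nat \<Rightarrow> 'a set" +
  fixes G :: "nat \<Rightarrow> 'a set"
  assumes subspace_G: "subspace (G i)" and G_gr: "G i \<subseteq> gr 1"
begin

text \<open>
  Throughout, \<open>N\<close> is a space of linear forms, and statements about \<open>prod_part X\<close>, the product of
  the ideals generated by \<open>G i\<close> for \<open>i \<in> X\<close>, are made modulo \<open>lin_part N\<close>, the ideal generated by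
  \<open>N\<close>. This amounts to working in the quotient by \<open>N\<close>, whose dimension drops when \<open>N\<close> grows.
\<close>

definition lspan :: "'a set \<Rightarrow> nat set \<Rightarrow> 'a set" where
  "lspan N X = span (N \<union> (\<Union>i\<in>X. G i))"

definition prod_gens :: "nat set \<Rightarrow> (nat \<times> 'a) set" where
  "prod_gens X = {(card X, prod g X) | g. \<forall>i\<in>X. g i \<in> G i}"

definition prod_part :: "nat set \<Rightarrow> nat \<Rightarrow> 'a set" where
  "prod_part X = ideal_part (prod_gens X)"

definition lin_part :: "'a set \<Rightarrow> nat \<Rightarrow> 'a set" where
  "lin_part N = ideal_part ({1} \<times> N)"

definition sum_part :: "'a set \<Rightarrow> nat set \<Rightarrow> nat \<Rightarrow> 'a set" where
  "sum_part N X = ideal_part (prod_gens X \<union> {1} \<times> N)"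

lemma subspace_ideals: "subspace (prod_part X d)" "subspace (lin_part N d)" "subspace (sum_part N X d)"
  unfolding prod_part_def lin_part_def sum_part_def by (rule subspace_ideal_part)+

lemma prod_part_sub_sum: "prod_part X d \<subseteq> sum_part N X d"
  unfolding prod_part_def sum_part_def by (rule ideal_part_mono) simp

lemma lin_part_sub_sum: "lin_part N d \<subseteq> sum_part N X d"
  unfolding lin_part_def sum_part_def by (rule ideal_part_mono) simp

lemma sum_part_E:
  assumes "v \<in> sum_part N X d"
  obtains a where "a \<in> prod_part X d" "v - a \<in> lin_part N d"
  using assms unfolding sum_part_def prod_part_def lin_part_def
    by (rule ideal_part_UnE) (use that in \<open>auto simp: prod_part_def lin_part_def\<close>)

lemma lin_part_mono: "N \<subseteq> N' \<Longrightarrow> lin_part N d \<subseteq> lin_part N' d"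
  unfolding lin_part_def by (rule ideal_part_mono) auto

lemma sum_part_mono: "N \<subseteq> N' \<Longrightarrow> sum_part N X d \<subseteq> sum_part N' X d"
  unfolding sum_part_def by (rule ideal_part_mono) auto

lemma subspace_lspan: "subspace (lspan N X)"
  unfolding lspan_def by (rule subspace_span)

lemma lspan_mono: "N \<subseteq> N' \<Longrightarrow> X \<subseteq> Y \<Longrightarrow> lspan N X \<subseteq> lspan N' Y"
  unfolding lspan_def by (rule span_mono) blast

lemma lspan_gr: "N \<subseteq> gr 1 \<Longrightarrow> lspan N X \<subseteq> gr 1"
  unfolding lspan_def using G_gr by (intro span_minimal subspace_gr) auto

lemma lspan_empty: "subspace N \<Longrightarrow> lspan N {} = N"
  unfolding lspan_def using span_eq_iff by simp

lemma gens_form_products: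
  assumes "finite X"
  shows "prod_gens X \<union> {1} \<times> N \<subseteq> form_products (lspan N X)"
proof -
  have "N \<subseteq> lspan N X" and G: "\<And>i. i \<in> X \<Longrightarrow> G i \<subseteq> lspan N X"
    unfolding lspan_def using span_superset[of "N \<union> (\<Union>i\<in>X. G i)"] by blast+
  then have "{1} \<times> N \<subseteq> form_products (lspan N X)" using form_products_single by blast
  moreover have "prod_gens X \<subseteq> form_products (lspan N X)"
    unfolding prod_gens_def using form_products_prod[OF assms, of _ "lspan N X"] G by blast
  ultimately show ?thesis by blast
qed

lemma gens_gr:
  assumes "finite X" "N \<subseteq> gr 1" "(k, a) \<in> prod_gens X \<union> {1} \<times> N"
  shows "a \<in> gr k"
  using form_products_gr[OF lspan_gr[OF assms(2)]] gens_form_products[OF assms(1), of N] assms(3) by blast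

lemma sum_part_gr: "finite X \<Longrightarrow> N \<subseteq> gr 1 \<Longrightarrow> sum_part N X d \<subseteq> gr d"
  unfolding sum_part_def by (rule ideal_part_subset_gr) (rule gens_gr)

lemma prod_part_empty: "gr d \<subseteq> prod_part {} d"
proof
  fix r assume "r \<in> gr d"
  moreover have "(0, 1) \<in> prod_gens {}" unfolding prod_gens_def by simp
  ultimately show "r \<in> prod_part {} d" unfolding prod_part_def
    using ideal_part_mult_gen[of 0 1 "prod_gens {}" r d] by simp
qed

lemma sum_part_insert_mult:
  assumes "finite X" "s \<notin> X" "u \<in> G s" "v \<in> sum_part N X d"
  shows "u * v \<in> sum_part N (insert s X) (Suc d)"
  using assms(4) unfolding sum_part_def ideal_part_def[of _ d]
  unfolding ideal_part_def
proof (rule mult_in_span[rotated])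
  fix v assume "v \<in> {a * r | k a e r. (k, a) \<in> prod_gens X \<union> {1} \<times> N \<and> r \<in> gr e \<and> d = k + e}"
  then obtain k a e r where v: "v = a * r" "(k, a) \<in> prod_gens X \<union> {1} \<times> N" "r \<in> gr e" "d = k + e"
    by blast
  let ?Q = "prod_gens (insert s X) \<union> {1} \<times> N"
  have "u * v \<in> ideal_part ?Q (Suc d)"
  proof (cases "(k, a) \<in> prod_gens X")
    case True
    then obtain g where g: "k = card X" "a = prod g X" "\<forall>i\<in>X. g i \<in> G i"
      unfolding prod_gens_def by blast
    define g' where "g' = g(s := u)"
    have "prod g' (insert s X) = u * a"
      unfolding g'_def using assms(1,2) g(2)
        by (simp add: prod.insert_if, intro arg_cong[where f = "(*) u"] prod.cong) auto
    moreover have "card (insert s X) = Suc k" using assms(1,2) g(1) by simp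
    moreover have "\<forall>i\<in>insert s X. g' i \<in> G i" unfolding g'_def using g(3) assms(3) by simp
    ultimately have "(Suc k, u * a) \<in> ?Q" unfolding prod_gens_def
      by (intro UnI1 CollectI exI[of _ g']) simp
    then show ?thesis using ideal_part_mult_gen[of "Suc k" "u * a" ?Q r e] v
      by (simp add: mult.assoc)
  next
    case False
    then have k: "(1, a) \<in> ?Q" "k = 1" using v(2) by auto
    have "u * r \<in> gr (1 + e)" using gr_mult v(3) assms(3) G_gr by blast
    then have "a * (u * r) \<in> ideal_part ?Q (1 + (1 + e))" by (rule ideal_part_mult_gen[OF k(1)])
    then show ?thesis using v k(2) by (simp add: ac_simps)
  qed
  then show "u * v \<in> span {a * r | k a e r. (k, a) \<in> ?Q \<and> r \<in> gr e \<and> Suc d = k + e}"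
    unfolding ideal_part_def .
qed

lemma prod_gr: "finite X \<Longrightarrow> \<forall>i\<in>X. g i \<in> G i \<Longrightarrow> prod g X \<in> gr (card X)"
  by (rule gens_gr[of X "{}"]) (auto simp: prod_gens_def)

lemma prod_part_anti_mono:
  assumes "X \<subseteq> Y" "finite Y"
  shows "prod_part Y d \<subseteq> prod_part X d"
  unfolding prod_part_def
proof (rule ideal_part_le)
  fix k a assume "(k, a) \<in> prod_gens Y"
  then obtain g where g: "k = card Y" "a = prod g Y" "\<forall>i\<in>Y. g i \<in> G i"
    unfolding prod_gens_def by blast
  have fin: "finite X" "finite (Y - X)" using assms finite_subset by auto
  have "(card X, prod g X) \<in> prod_gens X" using g(3) assms(1) unfolding prod_gens_def by blast
  then have "prod g X * prod g (Y - X) \<in> ideal_part (prod_gens X) (card X + card (Y - X))"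
    using g(3) fin(2) by (intro ideal_part_mult_gen prod_gr) auto
  moreover have "card X + card (Y - X) = k"
    using g(1) fin card_Diff_subset[OF fin(1) assms(1)] card_mono[OF assms(2,1)] by simp
  moreover have "prod g X * prod g (Y - X) = a"
    using g(2) assms prod.subset_diff[of X Y g] by (simp add: mult.commute)
  ultimately show "a \<in> ideal_part (prod_gens X) k" by simp
qed

lemma sum_part_anti_mono:
  assumes "X \<subseteq> Y" "finite Y"
  shows "sum_part N Y d \<subseteq> sum_part N X d"
proof
  fix v assume "v \<in> sum_part N Y d"
  then obtain a where a: "a \<in> prod_part Y d" "v - a \<in> lin_part N d" by (rule sum_part_E)
  have "a \<in> sum_part N X d" "v - a \<in> sum_part N X d"
    using a prod_part_anti_mono[OF assms] prod_part_sub_sum lin_part_sub_sum by blast+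
  then have "a + (v - a) \<in> sum_part N X d" by (rule subspace_add[OF subspace_ideals(3)])
  then show "v \<in> sum_part N X d" by simp
qed

lemma sum_part_nonzerodivisor:
  assumes "finite X" "N \<subseteq> gr 1" "x \<in> gr 1" "x \<notin> lspan N X" "f \<in> gr d" "x * f \<in> sum_part N X (Suc d)"
  shows "f \<in> sum_part N X d"
  using assms(6) unfolding sum_part_def
  by (rule ideal_part_nonzerodivisor[OF subspace_lspan lspan_gr[OF assms(2)] assms(3,4) gens_form_products[OF assms(1)] assms(5)])

lemma lin_part_nonzerodivisor:
  assumes "subspace N" "N \<subseteq> gr 1" "x \<in> gr 1" "x \<notin> N" "f \<in> gr d" "x * f \<in> lin_part N (Suc d)"
  shows "f \<in> lin_part N d"
proof -
  have "{1} \<times> N \<subseteq> form_products N" using form_products_single by blast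
  then show ?thesis
    using ideal_part_nonzerodivisor[OF assms(1-4) _ assms(5)] assms(6)
      unfolding lin_part_def by blast
qed

text \<open>
  Passing from \<open>N\<close> to \<open>N + K x\<close> adds the multiples of \<open>x\<close>, and in each degree a single multiple
  suffices.
\<close>

lemma lin_part_insertE:
  assumes "x \<in> gr 1" "v \<in> lin_part (span (insert x N)) (Suc d)"
  obtains q where "q \<in> gr d" "v - x * q \<in> lin_part N (Suc d)"
proof -
  have "\<exists>q. q \<in> gr d \<and> v - x * q \<in> lin_part N (Suc d)"
    using assms(2) unfolding lin_part_def ideal_part_def[of "{1} \<times> span (insert x N)"]
  proof (induction rule: span_induct_alt)
    case base
    then show ?case using subspace_0[OF subspace_gr] subspace_0[OF subspace_ideal_part]
      by (intro exI[of _ 0]) simp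
  next
    case (step c v y)
    then obtain b r where br: "v = b * r" "b \<in> span (insert x N)" "r \<in> gr d" by auto
    obtain q where q: "q \<in> gr d" "y - x * q \<in> ideal_part ({1} \<times> N) (Suc d)" using step(2) by blast
    obtain k where "b - scale k x \<in> span N" using br(2) by (auto simp: span_insert)
    then have "r * (b - scale k x) \<in> ideal_part ({1} \<times> N) (Suc d)"
      unfolding ideal_part_def
    proof (rule mult_in_span[rotated])
      fix b assume "b \<in> N"
      then show "r * b \<in> span {a * r | k a e r. (k, a) \<in> {1} \<times> N \<and> r \<in> gr e \<and> Suc d = k + e}"
        using br(3) by (intro span_base) (force simp: mult.commute)
    qed
    then have "scale c (r * (b - scale k x)) + (y - x * q) \<in> ideal_part ({1} \<times> N) (Suc d)"
      using q(2) by (intro subspace_add subspace_scale subspace_ideal_part)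
    moreover have "scale c (r * (b - scale k x)) + (y - x * q) = scale c v + y - x * (scale c (scale k r) + q)"
    proof -
      have "r * scale k x = x * scale k r" by (metis mult.commute scale_mult)
      then have "scale c (r * scale k x) = x * scale c (scale k r)"
        by (metis mult.commute scale_mult)
      then show ?thesis by (simp add: br(1) algebra_simps)
    qed
    moreover have "scale c (scale k r) + q \<in> gr d"
      using br(3) q(1) by (intro subspace_add subspace_scale subspace_gr)
    ultimately show ?case by metis
  qed
  then show ?thesis using that by blast
qed

lemma sign_subspace: "subspace U \<Longrightarrow> v \<in> U \<Longrightarrow> csign s X * v \<in> U"
  using csign_cases[of s X, where 'a = 'a] subspace_neg[of U v] by auto

lemma sign_subspaceD:
  assumes "subspace U" "csign s X * v \<in> U"
  shows "v \<in> U"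
  using sign_subspace[OF assms, of s X] by (simp add: csign_square)

lemma boundary_in_subspace:
  assumes "subspace U" "\<And>s. s \<in> S - X \<Longrightarrow> z (insert s X) \<in> U"
  shows "boundary S z X \<in> U"
  unfolding boundary_def using assms by (intro subspace_sum sign_subspace) auto

text \<open>
  Exactness of the cube complex in degree \<open>d\<close> modulo \<open>N\<close>. That \<open>w\<close> is taken in \<open>prod_part\<close> and not
  in the larger \<open>sum_part\<close> makes it independent of \<open>N\<close>, so that a \<open>w\<close> found for a larger \<open>N\<close> can
  be used.
\<close>

definition exact_mod :: "'a set \<Rightarrow> nat set \<Rightarrow> nat \<Rightarrow> bool" where
  "exact_mod N S d \<longleftrightarrow> (\<forall>z. (\<forall>X\<subseteq>S. z X \<in> sum_part N X d) \<and> (\<forall>X\<subseteq>S. boundary S z X \<in> lin_part N d) \<longrightarrow>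
     (\<exists>w. (\<forall>X\<subseteq>S. w X \<in> prod_part X d) \<and> (\<forall>X\<subseteq>S. z X - boundary S w X \<in> lin_part N d)))"

text \<open>
  If the linear forms at hand do not span, then \<open>x\<close> is a nonzerodivisor. If they do, then by
  induction \<open>f\<close> lies in \<open>sum_part N (X - {i})\<close> for all \<open>i\<close>. The family that is \<open>f\<close>, up to sign, at
  the sets \<open>X - {i}\<close> is a cycle, being the formal boundary of \<open>f\<close> placed at \<open>X\<close>. By exactness it
  is the boundary of a family in the complex, whose entry at \<open>X\<close> is therefore congruent to \<open>f\<close>.
\<close>

lemma regular_cancel:
  assumes "finite X" and N: "subspace N" "N \<subseteq> gr 1" and x: "x \<in> gr 1"
    and avoid: "\<And>A. A \<subseteq> X \<Longrightarrow> \<not> gr 1 \<subseteq> lspan N A \<Longrightarrow> x \<notin> lspan N A"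
    and exact_mod: "\<And>S. S \<subseteq> X \<Longrightarrow> S \<noteq> {} \<Longrightarrow> gr 1 \<subseteq> lspan N S \<Longrightarrow> card S \<le> d \<Longrightarrow> exact_mod N S d"
    and f: "card X \<le> d" "f \<in> gr d" "x * f \<in> sum_part N X (Suc d)"
  shows "f \<in> sum_part N X d"
  using assms(1) avoid exact_mod f(1,3)
proof (induction X rule: finite_psubset_induct)
  case (psubset X)
  show ?case
  proof (cases "gr 1 \<subseteq> lspan N X")
    case False
    then show ?thesis
      using sum_part_nonzerodivisor[OF psubset.hyps(1) N(2) x _ f(2)] psubset.prems by blast
  next
    case full: True
    show ?thesis
    proof (cases "X = {}")
      case True
      then show ?thesis using f(2) prod_part_empty prod_part_sub_sum by blast
    next
      case False
      have f_in: "f \<in> sum_part N (X - {i}) d" if i: "i \<in> X" for i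
      proof (rule psubset.IH)
        show "card (X - {i}) \<le> d" using psubset.prems(3) card_Diff1_le[of X i] by simp
        show "x * f \<in> sum_part N (X - {i}) (Suc d)"
          using psubset.prems(4) sum_part_anti_mono[of "X - {i}" X] psubset.hyps by blast
      qed (use i psubset.prems in blast)+
      define v where "v Y = (if Y = X then f else 0)" for Y
      have "boundary X v Y \<in> sum_part N Y d" if "Y \<subseteq> X" for Y
      proof (rule boundary_in_subspace[OF subspace_ideals(3)])
        fix s assume s: "s \<in> X - Y"
        show "v (insert s Y) \<in> sum_part N Y d"
        proof (cases "insert s Y = X")
          case True
          then have "Y = X - {s}" using s by auto
          then show ?thesis using f_in[of s] s True by (simp add: v_def)
        next
          case False
          then show ?thesis using subspace_0[OF subspace_ideals(3)] by (simp add: v_def)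
        qed
      qed
      moreover have "boundary X (boundary X v) Y \<in> lin_part N d" if "Y \<subseteq> X" for Y
        using boundary_boundary[OF psubset.hyps(1) that, of v] subspace_0[OF subspace_ideals(2), of N d]
        by simp
      moreover have "exact_mod N X d"
        using psubset.prems full False by blast
      ultimately obtain w where w: "\<And>Y. Y \<subseteq> X \<Longrightarrow> w Y \<in> prod_part Y d"
        "\<And>Y. Y \<subseteq> X \<Longrightarrow> boundary X v Y - boundary X w Y \<in> lin_part N d"
        unfolding exact_mod_def by (metis (no_types, lifting))
      obtain s where s: "s \<in> X" using False by blast
      have bd: "boundary X z (X - {s}) = csign s (X - {s}) * z X" for z :: "nat set \<Rightarrow> 'a"
      proof -
        have "X - (X - {s}) = {s}" "insert s (X - {s}) = X" using s by auto
        then show ?thesis by (simp add: boundary_def)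
      qed
      have "csign s (X - {s}) * (f - w X) \<in> lin_part N d"
        using w(2)[of "X - {s}"] unfolding bd by (simp add: v_def right_diff_distrib)
      then have "f - w X \<in> lin_part N d" by (rule sign_subspaceD[OF subspace_ideals(2)])
      then have "(f - w X) + w X \<in> sum_part N X d"
        using w(1)[of X] lin_part_sub_sum prod_part_sub_sum
          by (intro subspace_add subspace_ideals) blast+
      then show ?thesis by simp
    qed
  qed
qed


lemma lspan_insertE:
  assumes "finite S" "x \<in> lspan N S" "subspace N"
  obtains b u where "b \<in> N" "\<And>s. s \<in> S \<Longrightarrow> u s \<in> G s" "x = b + (\<Sum>s\<in>S. u s)"
proof -
  have "\<exists>b u. b \<in> N \<and> (\<forall>s\<in>S. u s \<in> G s) \<and> x = b + (\<Sum>s\<in>S. u s)"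
    using assms(1,2)
  proof (induction S arbitrary: x)
    case empty
    then show ?case using lspan_empty[OF assms(3)] by auto
  next
    case (insert s S)
    have "lspan N (insert s S) = span (G s \<union> (N \<union> (\<Union>i\<in>S. G i)))"
      unfolding lspan_def by (rule arg_cong[where f = span]) auto
    then obtain a y where ay: "x = a + y" "a \<in> span (G s)" "y \<in> lspan N S"
      using insert.prems unfolding lspan_def span_Un by auto
    have a: "a \<in> G s" using ay(2) subspace_G[of s] span_eq_iff[of "G s"] by metis
    obtain b u where bu: "b \<in> N" "\<forall>s\<in>S. u s \<in> G s" "y = b + (\<Sum>s\<in>S. u s)"
      using insert.IH[OF ay(3)] by blast
    have "(\<Sum>t\<in>insert s S. (u(s := a)) t) = a + (\<Sum>t\<in>S. u t)"
      using insert.hyps by (simp, intro sum.cong) auto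
    then have "x = b + (\<Sum>t\<in>insert s S. (u(s := a)) t)" using ay bu by simp
    then show ?case using bu(1,2) a insert.hyps by (intro exI[of _ b] exI[of _ "u(s := a)"]) auto
  qed
  then show ?thesis using that by blast
qed

text \<open>
  The passage from \<open>N + K x\<close> to \<open>N\<close>. The degree bound \<open>card S \<le> d\<close> is just enough: \<open>x\<close> has to be
  cancelled in degree \<open>d - 1\<close>, for which \<open>card X \<le> d - 1\<close> is required. This fails only for
  \<open>X = S\<close>, where the entry of a cycle vanishes modulo \<open>N\<close> anyway, as the map out of the last term
  of the complex is injective.
\<close>

lemma exactness_step:
  assumes S: "finite S" "S \<noteq> {}" and N: "subspace N" "N \<subseteq> gr 1" and full: "gr 1 \<subseteq> lspan N S"
    and d: "card S \<le> d" and x: "x \<in> gr 1"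
    and avoid: "\<And>A. A \<subseteq> S \<Longrightarrow> \<not> gr 1 \<subseteq> lspan N A \<Longrightarrow> x \<notin> lspan N A" and xN: "x \<notin> N"
    and exact': "exact_mod (span (insert x N)) S d"
    and exact_smaller: "\<And>S' d. S' \<subset> S \<Longrightarrow> S' \<noteq> {} \<Longrightarrow> gr 1 \<subseteq> lspan N S' \<Longrightarrow> card S' \<le> d \<Longrightarrow> exact_mod N S' d"
  shows "exact_mod N S d"
  unfolding exact_mod_def
proof (intro allI impI, elim conjE)
  fix z assume z: "\<forall>X\<subseteq>S. z X \<in> sum_part N X d" and bz: "\<forall>X\<subseteq>S. boundary S z X \<in> lin_part N d"
  let ?N' = "span (insert x N)"
  have NN': "N \<subseteq> ?N'" using span_superset[of "insert x N"] by blast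
  have "0 < card S" using S by (simp add: card_gt_0_iff)
  then obtain e where e: "d = Suc e" using d by (cases d) auto
  obtain w where w: "\<forall>X\<subseteq>S. w X \<in> prod_part X d" "\<forall>X\<subseteq>S. z X - boundary S w X \<in> lin_part ?N' d"
  proof -
    have "\<forall>X\<subseteq>S. z X \<in> sum_part ?N' X d"
      using z by (intro allI impI subsetD[OF sum_part_mono[OF NN']]) simp
    moreover have "\<forall>X\<subseteq>S. boundary S z X \<in> lin_part ?N' d"
      using bz by (intro allI impI subsetD[OF lin_part_mono[OF NN']]) simp
    ultimately have "\<exists>w. (\<forall>X\<subseteq>S. w X \<in> prod_part X d) \<and> (\<forall>X\<subseteq>S. z X - boundary S w X \<in> lin_part ?N' d)"
      using exact'[unfolded exact_mod_def, THEN spec, THEN mp, of z] by simp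
    then show ?thesis using that by (elim exE conjE)
  qed
  define y where "y X = z X - boundary S w X" for X
  have bw: "boundary S w X \<in> sum_part N X d" if "X \<subseteq> S" for X
  proof (rule boundary_in_subspace[OF subspace_ideals(3)])
    fix s assume "s \<in> S - X"
    then have "insert s X \<subseteq> S" using that by blast
    moreover have "finite (insert s X)" using that S(1) finite_subset by auto
    ultimately show "w (insert s X) \<in> sum_part N X d"
      using w(1) by (intro subsetD[OF prod_part_sub_sum] subsetD[OF prod_part_anti_mono[of X "insert s X"]]) auto
  qed
  have y: "y X \<in> sum_part N X d" if "X \<subseteq> S" for X
    unfolding y_def using z bw[OF that] that by (intro subspace_diff subspace_ideals) simp_all
  have by_: "boundary S y X \<in> lin_part N d" if "X \<subseteq> S" for X
  proof -
    have "boundary S y X = boundary S z X"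
      unfolding y_def boundary_diff using boundary_boundary[OF S(1) that, of w] by simp
    then show ?thesis using bz that by simp
  qed
  \<comment> \<open>the last term of the complex carries no cycles\<close>
  have yS: "y S \<in> lin_part N d"
  proof -
    obtain s where s: "s \<in> S" using S(2) by blast
    have "S - (S - {s}) = {s}" "insert s (S - {s}) = S" using s by auto
    then have "boundary S y (S - {s}) = csign s (S - {s}) * y S" by (simp add: boundary_def)
    moreover have "boundary S y (S - {s}) \<in> lin_part N d" by (rule by_) blast
    ultimately show ?thesis using sign_subspaceD[OF subspace_ideals(2)] by metis
  qed
  have ex_q: "\<exists>q. q \<in> gr e \<and> y X - x * q \<in> lin_part N d \<and> (X = S \<longrightarrow> q = 0)" if X: "X \<subseteq> S" for X
  proof (cases "X = S")
    case True
    then show ?thesis using yS subspace_0[OF subspace_gr] by (intro exI[of _ 0]) simp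
  next
    case False
    have "y X \<in> lin_part ?N' (Suc e)" using w(2) X unfolding y_def e by blast
    then show ?thesis using lin_part_insertE[OF x] False unfolding e by metis
  qed
  have "\<forall>X. \<exists>q. X \<subseteq> S \<longrightarrow> q \<in> gr e \<and> y X - x * q \<in> lin_part N d \<and> (X = S \<longrightarrow> q = 0)"
    using ex_q by blast
  from choice[OF this] obtain q where q: "\<And>X. X \<subseteq> S \<Longrightarrow> q X \<in> gr e"
    "\<And>X. X \<subseteq> S \<Longrightarrow> y X - x * q X \<in> lin_part N d" "q S = 0" by blast
  \<comment> \<open>the cofactor \<open>q\<close> of \<open>x\<close> is again a cycle of the complex, in degree \<open>e = d - 1\<close>\<close>
  have qM: "q X \<in> sum_part N X e" if X: "X \<subseteq> S" for X
  proof (cases "X = S")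
    case True
    then show ?thesis using q(3) subspace_0[OF subspace_ideals(3)] by simp
  next
    case False
    then have XS: "X \<subset> S" using X by blast
    have "card X < card S" using XS S(1) psubset_card_mono by blast
    then have cX: "card X \<le> e" using d e by simp
    have "y X - (y X - x * q X) \<in> sum_part N X d"
      by (rule subspace_diff[OF subspace_ideals(3) y[OF X] subsetD[OF lin_part_sub_sum q(2)[OF X]]])
    then have xq: "x * q X \<in> sum_part N X (Suc e)" using e by simp
    show ?thesis
    proof (rule regular_cancel[OF finite_subset[OF X S(1)] N x _ _ cX q(1)[OF X] xq])
      show "x \<notin> lspan N A" if "A \<subseteq> X" "\<not> gr 1 \<subseteq> lspan N A" for A
        using avoid that X by blast
      show "exact_mod N S' e" if "S' \<subseteq> X" "S' \<noteq> {}" "gr 1 \<subseteq> lspan N S'" "card S' \<le> e" for S'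
        using exact_smaller that XS by blast
    qed
  qed
  have bq: "boundary S q X \<in> lin_part N e" if X: "X \<subseteq> S" for X
  proof (rule lin_part_nonzerodivisor[OF N x xN])
    show "boundary S q X \<in> gr e"
      using q(1) X by (intro boundary_in_subspace[OF subspace_gr]) auto
    have "boundary S (\<lambda>X. y X - x * q X) X \<in> lin_part N d"
      using q(2) X by (intro boundary_in_subspace[OF subspace_ideals(2)]) auto
    then have "boundary S y X - boundary S (\<lambda>X. y X - x * q X) X \<in> lin_part N d"
      using by_[OF X] by (intro subspace_diff subspace_ideals)
    then show "x * boundary S q X \<in> lin_part N (Suc e)"
      unfolding boundary_diff boundary_mult e by simp
  qed
  obtain b u where bu: "b \<in> N" "\<And>s. s \<in> S \<Longrightarrow> u s \<in> G s" "x = b + (\<Sum>s\<in>S. u s)"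
    using lspan_insertE[OF S(1) _ N(1), of x] full x by blast
  \<comment> \<open>the homotopy for multiplication by \<open>x - b \<equiv> x\<close>; it shows that \<open>x q\<close> is the boundary of \<open>h\<close>\<close>
  define h where "h X = (\<Sum>s\<in>S. homotopy (u s) s q X)" for X
  have h: "h X \<in> sum_part N X d" if X: "X \<subseteq> S" for X
    unfolding h_def
  proof (rule subspace_sum[OF subspace_ideals(3)])
    fix s assume s: "s \<in> S"
    show "homotopy (u s) s q X \<in> sum_part N X d"
    proof (cases "s \<in> X")
      case True
      have "u s * q (X - {s}) \<in> sum_part N (insert s (X - {s})) (Suc e)"
        using X S(1) s finite_subset by (intro sum_part_insert_mult bu(2) qM) auto
      then have "u s * q (X - {s}) \<in> sum_part N X d" using True e by (simp add: insert_absorb)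
      then show ?thesis
        unfolding homotopy_def using True sign_subspace[OF subspace_ideals(3)] by simp
    next
      case False
      then show ?thesis unfolding homotopy_def using subspace_0[OF subspace_ideals(3)] by simp
    qed
  qed
  have yh: "y X - boundary S h X \<in> lin_part N d" if X: "X \<subseteq> S" for X
  proof -
    have "boundary S h X + (\<Sum>s\<in>S. homotopy (u s) s (boundary S q) X) = (\<Sum>s\<in>S. u s * q X)"
      unfolding h_def boundary_sum sum.distrib[symmetric]
      by (intro sum.cong refl homotopy_boundary[OF S(1) X])
    also have "\<dots> = (x - b) * q X" using bu(3) by (simp add: sum_distrib_right)
    finally have eq: "y X - boundary S h X =
        (y X - x * q X) + q X * b + (\<Sum>s\<in>S. homotopy (u s) s (boundary S q) X)"
      by (simp add: algebra_simps)
    have "b \<in> lin_part N 1" using bu(1) unfolding lin_part_def by (intro ideal_part_gen) simp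
    then have "q X * b \<in> lin_part N (e + 1)"
      unfolding lin_part_def by (rule ideal_part_mult[OF q(1)[OF X]])
    moreover have "(\<Sum>s\<in>S. homotopy (u s) s (boundary S q) X) \<in> lin_part N d"
    proof (rule subspace_sum[OF subspace_ideals(2)])
      fix s assume s: "s \<in> S"
      have "u s * boundary S q (X - {s}) \<in> lin_part N (1 + e)"
        using bu(2)[OF s] G_gr X bq[of "X - {s}"] ideal_part_mult unfolding lin_part_def by blast
      then have "u s * boundary S q (X - {s}) \<in> lin_part N d" using e by simp
      then show "homotopy (u s) s (boundary S q) X \<in> lin_part N d"
        unfolding homotopy_def
        using sign_subspace[OF subspace_ideals(2)] subspace_0[OF subspace_ideals(2)] by simp
    qed
    ultimately show ?thesis
      unfolding eq using q(2)[OF X] e by (intro subspace_add subspace_ideals) auto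
  qed
  \<comment> \<open>drop the part of \<open>h\<close> in the ideal of \<open>N\<close>, as it and its boundary vanish modulo \<open>N\<close>\<close>
  have "\<exists>a. a \<in> prod_part X d \<and> h X - a \<in> lin_part N d" if "X \<subseteq> S" for X
    using sum_part_E[OF h[OF that]] by metis
  then obtain h0 where h0: "\<And>X. X \<subseteq> S \<Longrightarrow> h0 X \<in> prod_part X d" "\<And>X. X \<subseteq> S \<Longrightarrow> h X - h0 X \<in> lin_part N d"
    by metis
  show "\<exists>w. (\<forall>X\<subseteq>S. w X \<in> prod_part X d) \<and> (\<forall>X\<subseteq>S. z X - boundary S w X \<in> lin_part N d)"
  proof (intro exI[of _ "\<lambda>X. w X + h0 X"] conjI allI impI)
    fix X assume X: "X \<subseteq> S"
    show "w X + h0 X \<in> prod_part X d"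
      using w(1) h0(1) X by (intro subspace_add subspace_ideals) auto
    have "boundary S (\<lambda>X. h X - h0 X) X \<in> lin_part N d"
      using h0(2) X by (intro boundary_in_subspace[OF subspace_ideals(2)]) auto
    then have "(y X - boundary S h X) + boundary S (\<lambda>X. h X - h0 X) X \<in> lin_part N d"
      using yh[OF X] by (intro subspace_add subspace_ideals)
    then show "z X - boundary S (\<lambda>X. w X + h0 X) X \<in> lin_part N d"
      unfolding boundary_diff boundary_add y_def by (simp add: algebra_simps)
  qed
qed

lemma gr_sub_lin_part:
  assumes "gr 1 \<subseteq> N" "0 < d"
  shows "gr d \<subseteq> lin_part N d"
proof -
  obtain e where e: "d = Suc e" using assms(2) by (cases d) auto
  have "a * b \<in> lin_part N (1 + e)" if "a \<in> gr 1" "b \<in> gr e" for a b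
    unfolding lin_part_def by (rule ideal_part_mult_gen) (use assms(1) that in auto)
  then have "span {a * b | a b. a \<in> gr 1 \<and> b \<in> gr e} \<subseteq> lin_part N (1 + e)"
    by (intro span_minimal subspace_ideals) blast
  then show ?thesis using gr_Suc[of e] e by auto
qed

text \<open>
  The outer induction enlarges \<open>N\<close> by generic forms until \<open>N\<close> contains all linear forms, when
  everything of positive degree vanishes modulo \<open>N\<close>; the inner one is over the subsets of \<open>S\<close>.
  Generic means outside of every proper subspace \<open>lspan N A\<close>, \<open>A \<subseteq> S\<close>.
\<close>

theorem exactness:
  assumes "finite S" "S \<noteq> {}" "subspace N" "N \<subseteq> gr 1" "gr 1 \<subseteq> lspan N S" "card S \<le> d"
  shows "exact_mod N S d"
  using assms
proof (induction "dim (gr 1) - dim N" arbitrary: N S d rule: less_induct)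
  case (less N S d)
  note outer = less.hyps
  from less.prems show ?case
  proof (induction S arbitrary: d rule: finite_psubset_induct)
    case (psubset S d)
    show ?case
    proof (cases "gr 1 \<subseteq> N")
      case True
      have "0 < card S" using psubset.prems psubset.hyps by (simp add: card_gt_0_iff)
      then have "gr d \<subseteq> lin_part N d" using gr_sub_lin_part[OF True] psubset.prems by simp
      then have MNI: "v \<in> lin_part N d" if "X \<subseteq> S" "v \<in> sum_part N X d" for X v
        using sum_part_gr[OF finite_subset[OF that(1) psubset.hyps(1)] psubset.prems(3), of d] that(2) by blast
      show ?thesis
        unfolding exact_mod_def using subspace_0[OF subspace_ideals(1)]
        by (intro allI impI exI[of _ "\<lambda>_. 0"]) (simp add: boundary_def MNI)
    next
      case False
      let ?\<U> = "{lspan N A | A. A \<subseteq> S \<and> \<not> gr 1 \<subseteq> lspan N A}"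
      have "finite ?\<U>" using psubset.hyps by simp
      then obtain x where x: "x \<in> gr 1" "\<forall>U\<in>?\<U>. x \<notin> U"
        using ex_avoiding_subspaces[OF infinite_field subspace_gr, of ?\<U> 1] subspace_lspan by blast
      have avoid: "x \<notin> lspan N A" if "A \<subseteq> S" "\<not> gr 1 \<subseteq> lspan N A" for A
        using x(2) that by blast
      have xN: "x \<notin> N"
        using avoid[of "{}"] lspan_empty[OF psubset.prems(2)] False by simp
      let ?N' = "span (insert x N)"
      have N': "?N' \<subseteq> gr 1"
        using x(1) psubset.prems by (intro span_minimal subspace_gr) auto
      have NN': "N \<subseteq> ?N'" using span_superset[of "insert x N"] by blast
      have "dim ?N' = Suc (dim N)"
        using psubset.prems xN fin_span_subset[OF fin_span_gr] by (intro dim_span_insert) auto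
      moreover have "dim ?N' \<le> dim (gr 1)" by (rule dim_mono_fin_span[OF fin_span_gr N'])
      ultimately have "dim (gr 1) - dim ?N' < dim (gr 1) - dim N" by simp
      then have exact': "exact_mod ?N' S d"
        using psubset.hyps psubset.prems N' lspan_mono[OF NN' order_refl, of S]
        by (intro outer subspace_span) auto
      show ?thesis
      proof (rule exactness_step[OF psubset.hyps psubset.prems x(1) _ xN exact'])
        show "x \<notin> lspan N A" if "A \<subseteq> S" "\<not> gr 1 \<subseteq> lspan N A" for A
          using avoid that .
      next
        fix S' d' assume "S' \<subset> S" "S' \<noteq> {}" "gr 1 \<subseteq> lspan N S'" "card S' \<le> d'"
        then show "exact_mod N S' d'" using psubset.prems(2,3) by (intro psubset.IH)
      qed
    qed
  qed
qed

end

section \<open>Euler characteristics and Hilbert series\<close>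

lemma sum_Pow_alternating:
  assumes "finite S" "S \<noteq> {}"
  shows "(\<Sum>X\<in>Pow S. (- 1) ^ card X) = (0 :: 'r::comm_ring_1)"
proof -
  obtain s where s: "s \<in> S" using assms by blast
  define T where "T = S - {s}"
  have T: "S = insert s T" "s \<notin> T" "finite T" using s assms unfolding T_def by auto
  have "(\<Sum>X\<in>Pow S. (- 1) ^ card X) =
      (\<Sum>X\<in>Pow T. (- 1) ^ card X) + (\<Sum>X\<in>insert s ` Pow T. (- 1) ^ card X :: 'r)"
    unfolding T(1) Pow_insert using T by (intro sum.union_disjoint) auto
  also have "(\<Sum>X\<in>insert s ` Pow T. (- 1) ^ card X :: 'r) = (\<Sum>X\<in>Pow T. - ((- 1) ^ card X))"
  proof (subst sum.reindex)
    show "inj_on (insert s) (Pow T)"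
      by (rule inj_onI) (use T(2) in \<open>metis PowD insert_ident subsetD\<close>)
    show "sum ((\<lambda>X. (- 1) ^ card X) \<circ> insert s) (Pow T) = (\<Sum>X\<in>Pow T. - ((- 1) ^ card X) :: 'r)"
    proof (intro sum.cong refl)
      fix X assume "X \<in> Pow T"
      then have "s \<notin> X" "finite X" using T finite_subset by auto
      then show "((\<lambda>X. (- 1) ^ card X) \<circ> insert s) X = - ((- 1) ^ card X :: 'r)" by simp
    qed
  qed
  finally show ?thesis by (simp add: sum_negf)
qed

context linear_ideals
begin

text \<open>
  The map \<open>\<pi>\<close> turns the complex modulo \<open>N\<close> into a complex of subspaces \<open>F X\<close>. The spaces \<open>C True\<close>
  and \<open>C False\<close> of families supported on sets of even and odd size are mapped to each other by the
  boundary \<open>D\<close>, and by exactness kernel and image agree in both. Two applications of rank-nullity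
  give equal dimensions.
\<close>

theorem euler_characteristic:
  assumes S: "finite S" "S \<noteq> {}" and N: "N \<subseteq> gr 1" and ex: "exact_mod N S d"
  shows "(\<Sum>X\<in>Pow S. (- 1) ^ card X * of_nat (dim (sum_part N X d))) = (0 :: rat)"
proof -
  obtain \<pi> where \<pi>: "Vector_Spaces.linear scale scale \<pi>" "\<And>v. \<pi> v = 0 \<longleftrightarrow> v \<in> lin_part N d"
    using ex_linear_kernel[OF subspace_ideals(2)] by blast
  interpret \<pi>: Vector_Spaces.linear scale scale \<pi> by (rule \<pi>(1))
  interpret p: vector_space_pair scale scale by unfold_locales
  interpret f: vector_space "fun_scale scale :: _ \<Rightarrow> (nat set \<Rightarrow> 'a) \<Rightarrow> _"
    by (rule vector_space_fun_scale)
  interpret q: vector_space_pair "fun_scale scale :: _ \<Rightarrow> (nat set \<Rightarrow> 'a) \<Rightarrow> _"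
    "fun_scale scale :: _ \<Rightarrow> (nat set \<Rightarrow> 'a) \<Rightarrow> _" by unfold_locales
  define F where "F X = \<pi> ` sum_part N X d" for X
  have finX: "finite X" if "X \<subseteq> S" for X using S(1) that finite_subset by blast
  have finM: "fin_span (sum_part N X d)" if "X \<subseteq> S" for X
    by (rule fin_span_subset[OF fin_span_gr sum_part_gr[OF finX[OF that] N]])
  have F: "subspace (F X)" for X
    unfolding F_def by (rule p.linear_subspace_image[OF \<pi>(1) subspace_ideals(3)])
  have finF: "fin_span (F X)" if "X \<subseteq> S" for X
    unfolding F_def by (rule p.fin_span_image[OF \<pi>(1) finM[OF that]])
  have dimM: "dim (sum_part N X d) = dim (F X) + dim (lin_part N d)" if "X \<subseteq> S" for X
  proof -
    have "{m \<in> sum_part N X d. \<pi> m = 0} = lin_part N d" using lin_part_sub_sum \<pi>(2) by blast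
    then show ?thesis
      using p.rank_nullity[OF \<pi>(1) subspace_ideals(3) finM[OF that]] unfolding F_def by simp
  qed
  have \<pi>_sign: "\<pi> (csign s X * v) = csign s X * \<pi> v" for s X v
    using csign_cases[of s X, where 'a = 'a] \<pi>.neg[of v] by (elim disjE) simp_all
  have \<pi>_boundary: "\<pi> (boundary S z X) = boundary S (\<pi> \<circ> z) X" for z X
    unfolding boundary_def by (simp add: \<pi>.sum \<pi>_sign)
  define T where "T b = {X. X \<subseteq> S \<and> (even (card X) \<longleftrightarrow> b)}" for b
  define C where "C b = {g. (\<forall>X\<in>T b. g X \<in> F X) \<and> (\<forall>X. X \<notin> T b \<longrightarrow> g X = 0)}" for b
  define D where "D g = (\<lambda>X. if X \<subseteq> S then boundary S g X else 0)" for g :: "nat set \<Rightarrow> 'a"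
  have finT: "finite (T b)" for b
    by (rule finite_subset[of _ "Pow S"]) (use S(1) in \<open>auto simp: T_def\<close>)
  have T_insert: "insert s X \<in> T (\<not> b) \<longleftrightarrow> X \<in> T b" if "X \<subseteq> S" "s \<in> S - X" for s X b
    using that finX[OF that(1)] unfolding T_def by auto
  have D: "Vector_Spaces.linear (fun_scale scale) (fun_scale scale) D"
  proof (unfold_locales)
    show "D (g + h) = D g + D h" for g h
      unfolding D_def plus_fun_def by (auto simp: boundary_add)
    have "csign s X * scale c v = scale c (csign s X * v)" for s X c v
      by (metis mult.commute scale_mult)
    then show "D (fun_scale scale c g) = fun_scale scale c (D g)" for c g
      unfolding D_def fun_scale_def boundary_def by (auto simp: scale_sum_right)
  qed
  have C: "f.subspace (C b)" "f.fin_span (C b)" "f.dim (C b) = (\<Sum>X\<in>T b. dim (F X))" for b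
  proof -
    have finF': "fin_span (F X)" if "X \<in> T b" for X using finF that unfolding T_def by blast
    show "f.subspace (C b)" unfolding C_def by (rule subspace_families[OF F])
    show "f.fin_span (C b)" unfolding C_def by (rule fin_span_families[OF finT finF'])
    show "f.dim (C b) = (\<Sum>X\<in>T b. dim (F X))" unfolding C_def by (rule dim_families[OF finT F finF'])
  qed
  have F_anti: "F (insert s X) \<subseteq> F X" if "insert s X \<subseteq> S" for s X
    unfolding F_def using sum_part_anti_mono[of X "insert s X"] finX[OF that] by blast
  have D_in: "D g \<in> C (\<not> b)" if g: "g \<in> C b" for g b
    unfolding C_def
  proof (intro CollectI conjI ballI allI impI)
    fix X assume "X \<in> T (\<not> b)"
    then have X: "X \<subseteq> S" unfolding T_def by blast
    have "boundary S g X \<in> F X"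
    proof (rule boundary_in_subspace[OF F])
      fix s assume s: "s \<in> S - X"
      have "g (insert s X) \<in> F (insert s X)"
        using g subspace_0[OF F] unfolding C_def by (cases "insert s X \<in> T b") auto
      then show "g (insert s X) \<in> F X" using F_anti[of s X] s X by blast
    qed
    then show "D g X \<in> F X" unfolding D_def using X by simp
  next
    fix X assume X: "X \<notin> T (\<not> b)"
    show "D g X = 0"
    proof (cases "X \<subseteq> S")
      case True
      have "g (insert s X) = 0" if "s \<in> S - X" for s
        using g X T_insert[OF True that, of "\<not> b"] unfolding C_def by simp
      then have "boundary S g X = 0" unfolding boundary_def by simp
      then show ?thesis unfolding D_def by simp
    qed (simp add: D_def)
  qed
  have DD: "D (D g) = 0" for g
  proof
    fix X
    have "boundary S (D g) X = boundary S (boundary S g) X" if "X \<subseteq> S"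
      unfolding boundary_def[of S "D g"] boundary_def[of S "boundary S g"]
      using that by (intro sum.cong refl) (auto simp: D_def)
    then show "D (D g) X = (0 :: nat set \<Rightarrow> 'a) X"
      using boundary_boundary[OF S(1), of X g] unfolding D_def[of "D g"] by auto
  qed
  have im_ker: "D ` C (\<not> b) = {g \<in> C b. D g = 0}" for b
  proof (intro equalityI subsetI)
    fix g assume "g \<in> D ` C (\<not> b)"
    then show "g \<in> {g \<in> C b. D g = 0}" using D_in[of _ "\<not> b"] DD by auto
  next
    fix g assume "g \<in> {g \<in> C b. D g = 0}"
    then have g: "g \<in> C b" "D g = 0" by auto
    have "\<exists>v. (X \<subseteq> S \<longrightarrow> v \<in> sum_part N X d) \<and> \<pi> v = g X" for X
    proof (cases "X \<in> T b")
      case True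
      then have "g X \<in> F X" using g(1) unfolding C_def by blast
      then show ?thesis unfolding F_def by auto
    next
      case False
      then have "g X = 0" using g(1) unfolding C_def by blast
      then show ?thesis using subspace_0[OF subspace_ideals(3)]
        by (intro exI[of _ 0]) (simp add: \<pi>.zero)
    qed
    then obtain z where z: "\<And>X. X \<subseteq> S \<Longrightarrow> z X \<in> sum_part N X d" "\<And>X. \<pi> (z X) = g X" by metis
    have \<pi>z: "\<pi> \<circ> z = g" using z(2) by auto
    have "boundary S z X \<in> lin_part N d" if "X \<subseteq> S" for X
    proof -
      have "boundary S g X = 0" using fun_cong[OF g(2), of X] that unfolding D_def by simp
      then show ?thesis using \<pi>_boundary[of z X] unfolding \<pi>z by (simp add: \<pi>(2))
    qed
    then obtain w where w: "\<And>X. X \<subseteq> S \<Longrightarrow> w X \<in> prod_part X d"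
      "\<And>X. X \<subseteq> S \<Longrightarrow> z X - boundary S w X \<in> lin_part N d"
      using ex[unfolded exact_mod_def, THEN spec, THEN mp, of z] z(1) by auto
    define h where "h X = (if X \<in> T (\<not> b) then \<pi> (w X) else 0)" for X
    have "h \<in> C (\<not> b)"
      unfolding C_def h_def F_def using w(1) prod_part_sub_sum by (force simp: T_def)
    moreover have "D h = g"
    proof
      fix X
      show "D h X = g X"
      proof (cases "X \<in> T b")
        case True
        then have X: "X \<subseteq> S" unfolding T_def by blast
        have "\<pi> (z X - boundary S w X) = 0" using w(2)[OF X] \<pi>(2) by blast
        then have "g X = boundary S (\<pi> \<circ> w) X" by (simp add: \<pi>.diff z(2) \<pi>_boundary)
        also have "\<dots> = boundary S h X"
          unfolding boundary_def
          by (intro sum.cong refl) (use T_insert[OF X] True in \<open>simp add: h_def\<close>)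
        finally show ?thesis unfolding D_def using X by simp
      next
        case False
        then have "g X = 0" using g(1) unfolding C_def by blast
        moreover have "D h X = 0"
          using D_in[OF \<open>h \<in> C (\<not> b)\<close>] False unfolding C_def by simp
        ultimately show ?thesis by simp
      qed
    qed
    ultimately show "g \<in> D ` C (\<not> b)" by blast
  qed
  have "f.dim (C b) = f.dim (D ` C b) + f.dim (D ` C (\<not> b))" for b
    using q.rank_nullity[OF D C(1,2)] im_ker by simp
  from this[of True] this[of False] have "f.dim (C True) = f.dim (C False)" by simp
  then have eq: "(\<Sum>X\<in>T True. dim (F X)) = (\<Sum>X\<in>T False. dim (F X))" by (simp add: C(3))
  have "(\<Sum>X\<in>Pow S. (- 1) ^ card X * of_nat (dim (sum_part N X d)) :: rat) =
      (\<Sum>X\<in>Pow S. (- 1) ^ card X * of_nat (dim (F X))) + (\<Sum>X\<in>Pow S. (- 1) ^ card X) * of_nat (dim (lin_part N d))"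
    unfolding sum_distrib_right sum.distrib[symmetric]
    by (intro sum.cong refl) (simp add: dimM distrib_left)
  also have "\<dots> = (\<Sum>X\<in>Pow S. (- 1) ^ card X * of_nat (dim (F X)))"
    using sum_Pow_alternating[OF S, where 'r = rat] by simp
  also have "\<dots> = (\<Sum>X\<in>T True. (- 1) ^ card X * of_nat (dim (F X))) +
      (\<Sum>X\<in>T False. (- 1) ^ card X * of_nat (dim (F X)))"
  proof -
    have "Pow S = T True \<union> T False" "T True \<inter> T False = {}" unfolding T_def by auto
    then show ?thesis using finT by (simp add: sum.union_disjoint)
  qed
  also have "(\<Sum>X\<in>T True. (- 1) ^ card X * of_nat (dim (F X)) :: rat) = of_nat (\<Sum>X\<in>T True. dim (F X))"
    unfolding of_nat_sum by (intro sum.cong refl) (simp add: T_def)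
  also have "(\<Sum>X\<in>T False. (- 1) ^ card X * of_nat (dim (F X)) :: rat) = - of_nat (\<Sum>X\<in>T False. dim (F X))"
    unfolding of_nat_sum sum_negf[symmetric] by (intro sum.cong refl) (simp add: T_def)
  finally show ?thesis using eq by simp
qed


end

context graded_algebra
begin

definition hilb :: "(nat \<Rightarrow> 'a set) \<Rightarrow> rat fps" where
  "hilb F = Abs_fps (\<lambda>d. of_nat (dim (F d)))"

definition quotient_series :: "(nat \<times> 'a) set \<Rightarrow> rat fps" where
  "quotient_series P = hilb gr - hilb (ideal_part P)"

text \<open>
  Multiplication by \<open>x\<close> embeds the quotient by \<open>P\<close>, shifted by one degree, into itself; the
  cokernel is the quotient by \<open>P\<close> and \<open>x\<close>.
\<close>

lemma quotient_series_insert: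
  assumes P: "\<And>k a. (k, a) \<in> P \<Longrightarrow> a \<in> gr k" and x: "x \<in> gr 1"
    and nzd: "\<And>d f. f \<in> gr d \<Longrightarrow> x * f \<in> ideal_part P (Suc d) \<Longrightarrow> f \<in> ideal_part P d"
  shows "quotient_series (insert (1, x) P) = (1 - fps_X) * quotient_series P"
proof (rule fps_ext)
  interpret p: vector_space_pair scale scale by unfold_locales
  let ?P' = "insert (1, x) P"
  have P'_eq: "ideal_part ?P' d = span {a * r | k a e r. (k, a) \<in> {(1, x)} \<and> r \<in> gr e \<and> d = k + e \<or>
      (k, a) \<in> P \<and> r \<in> gr e \<and> d = k + e}" for d
    unfolding ideal_part_def by (rule arg_cong[where f = span]) blast
  fix n
  show "quotient_series ?P' $ n = ((1 - fps_X) * quotient_series P) $ n"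
  proof (cases n)
    case 0
    have "ideal_part ?P' 0 = ideal_part P 0"
      unfolding ideal_part_def by (rule arg_cong[where f = span]) auto
    then show ?thesis unfolding 0 by (simp add: quotient_series_def hilb_def)
  next
    case (Suc d)
    have Pd: "ideal_part P (Suc d) \<subseteq> gr (Suc d)" using P by (rule ideal_part_subset_gr)
    have sub: "ideal_part P d \<subseteq> gr d" using P by (rule ideal_part_subset_gr)
    have Id_eq: "ideal_part ?P' (Suc d) = {x * e + u | e u. e \<in> gr d \<and> u \<in> ideal_part P (Suc d)}" (is "_ = ?W")
    proof
      have W: "subspace ?W"
      proof -
        have "?W = {a + b | a b. a \<in> (*) x ` gr d \<and> b \<in> ideal_part P (Suc d)}" by blast
        then show ?thesis
          using subspace_sums[OF p.linear_subspace_image[OF linear_mult subspace_gr] subspace_ideal_part] by simp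
      qed
      show "ideal_part ?P' (Suc d) \<subseteq> ?W"
        unfolding ideal_part_def[of ?P']
      proof (rule span_minimal[OF _ W], rule subsetI)
        fix v assume "v \<in> {a * r | k a e r. (k, a) \<in> ?P' \<and> r \<in> gr e \<and> Suc d = k + e}"
        then obtain k a e r where v: "v = a * r" "(k, a) \<in> ?P'" "r \<in> gr e" "Suc d = k + e" by blast
        show "v \<in> ?W"
        proof (cases "(k, a) \<in> P")
          case True
          then have "v = x * 0 + v" "v \<in> ideal_part P (Suc d)" using v ideal_part_mult_gen by auto
          then show ?thesis using subspace_0[OF subspace_gr] by blast
        next
          case False
          then have "v = x * r + 0" "r \<in> gr d" using v by auto
          then show ?thesis using subspace_0[OF subspace_ideal_part] by blast
        qed
      qed
      have "x * e + u \<in> ideal_part ?P' (Suc d)" if "e \<in> gr d" "u \<in> ideal_part P (Suc d)" for e u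
      proof (rule subspace_add[OF subspace_ideal_part])
        show "x * e \<in> ideal_part ?P' (Suc d)"
          using ideal_part_mult_gen[of 1 x ?P' e d] that(1) by simp
        show "u \<in> ideal_part ?P' (Suc d)" using that(2) ideal_part_mono[of P ?P'] by blast
      qed
      then show "?W \<subseteq> ideal_part ?P' (Suc d)" by blast
    qed
    have "{e \<in> gr d. x * e \<in> ideal_part P (Suc d)} = ideal_part P d"
      using nzd ideal_part_mult[OF x, of _ P d] sub by auto
    then have "dim (ideal_part ?P' (Suc d)) + dim (ideal_part P d) = dim (ideal_part P (Suc d)) + dim (gr d)"
      using p.dim_image_sum[OF linear_mult[of x] subspace_gr[of d] fin_span_gr[of d] subspace_ideal_part
          fin_span_subset[OF fin_span_gr Pd]] unfolding Id_eq by simp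
    then have "(of_nat (dim (ideal_part ?P' (Suc d))) :: rat) + of_nat (dim (ideal_part P d)) =
        of_nat (dim (ideal_part P (Suc d))) + of_nat (dim (gr d))"
      by (metis of_nat_add)
    then show ?thesis
      unfolding Suc by (simp add: quotient_series_def hilb_def algebra_simps fps_X_mult_nth)
  qed
qed

lemma ideal_part_linear_span:
  "ideal_part (P \<union> {1} \<times> span (insert x N)) = ideal_part (insert (1, x) (P \<union> {1} \<times> N))" (is "ideal_part ?Q = ideal_part ?P")
proof (intro ext equalityI ideal_part_le)
  fix d k a assume a: "(k, a) \<in> ?Q"
  show "a \<in> ideal_part ?P k"
  proof (cases "(k, a) \<in> P")
    case True
    then show ?thesis by (intro ideal_part_gen) simp
  next
    case False
    then have "k = 1" "a \<in> span (insert x N)" using a by auto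
    moreover have "span (insert x N) \<subseteq> ideal_part ?P 1"
      by (intro span_minimal subspace_ideal_part) (auto intro!: ideal_part_gen)
    ultimately show ?thesis by blast
  qed
next
  fix d k a assume "(k, a) \<in> ?P"
  then show "a \<in> ideal_part ?Q k" using span_superset[of "insert x N"]
    by (intro ideal_part_gen) auto
qed

text \<open>
  One by one, forms outside of the span of \<open>N\<close> and \<open>L\<close> are added to \<open>N\<close>. Each is a nonzerodivisor
  modulo the ideal, whose generators are products of forms in that span.
\<close>

lemma ex_complement_series:
  assumes "subspace L" "L \<subseteq> gr 1" "subspace N" "N \<subseteq> gr 1"
  shows "\<exists>N'. subspace N' \<and> N' \<subseteq> gr 1 \<and> gr 1 \<subseteq> span (N' \<union> L) \<and>
    (\<forall>P\<subseteq>form_products L. quotient_series (P \<union> {1} \<times> N') =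
      (1 - fps_X) ^ (dim (gr 1) - dim (span (N \<union> L))) * quotient_series (P \<union> {1} \<times> N))"
  using assms(3,4)
proof (induction "dim (gr 1) - dim (span (N \<union> L))" arbitrary: N rule: less_induct)
  case (less N)
  let ?W = "span (N \<union> L)"
  have W: "?W \<subseteq> gr 1" using less.prems assms by (intro span_minimal subspace_gr) auto
  show ?case
  proof (cases "gr 1 \<subseteq> ?W")
    case True
    then have "?W = gr 1" using W by blast
    then show ?thesis using less.prems True by (intro exI[of _ N]) simp
  next
    case False
    then obtain x where x: "x \<in> gr 1" "x \<notin> ?W" by blast
    let ?N = "span (insert x N)"
    have N: "subspace ?N" "?N \<subseteq> gr 1"
      using less.prems x(1) by (intro subspace_span, intro span_minimal subspace_gr) blast
    have "span (?N \<union> L) = span (insert x ?W)"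
    proof (rule subset_antisym; intro span_minimal subspace_span)
      have "insert x N \<union> L \<subseteq> span (insert x ?W)"
        using span_superset[of "insert x ?W"] span_superset[of "N \<union> L"] by blast
      then have "insert x N \<subseteq> span (insert x ?W)" and "L \<subseteq> span (insert x ?W)" by blast+
      moreover from this(1) have "?N \<subseteq> span (insert x ?W)"
        by (rule span_minimal[OF _ subspace_span])
      ultimately show "?N \<union> L \<subseteq> span (insert x ?W)" by blast
      have "N \<union> L \<subseteq> ?N \<union> L" "x \<in> ?N \<union> L" using span_superset[of "insert x N"] by auto
      then show "insert x ?W \<subseteq> span (?N \<union> L)"
        using span_mono[of "N \<union> L" "?N \<union> L"] span_superset[of "?N \<union> L"] by blast
    qed
    then have dimW: "dim (span (?N \<union> L)) = Suc (dim ?W)"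
      using dim_span_insert[OF subspace_span fin_span_subset[OF fin_span_gr W] x(2)] by simp
    have "insert x ?W \<subseteq> gr 1" using x(1) W by blast
    then have "Suc (dim ?W) \<le> dim (gr 1)"
      using dim_mono_fin_span[OF fin_span_gr span_minimal[OF _ subspace_gr]]
        dim_span_insert[OF subspace_span fin_span_subset[OF fin_span_gr W] x(2)] by metis
    then have diff: "dim (gr 1) - dim ?W = Suc (dim (gr 1) - dim (span (?N \<union> L)))"
      unfolding dimW by simp
    then obtain N' where N': "subspace N'" "N' \<subseteq> gr 1" "gr 1 \<subseteq> span (N' \<union> L)"
      "\<And>P. P \<subseteq> form_products L \<Longrightarrow> quotient_series (P \<union> {1} \<times> N') =
        (1 - fps_X) ^ (dim (gr 1) - dim (span (?N \<union> L))) * quotient_series (P \<union> {1} \<times> ?N)"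
      using less.hyps[OF _ N] by auto
    have "quotient_series (P \<union> {1} \<times> ?N) = (1 - fps_X) * quotient_series (P \<union> {1} \<times> N)"
      if P: "P \<subseteq> form_products L" for P
    proof -
      let ?P = "P \<union> {1} \<times> N"
      have "N \<subseteq> ?W" "L \<subseteq> ?W" using span_superset[of "N \<union> L"] by auto
      then have PW: "?P \<subseteq> form_products ?W"
        using P form_products_mono[of L ?W] form_products_single[of _ ?W] by blast
      have "quotient_series (insert (1, x) ?P) = (1 - fps_X) * quotient_series ?P"
      proof (rule quotient_series_insert[OF _ x(1)])
        show "a \<in> gr k" if "(k, a) \<in> ?P" for k a
          using form_products_gr[OF W] PW that by blast
        show "f \<in> ideal_part ?P d" if "f \<in> gr d" "x * f \<in> ideal_part ?P (Suc d)" for d f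
          by (rule ideal_part_nonzerodivisor[OF subspace_span W x PW that])
      qed
      then show ?thesis unfolding quotient_series_def ideal_part_linear_span .
    qed
    then show ?thesis
      using N' unfolding diff by (intro exI[of _ N']) (simp add: mult.assoc mult.left_commute)
  qed
qed

lemma ideal_part_zero_gens: "ideal_part (P \<union> {1} \<times> {0}) = ideal_part P"
proof (intro ext equalityI ideal_part_le)
  fix d k a assume "(k, a) \<in> P \<union> {1} \<times> {0}"
  then show "a \<in> ideal_part P k" using ideal_part_gen subspace_0[OF subspace_ideal_part] by auto
qed (auto intro: ideal_part_gen)

text \<open>
  The complement of \<open>L = {0}\<close> is the space of all linear forms, and the quotient by these is the
  field in degree \<open>0\<close>.
\<close>

theorem hilb_gr: "(1 - fps_X) ^ dim (gr 1) * hilb gr = 1"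
proof -
  have zero: "subspace {0}" "{0} \<subseteq> gr 1" using subspace_0[OF subspace_gr] by auto
  obtain N' where N': "subspace N'" "N' \<subseteq> gr 1" "gr 1 \<subseteq> span (N' \<union> {0})"
    "\<And>P. P \<subseteq> form_products {0} \<Longrightarrow> quotient_series (P \<union> {1} \<times> N') =
      (1 - fps_X) ^ (dim (gr 1) - dim (span ({0} \<union> {0}))) * quotient_series (P \<union> {1} \<times> {0})"
    using ex_complement_series[OF zero zero] by blast
  have "N' = gr 1" using N'(1-3) by (simp add: span_eq_iff[THEN iffD2])
  have dim0: "dim {0} = 0" using dim_le_card[of "{0}" "{}"] by simp
  have "hilb (ideal_part {}) = 0"
    unfolding hilb_def ideal_part_def using dim0 by (simp add: fps_zero_def)
  then have 1: "quotient_series ({1} \<times> gr 1) = (1 - fps_X) ^ dim (gr 1) * hilb gr"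
    using N'(4)[of "{}"] dim0 ideal_part_zero_gens[of "{}"]
    unfolding \<open>N' = gr 1\<close> quotient_series_def by simp
  have "quotient_series ({1} \<times> gr 1) = 1"
  proof (rule fps_ext)
    fix n
    show "quotient_series ({1} \<times> gr 1) $ n = 1 $ n"
    proof (cases n)
      case 0
      have "ideal_part ({1} \<times> gr 1) 0 = {0}" unfolding ideal_part_def by (simp add: span_empty)
      moreover have "dim (gr 0) = 1"
      proof (rule dim_unique[of "{1}"])
        show "{1} \<subseteq> gr 0" using one_in_gr by simp
        show "gr 0 \<subseteq> span {1}" unfolding gr_0 by (auto intro: span_scale span_base)
      qed simp_all
      ultimately show ?thesis using dim0 by (simp add: 0 quotient_series_def hilb_def)
    next
      case (Suc d)
      have "a * b \<in> ideal_part ({1} \<times> gr 1) (1 + d)" if "a \<in> gr 1" "b \<in> gr d" for a b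
        by (rule ideal_part_mult_gen) (use that in auto)
      then have "span {a * b | a b. a \<in> gr 1 \<and> b \<in> gr d} \<subseteq> ideal_part ({1} \<times> gr 1) (1 + d)"
        by (intro span_minimal subspace_ideal_part) blast
      then have "gr n \<subseteq> ideal_part ({1} \<times> gr 1) n" using gr_Suc[of d] Suc by auto
      moreover have "ideal_part ({1} \<times> gr 1) n \<subseteq> gr n" by (rule ideal_part_subset_gr) auto
      ultimately have "ideal_part ({1} \<times> gr 1) n = gr n" by blast
      then show ?thesis using Suc by (simp add: quotient_series_def hilb_def)
    qed
  qed
  then show ?thesis using 1 by simp
qed

end

context linear_ideals
begin

text \<open>
  Dividing by a complement \<open>N\<close> of the span of the \<open>G i\<close> multiplies all the series by the same
  power of \<open>1 - t\<close> and brings about the spanning case, in which the Euler characteristic vanishes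
  from degree \<open>card S\<close> on.
\<close>

theorem alternating_hilbert_series:
  assumes S: "finite S" "S \<noteq> {}"
  shows "\<exists>Q :: rat poly. (Q = 0 \<or> degree Q < card S) \<and>
    (1 - fps_X) ^ (dim (gr 1) - dim (span (\<Union>i\<in>S. G i))) * (\<Sum>X\<in>Pow S. (- 1) ^ card X * hilb (prod_part X)) =
      fps_of_poly Q"
proof -
  let ?L = "span (\<Union>i\<in>S. G i)"
  let ?c = "dim (gr 1) - dim ?L"
  have L: "subspace ?L" "?L \<subseteq> gr 1"
    using G_gr by (intro subspace_span, intro span_minimal subspace_gr) blast
  have zero: "subspace {0}" "{0} \<subseteq> gr 1" using subspace_0[OF subspace_gr] by auto
  have "span ({0} \<union> ?L) = ?L" by (simp add: span_span)
  then obtain N where N: "subspace N" "N \<subseteq> gr 1" "gr 1 \<subseteq> span (N \<union> ?L)"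
    "\<And>P. P \<subseteq> form_products ?L \<Longrightarrow> quotient_series (P \<union> {1} \<times> N) =
      (1 - fps_X) ^ ?c * quotient_series (P \<union> {1} \<times> {0})"
    using ex_complement_series[OF L zero] by auto
  have finX: "finite X" if "X \<subseteq> S" for X using S(1) that finite_subset by blast
  have series: "hilb gr - hilb (sum_part N X) = (1 - fps_X) ^ ?c * (hilb gr - hilb (prod_part X))"
    if X: "X \<subseteq> S" for X
  proof -
    have "lspan {} X \<subseteq> ?L" unfolding lspan_def using X by (intro span_mono) auto
    then have "prod_gens X \<subseteq> form_products ?L"
      using gens_form_products[OF finX[OF X], of "{}"] form_products_mono by blast
    from N(4)[OF this] show ?thesis
      unfolding quotient_series_def ideal_part_zero_gens prod_part_def[symmetric]
        by (simp add: sum_part_def)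
  qed
  have full: "gr 1 \<subseteq> lspan N S"
  proof -
    have "N \<union> ?L \<subseteq> lspan N S"
      unfolding lspan_def using span_mono[of "\<Union>i\<in>S. G i" "N \<union> (\<Union>i\<in>S. G i)"] span_superset by blast
    then show ?thesis using N(3) span_minimal[OF _ subspace_lspan] by blast
  qed
  define q where "q = (\<Sum>X\<in>Pow S. (- 1) ^ card X * hilb (sum_part N X))"
  have alt0: "(\<Sum>X\<in>Pow S. (- 1) ^ card X * f) = 0" for f :: "rat fps"
    unfolding sum_distrib_right[symmetric] using sum_Pow_alternating[OF S,
      where 'r = "rat fps"] by simp
  have "(1 - fps_X) ^ ?c * (\<Sum>X\<in>Pow S. (- 1) ^ card X * (hilb gr - hilb (prod_part X))) =
      (\<Sum>X\<in>Pow S. (- 1) ^ card X * (hilb gr - hilb (sum_part N X)))"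
    unfolding sum_distrib_left by (intro sum.cong refl) (simp add: series mult.left_commute)
  then have eq: "(1 - fps_X) ^ ?c * (\<Sum>X\<in>Pow S. (- 1) ^ card X * hilb (prod_part X)) = q"
    unfolding right_diff_distrib sum_subtractf alt0 q_def by simp
  have q_nth: "q $ d = (\<Sum>X\<in>Pow S. (- 1) ^ card X * of_nat (dim (sum_part N X d)))" for d
  proof -
    have "((- 1) ^ k * f) $ d = (- 1) ^ k * f $ d" for k and f :: "rat fps"
      by (induction k) auto
    then show ?thesis unfolding q_def hilb_def by (simp add: fps_sum_nth)
  qed
  have "q $ d = 0" if "card S \<le> d" for d
    unfolding q_nth by (rule euler_characteristic[OF S N(2) exactness[OF S N(1,2) full that]])
  then have "q = fps_of_poly (\<Sum>i<card S. monom (q $ i) i)"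
    by (intro fps_ext) (auto simp: coeff_sum)
  moreover have "(\<Sum>i<card S. monom (q $ i) i) = 0 \<or> degree (\<Sum>i<card S. monom (q $ i) i) < card S"
  proof -
    have "0 < card S" using S by (simp add: card_gt_0_iff)
    have "degree (\<Sum>i<card S. monom (q $ i) i) \<le> card S - 1"
      by (rule degree_le) (auto simp: coeff_sum)
    then show ?thesis using \<open>0 < card S\<close> by linarith
  qed
  ultimately show ?thesis using eq by metis
qed

end

section \<open>The polynomial ring as a graded algebra\<close>

interpretation mpol: vector_space "mpol_scale :: 'k::field \<Rightarrow> ('x, 'k) mpol \<Rightarrow> ('x, 'k) mpol"
  by (rule vector_space_mpol_scale)

abbreviation "lookup \<equiv> Poly_Mapping.lookup"
abbreviation "keys \<equiv> Poly_Mapping.keys"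
abbreviation "single \<equiv> Poly_Mapping.single"

definition mdeg :: "('x \<Rightarrow>\<^sub>0 nat) \<Rightarrow> nat" where
  "mdeg \<alpha> = (\<Sum>x\<in>keys \<alpha>. lookup \<alpha> x)"

lemma mdeg_superset:
  assumes "finite A" "keys \<alpha> \<subseteq> A"
  shows "mdeg \<alpha> = (\<Sum>x\<in>A. lookup \<alpha> x)"
  unfolding mdeg_def using assms by (intro sum.mono_neutral_left) (auto simp: in_keys_iff)

lemma mdeg_add: "mdeg (\<alpha> + \<beta>) = mdeg \<alpha> + mdeg \<beta>"
proof -
  let ?A = "keys \<alpha> \<union> keys \<beta>"
  have "mdeg (\<alpha> + \<beta>) = (\<Sum>x\<in>?A. lookup (\<alpha> + \<beta>) x)"
    by (rule mdeg_superset) (use keys_add[of \<alpha> \<beta>] in auto)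
  also have "\<dots> = (\<Sum>x\<in>?A. lookup \<alpha> x) + (\<Sum>x\<in>?A. lookup \<beta> x)"
    by (simp add: lookup_add sum.distrib)
  also have "\<dots> = mdeg \<alpha> + mdeg \<beta>" by (simp add: mdeg_superset[of ?A])
  finally show ?thesis .
qed

lemma mdeg_0: "mdeg 0 = 0" by (simp add: mdeg_def)

lemma mdeg_single: "mdeg (single x k) = k" by (simp add: mdeg_def)

definition monomials :: "'x set \<Rightarrow> nat \<Rightarrow> ('x \<Rightarrow>\<^sub>0 nat) set" where
  "monomials B d = {\<alpha>. keys \<alpha> \<subseteq> B \<and> mdeg \<alpha> = d}"

lemma monomials_0: "monomials B 0 = {0}"
proof -
  have "\<alpha> = 0" if "mdeg \<alpha> = 0" for \<alpha> :: "'x \<Rightarrow>\<^sub>0 nat"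
  proof (rule poly_mapping_eqI)
    fix x
    have "\<forall>x\<in>keys \<alpha>. lookup \<alpha> x = 0"
      using that unfolding mdeg_def by simp
    then show "lookup \<alpha> x = lookup 0 x"
      by (cases "x \<in> keys \<alpha>") (auto simp: in_keys_iff)
  qed
  then show ?thesis unfolding monomials_def by (auto simp: mdeg_0)
qed

lemma monomials_add:
  "\<alpha> \<in> monomials B i \<Longrightarrow> \<beta> \<in> monomials B j \<Longrightarrow> \<alpha> + \<beta> \<in> monomials B (i + j)"
  unfolding monomials_def using keys_add[of \<alpha> \<beta>] by (auto simp: mdeg_add)

lemma monomials_SucE:
  assumes "\<alpha> \<in> monomials B (Suc d)"
  obtains b \<beta> where "b \<in> B" "\<beta> \<in> monomials B d" "\<alpha> = single b 1 + \<beta>"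
proof -
  have "\<alpha> \<noteq> 0" using assms unfolding monomials_def by (auto simp: mdeg_0)
  then obtain b where b: "b \<in> keys \<alpha>"
    by (metis equals0I keys_eq_empty)
  define \<beta> where "\<beta> = \<alpha> - single b 1"
  have eq: "\<alpha> = single b 1 + \<beta>"
    using b by (intro poly_mapping_eqI)
      (auto simp: \<beta>_def lookup_add lookup_minus lookup_single in_keys_iff when_def)
  have "keys \<beta> \<subseteq> keys \<alpha>"
    by (auto simp: \<beta>_def in_keys_iff lookup_minus)
  moreover have "mdeg \<alpha> = 1 + mdeg \<beta>" by (subst eq) (simp add: mdeg_add mdeg_single)
  ultimately show ?thesis
    using that[of b \<beta>] eq b assms unfolding monomials_def by auto
qed

lemma finite_monomials:
  assumes "finite B"
  shows "finite (monomials B d)"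
proof (induction d)
  case 0
  then show ?case by (simp add: monomials_0)
next
  case (Suc d)
  have "monomials B (Suc d) \<subseteq> (\<lambda>(b, \<beta>). single b 1 + \<beta>) ` (B \<times> monomials B d)"
  proof
    fix \<alpha> assume "\<alpha> \<in> monomials B (Suc d)"
    then obtain b \<beta> where "b \<in> B" "\<beta> \<in> monomials B d" "\<alpha> = single b 1 + \<beta>"
      by (rule monomials_SucE)
    then show "\<alpha> \<in> (\<lambda>(b, \<beta>). single b 1 + \<beta>) ` (B \<times> monomials B d)" by force
  qed
  then show ?case using Suc assms finite_subset by blast
qed

definition forms :: "'x set \<Rightarrow> nat \<Rightarrow> ('x, 'k::field) mpol set" where
  "forms B d = {f. keys f \<subseteq> monomials B d}"

lemma forms_eq: "forms B d = {f \<in> carrier (coord_ring B). homogeneous d f}"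
  unfolding forms_def monomials_def coord_ring_def homogeneous_def mdeg_def by auto

lemma lookup_mpol_scale: "lookup (mpol_scale c f) \<alpha> = c * lookup f \<alpha>"
proof -
  have "mpol_scale c f = Poly_Mapping.map ((*) c) f"
    unfolding mpol_scale_def by (rule mult_map_scale_conv_mult[symmetric])
  then show ?thesis by (simp add: map.rep_eq when_def)
qed

lemma mpol_scale_single: "mpol_scale c (single \<alpha> d) = single \<alpha> (c * d)"
  by (simp add: mpol_scale_def mult_single)

lemma mpol_expand: "f = (\<Sum>\<alpha>\<in>keys f. single \<alpha> (lookup f \<alpha>))"
  by (rule poly_mapping_eqI) (auto simp: lookup_sum lookup_single when_def in_keys_iff)

lemma mpol_in_span:
  assumes "keys f \<subseteq> A"
  shows "f \<in> mpol.span ((\<lambda>\<alpha>. single \<alpha> 1) ` A)"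
proof -
  have "(\<Sum>\<alpha>\<in>keys f. mpol_scale (lookup f \<alpha>) (single \<alpha> 1)) \<in>
      mpol.span ((\<lambda>\<alpha>. single \<alpha> 1) ` A)"
    using assms by (intro mpol.span_sum mpol.span_scale mpol.span_base) auto
  then show ?thesis using mpol_expand[of f] by (simp add: mpol_scale_single)
qed

lemma single_forms: "\<alpha> \<in> monomials B d \<Longrightarrow> single \<alpha> c \<in> forms B d"
  unfolding forms_def by auto

lemma subspace_forms: "mpol.subspace (forms B d :: ('x, 'k::field) mpol set)"
proof -
  have "f + g \<in> forms B d" if "f \<in> forms B d" "g \<in> forms B d" for f g :: "('x, 'k) mpol"
    using that keys_add[of f g] unfolding forms_def by blast
  moreover have "mpol_scale c f \<in> forms B d" if "f \<in> forms B d" for c and f :: "('x, 'k) mpol"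
    using that unfolding forms_def by (auto simp: in_keys_iff lookup_mpol_scale)
  ultimately show ?thesis unfolding mpol.subspace_def by (auto simp: forms_def)
qed

lemma forms_span: "forms B d = mpol.span ((\<lambda>\<alpha>. single \<alpha> 1) ` monomials B d)"
proof
  show "mpol.span ((\<lambda>\<alpha>. single \<alpha> 1) ` monomials B d) \<subseteq> forms B d"
    by (intro mpol.span_minimal subspace_forms) (auto intro: single_forms)
qed (use mpol_in_span in \<open>auto simp: forms_def\<close>)

lemma forms_mult: "f \<in> forms B i \<Longrightarrow> g \<in> forms B j \<Longrightarrow> f * g \<in> forms B (i + j)"
  unfolding forms_def using keys_mult[of f g] monomials_add by fastforce

lemma forms_0: "(forms B 0 :: ('x, 'k::field) mpol set) = range (\<lambda>c. mpol_scale c 1)"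
proof (intro equalityI subsetI)
  fix f :: "('x, 'k) mpol" assume "f \<in> forms B 0"
  then have "f \<in> mpol.span {single 0 1}" unfolding forms_span monomials_0 by simp
  then show "f \<in> range (\<lambda>c. mpol_scale c 1)" by (simp add: mpol.span_singleton)
next
  fix f :: "('x, 'k) mpol" assume "f \<in> range (\<lambda>c. mpol_scale c 1)"
  then obtain c where "f = single 0 (c * 1)"
    unfolding mpol_scale_single[symmetric] by auto
  then show "f \<in> forms B 0" using single_forms[of 0 B 0 c] by (simp add: monomials_0)
qed

lemma forms_Suc:
  "(forms B (Suc d) :: ('x, 'k::field) mpol set) \<subseteq> mpol.span {a * b | a b. a \<in> forms B 1 \<and> b \<in> forms B d}"
proof -
  have "single \<alpha> (1 :: 'k) \<in> {a * b | a b. a \<in> forms B 1 \<and> b \<in> forms B d}"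
    if \<alpha>: "\<alpha> \<in> monomials B (Suc d)" for \<alpha>
  proof -
    obtain b \<beta> where *: "b \<in> B" "\<beta> \<in> monomials B d" "\<alpha> = single b 1 + \<beta>"
      using \<alpha> by (rule monomials_SucE)
    have "single b 1 \<in> monomials B 1"
      using *(1) unfolding monomials_def by (simp add: mdeg_single)
    then have "single (single b 1) (1 :: 'k) \<in> forms B 1" by (rule single_forms)
    moreover have "single \<beta> (1 :: 'k) \<in> forms B d" using *(2) by (rule single_forms)
    moreover have "single \<alpha> (1 :: 'k) = single (single b 1) 1 * single \<beta> 1"
      unfolding *(3) by (simp add: mult_single)
    ultimately show ?thesis by blast
  qed
  then show ?thesis unfolding forms_span[of B "Suc d"] by (intro mpol.span_mono) auto
qed

abbreviation mvar :: "'x \<Rightarrow> ('x, 'k::field) mpol" where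
  "mvar b \<equiv> single (single b 1) 1"

lemma monomials_1: "monomials B 1 = (\<lambda>b. single b 1) ` B"
proof (intro equalityI subsetI)
  fix \<alpha> assume "\<alpha> \<in> monomials B 1"
  then have "\<alpha> \<in> monomials B (Suc 0)" by simp
  then obtain b \<beta> where "b \<in> B" "\<beta> \<in> monomials B 0" "\<alpha> = single b 1 + \<beta>"
    by (rule monomials_SucE)
  then show "\<alpha> \<in> (\<lambda>b. single b 1) ` B" by (simp add: monomials_0)
qed (auto simp: monomials_def mdeg_single)

lemma forms_1: "(forms B 1 :: ('x, 'k::field) mpol set) = mpol.span (mvar ` B)"
  unfolding forms_span monomials_1 image_image ..

lemma single_1_eq_iff: "single c (1 :: 'r::zero_neq_one) = single b 1 \<longleftrightarrow> c = b"
  by (metis keys_single singleton_inject zero_neq_one)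

lemma dim_forms_1:
  assumes "finite B"
  shows "mpol.dim (forms B 1 :: ('x, 'k::field) mpol set) = card B"
proof -
  have inj: "inj_on (mvar :: 'x \<Rightarrow> ('x, 'k) mpol) B"
    by (rule inj_onI) (simp only: single_1_eq_iff)
  have "mpol.independent (mvar ` B :: ('x, 'k) mpol set)"
  proof (rule mpol.independent_if_scalars_zero)
    fix u :: "('x, 'k) mpol \<Rightarrow> 'k" and v :: "('x, 'k) mpol"
    assume u: "(\<Sum>v\<in>mvar ` B. mpol_scale (u v) v) = 0" and "v \<in> mvar ` B"
    then obtain b where b: "b \<in> B" "v = mvar b" by blast
    have "(\<Sum>c\<in>B. single (single c (1 :: nat)) (u (mvar c))) = 0"
      using u by (subst (asm) sum.reindex[OF inj]) (simp add: mpol_scale_single)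
    from arg_cong[OF this, of "\<lambda>f. lookup f (single b 1)"]
    show "u v = 0"
      using assms b by (simp add: lookup_sum lookup_single when_def single_1_eq_iff[where 'r = nat, simplified])
  qed (use assms in simp)
  then have "mpol.dim (forms B 1 :: ('x, 'k) mpol set) = card (mvar ` B :: ('x, 'k) mpol set)"
    unfolding forms_1 by (rule mpol.dim_span_eq_card_independent)
  also have "\<dots> = card B" by (rule card_image[OF inj])
  finally show ?thesis .
qed

section \<open>Substitution homomorphisms and translations\<close>

definition mono_eval :: "('x \<Rightarrow> 'b::comm_ring_1) \<Rightarrow> ('x \<Rightarrow>\<^sub>0 nat) \<Rightarrow> 'b" where
  "mono_eval v \<alpha> = (\<Prod>x\<in>keys \<alpha>. v x ^ lookup \<alpha> x)"

definition mpol_eval :: "('k::field \<Rightarrow> 'b) \<Rightarrow> ('x \<Rightarrow> 'b::comm_ring_1) \<Rightarrow> ('x, 'k) mpol \<Rightarrow> 'b" where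
  "mpol_eval \<kappa> v f = (\<Sum>\<alpha>\<in>keys f. \<kappa> (lookup f \<alpha>) * mono_eval v \<alpha>)"

lemma mono_eval_superset:
  assumes "finite A" "keys \<alpha> \<subseteq> A"
  shows "mono_eval v \<alpha> = (\<Prod>x\<in>A. v x ^ lookup \<alpha> x)"
  unfolding mono_eval_def using assms by (intro prod.mono_neutral_left) (auto simp: in_keys_iff)

lemma mono_eval_add: "mono_eval v (\<alpha> + \<beta>) = mono_eval v \<alpha> * mono_eval v \<beta>"
proof -
  let ?A = "keys \<alpha> \<union> keys \<beta>"
  have "mono_eval v (\<alpha> + \<beta>) = (\<Prod>x\<in>?A. v x ^ lookup (\<alpha> + \<beta>) x)"
    by (rule mono_eval_superset) (use keys_add[of \<alpha> \<beta>] in auto)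
  also have "\<dots> = (\<Prod>x\<in>?A. v x ^ lookup \<alpha> x) * (\<Prod>x\<in>?A. v x ^ lookup \<beta> x)"
    by (simp add: lookup_add power_add prod.distrib)
  also have "\<dots> = mono_eval v \<alpha> * mono_eval v \<beta>" by (simp add: mono_eval_superset[of ?A])
  finally show ?thesis .
qed

lemma mono_eval_0: "mono_eval v 0 = 1" by (simp add: mono_eval_def)

lemma mono_eval_single: "mono_eval v (single x 1) = v x" by (simp add: mono_eval_def)

locale coefficient_hom =
  fixes \<kappa> :: "'k::field \<Rightarrow> 'b::comm_ring_1"
  assumes hom_add: "\<kappa> (a + b) = \<kappa> a + \<kappa> b" and hom_mult: "\<kappa> (a * b) = \<kappa> a * \<kappa> b"
    and hom_one: "\<kappa> 1 = 1"
begin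

lemma hom_zero: "\<kappa> 0 = 0" using hom_add[of 0 0] by simp

lemma mpol_eval_single: "mpol_eval \<kappa> v (single \<alpha> c) = \<kappa> c * mono_eval v \<alpha>"
  by (simp add: mpol_eval_def hom_zero)

lemma mpol_eval_superset:
  assumes "finite A" "keys f \<subseteq> A"
  shows "mpol_eval \<kappa> v f = (\<Sum>\<alpha>\<in>A. \<kappa> (lookup f \<alpha>) * mono_eval v \<alpha>)"
  unfolding mpol_eval_def using assms
  by (intro sum.mono_neutral_left) (auto simp: in_keys_iff hom_zero)

lemma mpol_eval_add: "mpol_eval \<kappa> v (f + g) = mpol_eval \<kappa> v f + mpol_eval \<kappa> v g"
proof -
  let ?A = "keys f \<union> keys g"
  have "mpol_eval \<kappa> v (f + g) = (\<Sum>\<alpha>\<in>?A. \<kappa> (lookup (f + g) \<alpha>) * mono_eval v \<alpha>)"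
    by (rule mpol_eval_superset) (use keys_add[of f g] in auto)
  also have "\<dots> = (\<Sum>\<alpha>\<in>?A. \<kappa> (lookup f \<alpha>) * mono_eval v \<alpha>) +
      (\<Sum>\<alpha>\<in>?A. \<kappa> (lookup g \<alpha>) * mono_eval v \<alpha>)"
    by (simp add: lookup_add hom_add distrib_right sum.distrib)
  also have "\<dots> = mpol_eval \<kappa> v f + mpol_eval \<kappa> v g" by (simp add: mpol_eval_superset[of ?A])
  finally show ?thesis .
qed

lemma mpol_eval_0: "mpol_eval \<kappa> v 0 = 0" by (simp add: mpol_eval_def)

lemma mpol_eval_sum: "mpol_eval \<kappa> v (\<Sum>i\<in>I. f i) = (\<Sum>i\<in>I. mpol_eval \<kappa> v (f i))"
  by (induction I rule: infinite_finite_induct) (auto simp: mpol_eval_0 mpol_eval_add)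

lemma mpol_eval_mult: "mpol_eval \<kappa> v (f * g) = mpol_eval \<kappa> v f * mpol_eval \<kappa> v g"
proof -
  have "f * g = (\<Sum>\<alpha>\<in>keys f. \<Sum>\<beta>\<in>keys g.
      single (\<alpha> + \<beta>) (lookup f \<alpha> * lookup g \<beta>))"
    by (subst mpol_expand[of f], subst mpol_expand[of g]) (simp add: sum_product mult_single)
  then have "mpol_eval \<kappa> v (f * g) = (\<Sum>\<alpha>\<in>keys f. \<Sum>\<beta>\<in>keys g.
      (\<kappa> (lookup f \<alpha>) * mono_eval v \<alpha>) * (\<kappa> (lookup g \<beta>) * mono_eval v \<beta>))"
    by (simp add: mpol_eval_sum mpol_eval_single hom_mult mono_eval_add ac_simps)
  then show ?thesis by (simp add: mpol_eval_def sum_product)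
qed

end

lemma mono_eval_mvar: "mono_eval mvar \<alpha> = single \<alpha> (1 :: 'k::field)"
proof -
  have pow: "mvar x ^ k = (single (single x k) 1 :: ('x, 'k) mpol)" for x :: 'x and k
  proof (induction k)
    case 0
    then show ?case by simp
  next
    case (Suc k)
    then show ?case by (simp add: mult_single flip: single_add)
  qed
  have "(\<Prod>x\<in>A. single (single x (lookup \<alpha> x)) (1 :: 'k)) =
      single (\<Sum>x\<in>A. single x (lookup \<alpha> x)) 1" if "finite A" for A
    using that by (induction A) (auto simp: mult_single)
  moreover have "(\<Sum>x\<in>keys \<alpha>. single x (lookup \<alpha> x)) = \<alpha>"
    by (rule poly_mapping_eqI) (auto simp: lookup_sum lookup_single when_def in_keys_iff)
  ultimately show ?thesis unfolding mono_eval_def pow by simp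
qed

text \<open>
  The elements of degree \<open>d\<close> of \<open>R[T]\<close>, if \<open>T\<close> has degree \<open>1\<close>.
\<close>

definition graded_coeffs :: "'x set \<Rightarrow> nat \<Rightarrow> ('x, 'k::field) mpol poly \<Rightarrow> bool" where
  "graded_coeffs B d p \<longleftrightarrow> (\<forall>i. if i \<le> d then coeff p i \<in> forms B (d - i) else coeff p i = 0)"

lemma graded_coeffs_mult:
  assumes "graded_coeffs B d p" "graded_coeffs B e q"
  shows "graded_coeffs B (d + e) (p * q)"
proof -
  have in_: "coeff p j * coeff q (i - j) \<in> forms B (d + e - i)" if "j \<le> i" "i \<le> d + e" for i j
  proof (cases "j \<le> d \<and> i - j \<le> e")
    case True
    then have "coeff p j * coeff q (i - j) \<in> forms B ((d - j) + (e - (i - j)))"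
      using assms by (intro forms_mult) (auto simp: graded_coeffs_def)
    moreover have "(d - j) + (e - (i - j)) = d + e - i" using True that by arith
    ultimately show ?thesis by simp
  next
    case False
    then have "coeff p j * coeff q (i - j) = 0" using assms by (auto simp: graded_coeffs_def)
    then show ?thesis using mpol.subspace_0[OF subspace_forms] by simp
  qed
  have zero: "coeff p j * coeff q (i - j) = 0" if "j \<le> i" "i > d + e" for i j
  proof (cases "j \<le> d")
    case True
    then have "i - j > e" using that by simp
    then show ?thesis using assms(2) by (auto simp: graded_coeffs_def)
  qed (use assms(1) in \<open>auto simp: graded_coeffs_def\<close>)
  show ?thesis
    unfolding graded_coeffs_def coeff_mult
    using in_ zero by (auto intro!: mpol.subspace_sum[OF subspace_forms] sum.neutral)
qed

lemma graded_coeffs_sum: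
  assumes "\<And>i. i \<in> I \<Longrightarrow> graded_coeffs B d (p i)"
  shows "graded_coeffs B d (\<Sum>i\<in>I. p i)"
  using assms unfolding graded_coeffs_def coeff_sum
  by (auto intro!: mpol.subspace_sum[OF subspace_forms] sum.neutral)

text \<open>
  For the translation, a functional \<open>l\<close> with \<open>l = 0\<close> on \<open>L\<close> and \<open>l x = 1\<close> is read as the point
  whose coordinates are its values at the variables. On linear forms the value at this point is
  \<open>l\<close> itself.
\<close>

theorem graded_algebra_forms:
  assumes B: "finite B" and inf: "infinite (UNIV :: 'k::field set)"
  shows "graded_algebra (mpol_scale :: 'k \<Rightarrow> ('x, 'k) mpol \<Rightarrow> _) (forms B)"
proof (unfold_locales)
  show "mpol_scale c (f * g) = mpol_scale c f * g" for c and f g :: "('x, 'k) mpol"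
    by (simp add: mpol_scale_def mult.assoc)
  show "mpol.subspace (forms B d :: ('x, 'k) mpol set)" for d by (rule subspace_forms)
  show "mpol.fin_span (forms B d :: ('x, 'k) mpol set)" for d
    unfolding mpol.fin_span_def forms_span using finite_monomials[OF B] by blast
  show "f * g \<in> forms B (i + j)" if "f \<in> forms B i" "g \<in> forms B j" for f g :: "('x, 'k) mpol"
    and i j
    using that by (rule forms_mult)
  show "forms B 0 = range (\<lambda>c :: 'k. mpol_scale c 1)" by (rule forms_0)
  show "forms B (Suc d) \<subseteq> mpol.span {a * b | a b. a \<in> forms B 1 \<and> b \<in> (forms B d :: ('x, 'k) mpol set)}" for d
    by (rule forms_Suc)
  show "infinite (UNIV :: 'k set)" by (rule inf)
next
  fix L :: "('x, 'k) mpol set" and x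
  assume L: "mpol.subspace L" "L \<subseteq> forms B 1" and x: "x \<in> forms B 1" "x \<notin> L"
  obtain l where l: "Vector_Spaces.linear mpol_scale (*) l" "\<forall>u\<in>L. l u = 0" "l x = 1"
    using mpol.ex_separating_functional[OF L(1) x(2)] by blast
  interpret l: Vector_Spaces.linear "mpol_scale :: 'k \<Rightarrow> ('x, 'k) mpol \<Rightarrow> _" "(*)" l by (rule l(1))
  define \<kappa> :: "'k \<Rightarrow> ('x, 'k) mpol poly" where "\<kappa> c = [:single 0 c:]" for c
  define v :: "'x \<Rightarrow> ('x, 'k) mpol poly" where "v b = [:mvar b, single 0 (l (mvar b)):]" for b
  interpret \<kappa>: coefficient_hom \<kappa>
    by unfold_locales (auto simp: \<kappa>_def single_add mult_single one_pCons mult.commute)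
  interpret c0: coefficient_hom "single 0 :: 'k \<Rightarrow> ('x, 'k) mpol"
    by unfold_locales (auto simp: single_add mult_single)
  define \<theta> where "\<theta> = mpol_eval \<kappa> v"
  have \<theta>1: "\<theta> 1 = 1"
    unfolding \<theta>_def using \<kappa>.mpol_eval_single[of v 0 1] by (simp add: mono_eval_0 \<kappa>.hom_one)
  have const: "coeff (\<theta> f) 0 = f" for f
  proof -
    have "coeff (mono_eval v \<alpha>) 0 = mono_eval mvar \<alpha>" for \<alpha>
    proof -
      have "coeff (p ^ k) 0 = coeff p 0 ^ k" for p :: "('x, 'k) mpol poly" and k
        by (simp flip: poly_0_coeff_0)
      moreover have "coeff (prod p A) 0 = (\<Prod>i\<in>A. coeff (p i) 0)" for p :: "'x \<Rightarrow> ('x, 'k) mpol poly"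
        and A
        by (simp add: poly_prod flip: poly_0_coeff_0)
      ultimately show ?thesis unfolding mono_eval_def by (simp add: v_def)
    qed
    then have "coeff (\<theta> f) 0 = (\<Sum>\<alpha>\<in>keys f.
        single 0 (lookup f \<alpha>) * single \<alpha> 1)"
      unfolding \<theta>_def mpol_eval_def by (simp add: coeff_sum \<kappa>_def mono_eval_mvar[simplified])
    also have "\<dots> = f" using mpol_expand[of f] by (simp add: mult_single)
    finally show ?thesis .
  qed
  have lin: "\<theta> a = [:a, single 0 (l a):]" if "a \<in> forms B 1" for a
    using that unfolding forms_1
  proof (induction rule: mpol.span_induct_alt)
    case base
    then show ?case by (simp add: \<theta>_def \<kappa>.mpol_eval_0 l.zero)
  next
    case (step c a y)
    then obtain b where b: "a = mvar b" by blast
    have "\<theta> (mpol_scale c a) = \<kappa> c * v b"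
      unfolding \<theta>_def b mpol_scale_single
        by (simp add: \<kappa>.mpol_eval_single mono_eval_single[simplified])
    also have "\<dots> = [:mpol_scale c a, single 0 (l (mpol_scale c a)):]"
      unfolding l.scale by (simp add: \<kappa>_def v_def b mpol_scale_def mult_single mult.commute)
    finally show ?case
      using step(2) by (simp add: \<theta>_def \<kappa>.mpol_eval_add l.add single_add)
  qed
  have grade: "graded_coeffs B d (\<theta> f)" if f: "f \<in> forms B d" for f d
  proof -
    have c: "graded_coeffs B 0 (\<kappa> c)" for c
      unfolding graded_coeffs_def \<kappa>_def using single_forms[of 0 B 0 c]
        by (auto simp: monomials_0 coeff_pCons split: nat.splits)
    have "graded_coeffs B 1 (v b)" if "b \<in> B" for b
    proof -
      have "(mvar b :: ('x, 'k) mpol) \<in> forms B 1" using that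
        by (intro single_forms) (simp add: monomials_1[simplified])
      moreover have "single 0 (l (mvar b)) \<in> forms B 0"
        by (intro single_forms) (simp add: monomials_0)
      ultimately show ?thesis
        unfolding graded_coeffs_def v_def by (auto simp: coeff_pCons split: nat.splits)
    qed
    then have "graded_coeffs B d (mono_eval v \<alpha>)" if "\<alpha> \<in> monomials B d" for \<alpha> d
      using that
    proof (induction d arbitrary: \<alpha>)
      case 0
      then show ?case using c[of 1] by (simp add: monomials_0 mono_eval_0 \<kappa>.hom_one)
    next
      case (Suc d)
      obtain b \<beta> where "b \<in> B" "\<beta> \<in> monomials B d" "\<alpha> = single b 1 + \<beta>"
        using Suc.prems(2) by (rule monomials_SucE)
      then show ?case
        using graded_coeffs_mult[of B 1 "v b" d "mono_eval v \<beta>"] Suc.IH[of \<beta>] Suc.prems(1)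
        by (simp add: mono_eval_add mono_eval_single[simplified])
    qed
    then have "graded_coeffs B (0 + d) (\<kappa> (lookup f \<alpha>) * mono_eval v \<alpha>)"
      if "\<alpha> \<in> keys f" for \<alpha>
      using that f by (intro graded_coeffs_mult c) (auto simp: forms_def)
    then show ?thesis
      unfolding \<theta>_def mpol_eval_def by (intro graded_coeffs_sum) simp
  qed
  show "\<exists>\<theta> :: ('x, 'k) mpol \<Rightarrow> ('x, 'k) mpol poly.
      (\<forall>a b. \<theta> (a + b) = \<theta> a + \<theta> b) \<and> (\<forall>a b. \<theta> (a * b) = \<theta> a * \<theta> b) \<and> \<theta> 1 = 1 \<and>
      (\<forall>a\<in>L. \<theta> a = [:a:]) \<and> \<theta> x = [:x, 1:] \<and>
      (\<forall>d. \<forall>f\<in>forms B d. coeff (\<theta> f) 0 = f \<and>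
         (\<forall>i. if i \<le> d then coeff (\<theta> f) i \<in> forms B (d - i) else coeff (\<theta> f) i = 0))"
  proof (intro exI[of _ \<theta>] conjI)
    show "\<forall>a\<in>L. \<theta> a = [:a:]" using lin L(2) l(2) by auto
    show "\<theta> x = [:x, 1:]" using lin[OF x(1)] l(3) by simp
    show "\<forall>d. \<forall>f\<in>forms B d. coeff (\<theta> f) 0 = f \<and>
         (\<forall>i. if i \<le> d then coeff (\<theta> f) i \<in> forms B (d - i) else coeff (\<theta> f) i = 0)"
      using const grade unfolding graded_coeffs_def by blast
  qed (simp_all add: \<theta>1, simp_all add: \<theta>_def \<kappa>.mpol_eval_add \<kappa>.mpol_eval_mult)
qed

section \<open>Extension of the base field\<close>

definition products_deg ::
  "'x set \<Rightarrow> (nat \<Rightarrow> ('x, 'k::field) mpol set) \<Rightarrow> nat set \<Rightarrow> nat \<Rightarrow> ('x, 'k) mpol set" where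
  "products_deg B G X d =
     {prod g X * r | g r e. (\<forall>i\<in>X. g i \<in> G i) \<and> r \<in> forms B e \<and> d = card X + e}"

definition mpol_series :: "(nat \<Rightarrow> ('x, 'k::field) mpol set) \<Rightarrow> rat fps" where
  "mpol_series F = Abs_fps (\<lambda>d. of_nat (mpol.dim (F d)))"

lemma mpol_span_mult:
  assumes "a \<in> mpol.span A" "b \<in> mpol.span C"
  shows "a * b \<in> mpol.span {x * y | x y. x \<in> A \<and> y \<in> C}"
proof -
  have scale_left: "mpol_scale c f * g = mpol_scale c (f * g)" for c and f g :: "('a, 'b) mpol"
    by (simp add: mpol_scale_def mult.assoc)
  have scale_right: "f * mpol_scale c g = mpol_scale c (f * g)" for c and f g :: "('a, 'b) mpol"
    by (simp add: mpol_scale_def ac_simps)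
  have 1: "x * b \<in> mpol.span {x * y | x y. x \<in> A \<and> y \<in> C}" if "x \<in> A" for x
    using assms(2)
  proof (induction rule: mpol.span_induct_alt)
    case base
    then show ?case by (simp add: mpol.span_zero)
  next
    case (step c y z)
    have "x * y \<in> mpol.span {x * y | x y. x \<in> A \<and> y \<in> C}"
      using that step(1) by (intro mpol.span_base) blast
    then show ?case
      using step(2) by (simp add: distrib_left scale_right mpol.span_add mpol.span_scale)
  qed
  show ?thesis
    using assms(1)
  proof (induction rule: mpol.span_induct_alt)
    case base
    then show ?case by (simp add: mpol.span_zero)
  next
    case (step c x z)
    then show ?case
      using 1[OF step(1)] by (simp add: distrib_right scale_left mpol.span_add mpol.span_scale)
  qed
qed

lemma mpol_span_prod:
  assumes "finite X" "\<And>i. i \<in> X \<Longrightarrow> g i \<in> mpol.span (A i)"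
  shows "prod g X \<in> mpol.span {prod h X | h. \<forall>i\<in>X. h i \<in> A i}"
  using assms
proof (induction X)
  case empty
  then show ?case by (simp add: mpol.span_base)
next
  case (insert s X)
  have "g s * prod g X \<in> mpol.span {x * y | x y. x \<in> A s \<and> y \<in> {prod h X | h. \<forall>i\<in>X. h i \<in> A i}}"
    using insert by (intro mpol_span_mult) auto
  also have "\<dots> \<subseteq> mpol.span {prod h (insert s X) | h. \<forall>i\<in>insert s X. h i \<in> A i}"
  proof (rule mpol.span_mono, rule subsetI)
    fix v assume "v \<in> {x * y | x y. x \<in> A s \<and> y \<in> {prod h X | h. \<forall>i\<in>X. h i \<in> A i}}"
    then obtain x h where v: "v = x * prod h X" "x \<in> A s" "\<forall>i\<in>X. h i \<in> A i" by blast
    define h' where "h' = h(s := x)"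
    have "prod h' X = prod h X"
      using insert.hyps unfolding h'_def by (intro prod.cong) auto
    then have "v = prod h' (insert s X)" using v(1) insert.hyps by (simp add: h'_def)
    moreover have "\<forall>i\<in>insert s X. h' i \<in> A i" using v(2,3) unfolding h'_def by simp
    ultimately show "v \<in> {prod h (insert s X) | h. \<forall>i\<in>insert s X. h i \<in> A i}" by blast
  qed
  finally show ?case using insert.hyps by simp
qed

locale field_hom = coefficient_hom \<phi> for \<phi> :: "'k::field \<Rightarrow> 'l::field"
begin

lemma hom_eq_0: "\<phi> c = 0 \<longleftrightarrow> c = 0"
proof
  assume "\<phi> c = 0"
  show "c = 0"
  proof (rule ccontr)
    assume "c \<noteq> 0"
    then have "\<phi> c * \<phi> (inverse c) = 1" using hom_mult[of c "inverse c"] hom_one by simp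
    then show False using \<open>\<phi> c = 0\<close> by simp
  qed
qed (simp add: hom_zero)

sublocale const: coefficient_hom "\<lambda>c. single 0 (\<phi> c) :: ('x, 'l) mpol"
  by unfold_locales (simp_all add: hom_add hom_mult hom_one single_add mult_single)

definition extend :: "('x, 'k) mpol \<Rightarrow> ('x, 'l) mpol" where
  "extend = mpol_eval (\<lambda>c. single 0 (\<phi> c)) mvar"

lemma extend_single: "extend (single \<alpha> c) = single \<alpha> (\<phi> c)"
  unfolding extend_def const.mpol_eval_single mono_eval_mvar by (simp add: mult_single)

lemma lookup_extend: "lookup (extend f) \<alpha> = \<phi> (lookup f \<alpha>)"
proof -
  have "extend f = (\<Sum>\<alpha>\<in>keys f. single \<alpha> (\<phi> (lookup f \<alpha>)))"
    unfolding extend_def mpol_eval_def mono_eval_mvar by (simp add: mult_single)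
  then show ?thesis
    by (simp add: lookup_sum lookup_single when_def in_keys_iff hom_zero)
qed

lemma extend_add: "extend (f + g) = extend f + extend g"
  unfolding extend_def by (rule const.mpol_eval_add)

lemma extend_mult: "extend (f * g) = extend f * extend g"
  unfolding extend_def by (rule const.mpol_eval_mult)

lemma extend_0: "extend 0 = 0"
  unfolding extend_def by (rule const.mpol_eval_0)

lemma extend_1: "extend 1 = 1"
  using extend_single[of 0 1] hom_one by simp

lemma extend_prod: "extend (prod g X) = (\<Prod>i\<in>X. extend (g i))"
  by (induction X rule: infinite_finite_induct) (auto simp: extend_1 extend_mult)

lemma extend_scale: "extend (mpol_scale c f) = mpol_scale (\<phi> c) (extend f)"
  by (rule poly_mapping_eqI) (simp add: lookup_extend lookup_mpol_scale hom_mult)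

lemma extend_forms: "f \<in> forms B d \<Longrightarrow> extend f \<in> forms B d"
  unfolding forms_def by (auto simp: in_keys_iff lookup_extend hom_eq_0)

lemma inj_extend: "inj extend"
proof (rule injI, rule poly_mapping_eqI)
  fix f g :: "('x, 'k) mpol" and \<alpha> assume "extend f = extend g"
  then have "\<phi> (lookup f \<alpha>) = \<phi> (lookup g \<alpha>)" using lookup_extend by metis
  then have "\<phi> (lookup f \<alpha> - lookup g \<alpha>) = 0"
    using hom_add[of "lookup f \<alpha> - lookup g \<alpha>" "lookup g \<alpha>"] by simp
  then show "lookup f \<alpha> = lookup g \<alpha>" by (simp add: hom_eq_0)
qed

lemma extend_span:
  assumes "f \<in> mpol.span A"
  shows "extend f \<in> mpol.span (extend ` A)"
  using assms
proof (induction rule: mpol.span_induct_alt)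
  case base
  then show ?case by (simp add: extend_0 mpol.span_zero)
next
  case (step c x y)
  then show ?case
    by (simp add: extend_add extend_scale mpol.span_add mpol.span_scale mpol.span_base)
qed

text \<open>
  A linear relation over the larger field is pushed down by a functional \<open>l\<close> that is linear over
  the smaller field and does not kill a chosen coefficient of the relation.
\<close>

lemma independent_extend:
  assumes "mpol.independent (A :: ('x, 'k) mpol set)"
  shows "mpol.independent (extend ` A)"
  unfolding mpol.independent_explicit_finite_subsets
proof (intro allI impI ballI)
  fix T u v
  assume T: "T \<subseteq> extend ` A" "finite T" "(\<Sum>v\<in>T. mpol_scale (u v) v) = 0" and v: "v \<in> T"
  obtain T0 where T0: "T0 \<subseteq> A" "finite T0" "T = extend ` T0"
    using finite_subset_image[OF T(2,1)] by blast
  obtain b where b: "b \<in> T0" "v = extend b" using v T0(3) by blast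
  show "u v = 0"
  proof (rule ccontr)
    assume "u v \<noteq> 0"
    interpret K: vector_space "\<lambda>c (y :: 'l). \<phi> c * y"
      by unfold_locales (auto simp: hom_add hom_mult hom_one algebra_simps)
    have "K.subspace {0}" by (auto simp: K.subspace_def)
    then obtain l where l: "Vector_Spaces.linear (\<lambda>c (y :: 'l). \<phi> c * y) (*) l" "l (u v) = 1"
      using K.ex_separating_functional[of "{0}" "u v"] \<open>u v \<noteq> 0\<close> by auto
    interpret l: Vector_Spaces.linear "\<lambda>c (y :: 'l). \<phi> c * y" "(*)" l by (rule l(1))
    have "(\<Sum>b\<in>T0. mpol_scale (l (u (extend b))) b) = 0"
    proof (rule poly_mapping_eqI)
      fix \<alpha>
      have "(\<Sum>b\<in>T0. mpol_scale (u (extend b)) (extend b)) = 0"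
        using T(3) unfolding T0(3)
          by (subst (asm) sum.reindex) (auto intro: inj_on_subset[OF inj_extend])
      then have "lookup (\<Sum>b\<in>T0. mpol_scale (u (extend b)) (extend b)) \<alpha> = 0" by simp
      then have "(\<Sum>b\<in>T0. \<phi> (lookup b \<alpha>) * u (extend b)) = 0"
        by (simp add: lookup_sum lookup_mpol_scale lookup_extend mult.commute)
      then have "l (\<Sum>b\<in>T0. \<phi> (lookup b \<alpha>) * u (extend b)) = 0" by (simp add: l.zero)
      then have "(\<Sum>b\<in>T0. lookup b \<alpha> * l (u (extend b))) = 0" by (simp add: l.sum l.scale)
      then show "lookup (\<Sum>b\<in>T0. mpol_scale (l (u (extend b))) b) \<alpha> = lookup 0 \<alpha>"
        by (simp add: lookup_sum lookup_mpol_scale mult.commute)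
    qed
    then have "\<forall>b\<in>T0. l (u (extend b)) = 0"
      using assms[unfolded mpol.independent_explicit_finite_subsets, rule_format, OF T0(1,2),
          of "\<lambda>b. l (u (extend b))"] by blast
    then show False using b l(2) by simp
  qed
qed

lemma dim_extend: "mpol.dim (extend ` A) = mpol.dim (A :: ('x, 'k) mpol set)"
proof -
  obtain C where C: "C \<subseteq> A" "mpol.independent C" "A \<subseteq> mpol.span C" "card C = mpol.dim A"
    by (rule mpol.basis_exists)
  have "extend ` A \<subseteq> mpol.span (extend ` C)" using C(3) extend_span by blast
  then have "mpol.dim (extend ` A) = card (extend ` C)"
    using mpol.basis_card_eq_dim[OF image_mono[OF C(1)] _ independent_extend[OF C(2)]] by simp
  also have "\<dots> = card C" by (rule card_image[OF inj_on_subset[OF inj_extend]]) simp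
  finally show ?thesis using C(4) by simp
qed

lemma forms_extend: "(forms B d :: ('x, 'l) mpol set) = mpol.span (extend ` forms B d)"
proof
  have "single \<alpha> 1 \<in> extend ` forms B d" if "\<alpha> \<in> monomials B d" for \<alpha>
    using single_forms[OF that, of "1 :: 'k"] extend_single[of \<alpha> 1] hom_one by (metis image_eqI)
  then show "(forms B d :: ('x, 'l) mpol set) \<subseteq> mpol.span (extend ` forms B d)"
    by (subst forms_span, intro mpol.span_mono) auto
qed (intro mpol.span_minimal subspace_forms, auto intro: extend_forms)

lemma products_deg_extend:
  assumes "finite X"
  shows "mpol.span (extend ` products_deg B G X d) =
    mpol.span (products_deg B (\<lambda>i. mpol.span (extend ` G i)) X d)"
proof
  show "mpol.span (extend ` products_deg B G X d) \<subseteq> mpol.span (products_deg B (\<lambda>i. mpol.span (extend ` G i)) X d)"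
  proof (rule mpol.span_mono, rule image_subsetI)
    fix f assume "f \<in> products_deg B G X d"
    then obtain g r e where f: "f = prod g X * r" "\<forall>i\<in>X. g i \<in> G i" "r \<in> forms B e" "d = card X + e"
      unfolding products_deg_def by blast
    have "extend f = (\<Prod>i\<in>X. extend (g i)) * extend r" using f(1)
      by (simp add: extend_mult extend_prod)
    moreover have "\<forall>i\<in>X. extend (g i) \<in> mpol.span (extend ` G i)" using f(2)
      by (auto intro: mpol.span_base)
    ultimately show "extend f \<in> products_deg B (\<lambda>i. mpol.span (extend ` G i)) X d"
      using extend_forms[OF f(3)] f(4) unfolding products_deg_def by blast
  qed
  show "mpol.span (products_deg B (\<lambda>i. mpol.span (extend ` G i)) X d) \<subseteq> mpol.span (extend ` products_deg B G X d)"
  proof (rule mpol.span_minimal[OF _ mpol.subspace_span], rule subsetI)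
    fix f assume "f \<in> products_deg B (\<lambda>i. mpol.span (extend ` G i)) X d"
    then obtain g r e where f: "f = prod g X * r" "\<forall>i\<in>X. g i \<in> mpol.span (extend ` G i)"
      "r \<in> forms B e" "d = card X + e"
      unfolding products_deg_def by blast
    have "prod g X \<in> mpol.span {prod h X | h. \<forall>i\<in>X. h i \<in> extend ` G i}"
      using f(2) by (intro mpol_span_prod[OF assms]) blast
    then have "f \<in> mpol.span {x * y | x y. x \<in> {prod h X | h. \<forall>i\<in>X. h i \<in> extend ` G i} \<and> y \<in> extend ` forms B e}"
      unfolding f(1) using f(3) forms_extend[of B e] by (intro mpol_span_mult) auto
    also have "\<dots> \<subseteq> mpol.span (extend ` products_deg B G X d)"
    proof (rule mpol.span_mono, rule subsetI)
      fix v assume "v \<in> {x * y | x y. x \<in> {prod h X | h. \<forall>i\<in>X. h i \<in> extend ` G i} \<and> y \<in> extend ` forms B e}"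
      then obtain h r
        where v: "v = prod h X * extend r" "\<forall>i\<in>X. h i \<in> extend ` G i" "r \<in> forms B e" by blast
      obtain h0 where h0: "\<forall>i\<in>X. h0 i \<in> G i \<and> h i = extend (h0 i)"
        using bchoice[of X "\<lambda>i y. y \<in> G i \<and> h i = extend y"] v(2) by blast
      have "v = extend (prod h0 X * r)" using h0 v(1) by (simp add: extend_mult extend_prod)
      moreover have "prod h0 X * r \<in> products_deg B G X d"
        unfolding products_deg_def using h0 v(3) f(4) by blast
      ultimately show "v \<in> extend ` products_deg B G X d" by blast
    qed
    finally show "f \<in> mpol.span (extend ` products_deg B G X d)" .
  qed
qed

end

lemma field_hom_fract: "field_hom (\<lambda>c :: 'k::field. Fract [:c:] 1)"
  by unfold_locales (simp_all add: One_fract_def one_pCons mult.commute)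

lemma infinite_poly_fract: "infinite (UNIV :: 'k::field poly fract set)"
proof -
  have "inj (\<lambda>n. Fract (monom 1 n) 1 :: 'k poly fract)"
    by (rule injI) (simp add: eq_fract monom_eq_iff')
  then show ?thesis using finite_imageD infinite_UNIV_nat by (metis finite_subset subset_UNIV)
qed

text \<open>
  Over \<open>K(t)\<close>, which is infinite, this holds for the extended spaces of linear forms. All the
  spaces involved are spanned by images of spaces over \<open>K\<close>, so their dimensions are those over
  \<open>K\<close>.
\<close>

theorem alternating_mpol_series:
  fixes G :: "nat \<Rightarrow> ('x, 'k::field) mpol set"
  assumes B: "finite B" and G: "\<And>i. G i \<subseteq> forms B 1"
  shows "finite S \<Longrightarrow> S \<noteq> {} \<Longrightarrow> \<exists>Q :: rat poly. (Q = 0 \<or> degree Q < card S) \<and>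
    (1 - fps_X) ^ (card B - mpol.dim (\<Union>i\<in>S. G i)) *
      (\<Sum>X\<in>Pow S. (- 1) ^ card X * mpol_series (products_deg B G X)) = fps_of_poly Q"
    and "(1 - fps_X) ^ card B * mpol_series (products_deg B G {}) = 1"
proof -
  interpret h: field_hom "\<lambda>c :: 'k. Fract [:c:] 1" by (rule field_hom_fract)
  define G' where "G' i = mpol.span (h.extend ` G i)" for i
  interpret L: graded_algebra "mpol_scale :: 'k poly fract \<Rightarrow> ('x, 'k poly fract) mpol \<Rightarrow> _" "forms B"
    by (rule graded_algebra_forms[OF B infinite_poly_fract])
  interpret L: linear_ideals "mpol_scale :: 'k poly fract \<Rightarrow> ('x, 'k poly fract) mpol \<Rightarrow> _" "forms B" G'
  proof
    show "mpol.subspace (G' i)" for i unfolding G'_def by (rule mpol.subspace_span)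
    show "G' i \<subseteq> forms B 1" for i
      unfolding G'_def using G h.extend_forms by (intro mpol.span_minimal subspace_forms) blast
  qed
  have prod_part: "L.prod_part X d = mpol.span (products_deg B G' X d)" for X d
  proof -
    have "{a * r | k a e r. (k, a) \<in> L.prod_gens X \<and> r \<in> forms B e \<and> d = k + e} = products_deg B G' X d"
      unfolding L.prod_gens_def products_deg_def by blast
    then show ?thesis unfolding L.prod_part_def L.ideal_part_def by simp
  qed
  have series: "L.hilb (L.prod_part X) = mpol_series (products_deg B G X)" if "finite X" for X
  proof -
    have "mpol.dim (L.prod_part X d) = mpol.dim (products_deg B G X d)" for d
      unfolding prod_part G'_def h.products_deg_extend[OF that, symmetric]
        by (simp add: h.dim_extend)
    then show ?thesis unfolding L.hilb_def mpol_series_def by simp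
  qed
  {
    assume S: "finite S" "S \<noteq> {}"
    have "mpol.span (\<Union>i\<in>S. G' i) = mpol.span (h.extend ` (\<Union>i\<in>S. G i))"
    proof (intro subset_antisym mpol.span_minimal mpol.subspace_span)
      show "(\<Union>i\<in>S. G' i) \<subseteq> mpol.span (h.extend ` (\<Union>i\<in>S. G i))"
        unfolding G'_def by (intro UN_least mpol.span_mono) blast
      show "h.extend ` (\<Union>i\<in>S. G i) \<subseteq> mpol.span (\<Union>i\<in>S. G' i)"
        unfolding G'_def by (auto intro!: mpol.span_base)
    qed
    then have "mpol.dim (mpol.span (\<Union>i\<in>S. G' i)) = mpol.dim (\<Union>i\<in>S. G i)"
      by (simp add: h.dim_extend)
    moreover have "(\<Sum>X\<in>Pow S. (- 1) ^ card X * L.hilb (L.prod_part X)) =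
        (\<Sum>X\<in>Pow S. (- 1) ^ card X * mpol_series (products_deg B G X))"
      by (intro sum.cong refl) (metis PowD S(1) finite_subset series)
    ultimately show "\<exists>Q :: rat poly. (Q = 0 \<or> degree Q < card S) \<and>
      (1 - fps_X) ^ (card B - mpol.dim (\<Union>i\<in>S. G i)) *
        (\<Sum>X\<in>Pow S. (- 1) ^ card X * mpol_series (products_deg B G X)) = fps_of_poly Q"
      using L.alternating_hilbert_series[OF S] dim_forms_1[OF B, where 'k = "'k poly fract"] by simp
  }
  have "products_deg B G' {} d = forms B d" for d
    unfolding products_deg_def by auto
  then have "L.prod_part {} = forms B"
    unfolding prod_part fun_eq_iff by (simp add: mpol.span_eq_iff[THEN iffD2, OF subspace_forms])
  then show "(1 - fps_X) ^ card B * mpol_series (products_deg B G {}) = 1"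
    using L.hilb_gr series[of "{}"] dim_forms_1[OF B, where 'k = "'k poly fract"] by simp
qed

section \<open>Homogeneous parts of products of ideals\<close>

lemma coord_ring_simps:
  "monoid.mult (coord_ring B) = (*)" "one (coord_ring B) = 1" "zero (coord_ring B) = 0" "add (coord_ring B) = (+)"
  by (simp_all add: coord_ring_def)

lemma carrier_eq_span: "carrier (coord_ring B :: ('x, 'k::field) mpol ring) = mpol.span (\<Union>e. forms B e)"
proof
  show "carrier (coord_ring B :: ('x, 'k) mpol ring) \<subseteq> mpol.span (\<Union>e. forms B e)"
  proof
    fix f :: "('x, 'k) mpol" assume f: "f \<in> carrier (coord_ring B)"
    have "single \<alpha> c \<in> mpol.span (\<Union>e. forms B e)"
      if "\<alpha> \<in> keys f" for \<alpha> and c :: 'k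
    proof (rule mpol.span_base, rule UN_I[OF UNIV_I], rule single_forms)
      show "\<alpha> \<in> monomials B (mdeg \<alpha>)"
        using f that unfolding coord_ring_def monomials_def by simp
    qed
    then show "f \<in> mpol.span (\<Union>e. forms B e)"
      by (subst mpol_expand) (rule mpol.span_sum)
  qed
  have "mpol.subspace (carrier (coord_ring B :: ('x, 'k) mpol ring))"
    unfolding mpol.subspace_def coord_ring_def using keys_add
    by (fastforce simp: in_keys_iff lookup_mpol_scale)
  then show "mpol.span (\<Union>e. forms B e) \<subseteq> carrier (coord_ring B :: ('x, 'k) mpol ring)"
    by (intro mpol.span_minimal) (auto simp: forms_eq)
qed

lemma single_0_carrier: "single 0 c \<in> carrier (coord_ring B)"
  by (auto simp: coord_ring_def)

lemma ideal_scale: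
  assumes "ideal I (coord_ring B)" "f \<in> I"
  shows "mpol_scale c f \<in> I"
  using ideal.I_l_closed[OF assms single_0_carrier] by (simp add: mpol_scale_def coord_ring_simps)

lemma ideal_subspace:
  assumes "ideal I (coord_ring B)"
  shows "mpol.subspace I"
proof -
  note I = ideal.axioms(1)[OF assms]
  have "0 \<in> I" using additive_subgroup.zero_closed[OF I] by (simp add: coord_ring_simps)
  moreover have "f + g \<in> I" if "f \<in> I" "g \<in> I" for f g
    using additive_subgroup.a_closed[OF I that] by (simp add: coord_ring_simps)
  ultimately show ?thesis
    using ideal_scale[OF assms] unfolding mpol.subspace_def by blast
qed

lemma genideal_eq_span:
  fixes F :: "('x, 'k::field) mpol set"
  assumes F: "F \<subseteq> carrier (coord_ring B)"
  shows "Idl\<^bsub>coord_ring B\<^esub> F = mpol.span {a * r | a r. a \<in> F \<and> r \<in> carrier (coord_ring B)}"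
    (is "_ = mpol.span ?T")
proof
  interpret R: cring "coord_ring B :: ('x, 'k) mpol ring" by (rule cring_coord_ring)
  let ?R = "coord_ring B :: ('x, 'k) mpol ring"
  note simps = coord_ring_simps
  have T: "?T \<subseteq> carrier ?R" using F R.m_closed by (auto simp: simps)
  have sub: "mpol.span ?T \<subseteq> carrier ?R"
    using T mpol.span_minimal[OF T] by (simp add: carrier_eq_span mpol.subspace_span)
  have mult: "x * v \<in> mpol.span ?T" if x: "x \<in> carrier ?R" and v: "v \<in> mpol.span ?T" for x v
  proof -
    have "x * v \<in> mpol.span {x' * y | x' y. x' \<in> {x} \<and> y \<in> ?T}"
      using mpol_span_mult[of x "{x}" v ?T] v by (simp add: mpol.span_base)
    also have "\<dots> \<subseteq> mpol.span ?T"
    proof (rule mpol.span_mono, rule subsetI)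
      fix w assume "w \<in> {x' * y | x' y. x' \<in> {x} \<and> y \<in> ?T}"
      then obtain a r where "w = x * (a * r)" "a \<in> F" "r \<in> carrier ?R" by blast
      moreover have "x * r \<in> carrier ?R" using R.m_closed[OF x \<open>r \<in> carrier ?R\<close>]
        by (simp add: simps)
      ultimately show "w \<in> ?T" by (auto simp: mult.left_commute)
    qed
    finally show ?thesis .
  qed
  have "ideal (mpol.span ?T) ?R"
  proof (rule idealI)
    show "subgroup (mpol.span ?T) (add_monoid ?R)"
    proof
      show "mpol.span ?T \<subseteq> carrier (add_monoid ?R)" using sub by simp
      show "x \<otimes>\<^bsub>add_monoid ?R\<^esub> y \<in> mpol.span ?T" if "x \<in> mpol.span ?T" "y \<in> mpol.span ?T" for x y
        using that by (simp add: simps mpol.span_add)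
      show "\<one>\<^bsub>add_monoid ?R\<^esub> \<in> mpol.span ?T" by (simp add: simps mpol.span_zero)
      show "inv\<^bsub>add_monoid ?R\<^esub> x \<in> mpol.span ?T" if x: "x \<in> mpol.span ?T" for x
      proof -
        have "- x \<in> mpol.span ?T" using x by (rule mpol.span_neg)
        moreover from this have "inv\<^bsub>add_monoid ?R\<^esub> x = - x"
          using R.minus_equality[of "- x" x] x sub by (auto simp: simps a_inv_def)
        ultimately show ?thesis by simp
      qed
    qed
    fix a x assume "a \<in> mpol.span ?T" "x \<in> carrier ?R"
    then show "x \<otimes>\<^bsub>?R\<^esub> a \<in> mpol.span ?T" "a \<otimes>\<^bsub>?R\<^esub> x \<in> mpol.span ?T"
      using mult[of x a] by (simp_all add: simps mult.commute[of a x])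
  qed (rule R.ring_axioms)
  moreover have "F \<subseteq> mpol.span ?T"
  proof
    fix a assume "a \<in> F"
    moreover have "1 \<in> carrier ?R" using R.one_closed by (simp add: simps)
    ultimately have "a * 1 \<in> ?T" by blast
    from mpol.span_base[OF this] show "a \<in> mpol.span ?T" by simp
  qed
  ultimately show "Idl\<^bsub>?R\<^esub> F \<subseteq> mpol.span ?T" by (rule R.genideal_minimal)
  have ideal: "ideal (Idl\<^bsub>?R\<^esub> F) ?R" by (rule R.genideal_ideal[OF F])
  have "?T \<subseteq> Idl\<^bsub>?R\<^esub> F"
  proof
    fix v assume "v \<in> ?T"
    then obtain a r where v: "v = a * r" "a \<in> F" "r \<in> carrier ?R" by blast
    then have "a \<in> Idl\<^bsub>?R\<^esub> F" using R.genideal_self[OF F] by blast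
    from ideal.I_r_closed[OF ideal this v(3)] show "v \<in> Idl\<^bsub>?R\<^esub> F" by (simp add: v(1) simps)
  qed
  then show "mpol.span ?T \<subseteq> Idl\<^bsub>?R\<^esub> F"
    by (rule mpol.span_minimal[OF _ ideal_subspace[OF ideal]])
qed

lemma ideal_prod_span:
  "ideal_prod (coord_ring B) (mpol.span A) (mpol.span C) = mpol.span {x * y | x y. x \<in> A \<and> y \<in> C}"
proof (intro equalityI subsetI)
  fix f assume "f \<in> ideal_prod (coord_ring B) (mpol.span A) (mpol.span C)"
  then show "f \<in> mpol.span {x * y | x y. x \<in> A \<and> y \<in> C}"
    by induction (auto simp: coord_ring_simps mpol_span_mult mpol.span_add)
next
  fix f assume "f \<in> mpol.span {x * y | x y. x \<in> A \<and> y \<in> C}"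
  then show "f \<in> ideal_prod (coord_ring B) (mpol.span A) (mpol.span C)"
  proof (induction rule: mpol.span_induct_alt)
    case base
    show ?case
      using ideal_prod.prod[OF mpol.span_zero mpol.span_zero, of "coord_ring B" A C]
      by (simp add: coord_ring_simps)
  next
    case (step c v z)
    then obtain x y where v: "v = x * y" "x \<in> A" "y \<in> C" by blast
    have "mpol_scale c x * y \<in> ideal_prod (coord_ring B) (mpol.span A) (mpol.span C)"
      using ideal_prod.prod[of "mpol_scale c x" "mpol.span A" y "mpol.span C" "coord_ring B"] v
      by (simp add: coord_ring_simps mpol.span_base mpol.span_scale)
    moreover have "mpol_scale c x * y = mpol_scale c v" by (simp add: v mpol_scale_def mult.assoc)
    ultimately show ?case
      using ideal_prod.sum[of "mpol_scale c v" "coord_ring B" _ _ z] step(2)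
        by (simp add: coord_ring_simps)
  qed
qed

definition products :: "'x set \<Rightarrow> (nat \<Rightarrow> ('x, 'k::field) mpol set) \<Rightarrow> nat set \<Rightarrow> ('x, 'k) mpol set" where
  "products B G X = {prod g X * r | g r. (\<forall>i\<in>X. g i \<in> G i) \<and> r \<in> carrier (coord_ring B)}"

lemma products_insert:
  assumes "finite X" "j \<notin> X"
  shows "{x * y | x y. x \<in> {a * r | a r. a \<in> G j \<and> r \<in> carrier (coord_ring B)} \<and> y \<in> products B G X} =
    products B G (insert j X)" (is "?L = _")
proof (intro equalityI subsetI)
  interpret R: cring "coord_ring B :: ('a, 'b) mpol ring" by (rule cring_coord_ring)
  fix v assume "v \<in> ?L"
  then obtain a r g r'
    where v: "v = (a * r) * (prod g X * r')" "a \<in> G j" "r \<in> carrier (coord_ring B)"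
    "\<forall>i\<in>X. g i \<in> G i" "r' \<in> carrier (coord_ring B)"
    unfolding products_def by blast
  define g' where "g' = g(j := a)"
  have "prod g' X = prod g X" using assms unfolding g'_def by (intro prod.cong) auto
  then have "v = prod g' (insert j X) * (r * r')" using v(1) assms by (simp add: g'_def ac_simps)
  moreover have "\<forall>i\<in>insert j X. g' i \<in> G i" using v(2,4) by (simp add: g'_def)
  moreover have "r * r' \<in> carrier (coord_ring B)"
    using R.m_closed[OF v(3,5)] by (simp add: coord_ring_simps)
  ultimately show "v \<in> products B G (insert j X)" unfolding products_def by blast
next
  interpret R: cring "coord_ring B :: ('a, 'b) mpol ring" by (rule cring_coord_ring)
  have one: "1 \<in> carrier (coord_ring B :: ('a, 'b) mpol ring)" using R.one_closed
    by (simp add: coord_ring_simps)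
  fix v assume "v \<in> products B G (insert j X)"
  then obtain g r where v: "v = prod g (insert j X) * r" "\<forall>i\<in>insert j X. g i \<in> G i" "r \<in> carrier (coord_ring B)"
    unfolding products_def by blast
  have "v = (g j * 1) * (prod g X * r)" using v(1) assms by (simp add: ac_simps)
  moreover have "prod g X * r \<in> products B G X" using v unfolding products_def by blast
  ultimately show "v \<in> ?L" using v(2) one by blast
qed

lemma foldr_ideal_prod:
  assumes "distinct js"
  shows "foldr (ideal_prod (coord_ring B))
      (map (\<lambda>j. mpol.span {a * r | a r. a \<in> G j \<and> r \<in> carrier (coord_ring B)}) js) (carrier (coord_ring B)) =
    mpol.span (products B G (set js))"
  using assms
proof (induction js)
  case Nil
  have "products B G {} = carrier (coord_ring B)" unfolding products_def by auto
  then show ?case by (simp add: carrier_eq_span mpol.span_span)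
next
  case (Cons j js)
  let ?I = "\<lambda>j. {a * r | a r. a \<in> G j \<and> r \<in> carrier (coord_ring B)}"
  have "foldr (ideal_prod (coord_ring B)) (map (\<lambda>j. mpol.span (?I j)) (j # js)) (carrier (coord_ring B)) =
      ideal_prod (coord_ring B) (mpol.span (?I j)) (mpol.span (products B G (set js)))"
    using Cons by simp
  also have "\<dots> = mpol.span {x * y | x y. x \<in> ?I j \<and> y \<in> products B G (set js)}"
    by (rule ideal_prod_span)
  also have "\<dots> = mpol.span (products B G (insert j (set js)))"
    using Cons.prems by (subst products_insert) simp_all
  finally show ?case by simp
qed

text \<open>
  The projection to the monomials of degree \<open>d\<close> fixes \<open>f\<close> and maps the span to \<open>F d\<close>.
\<close>

lemma homogeneous_component:
  fixes F :: "nat \<Rightarrow> ('x, 'k::field) mpol set"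
  assumes F: "\<And>e. mpol.subspace (F e)" "\<And>e. F e \<subseteq> forms B e"
    and f: "f \<in> mpol.span (\<Union>e. F e)" "homogeneous d f"
  shows "f \<in> F d"
proof -
  define comp :: "('x, 'k) mpol \<Rightarrow> ('x, 'k) mpol" where
    "comp f = (\<Sum>\<alpha>\<in>{\<alpha> \<in> keys f. mdeg \<alpha> = d}. single \<alpha> (lookup f \<alpha>))" for f
  have lookup: "lookup (comp f) \<alpha> = (if mdeg \<alpha> = d then lookup f \<alpha> else 0)" for f \<alpha>
    unfolding comp_def lookup_sum
    by (auto simp: lookup_single when_def in_keys_iff if_distrib)
  have "comp f \<in> F d"
    using f(1)
  proof (induction rule: mpol.span_induct_alt)
    case base
    have "comp 0 = 0" by (rule poly_mapping_eqI) (simp add: lookup)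
    then show ?case using mpol.subspace_0[OF F(1)] by simp
  next
    case (step c x y)
    then obtain e where e: "x \<in> F e" by blast
    then have deg: "mdeg \<alpha> = e" if "lookup x \<alpha> \<noteq> 0" for \<alpha>
      using F(2) that unfolding forms_def monomials_def by (fastforce simp: in_keys_iff)
    have "comp x = (if e = d then x else 0)"
      by (rule poly_mapping_eqI) (use deg in \<open>auto simp: lookup\<close>)
    then have "comp x \<in> F d" using e mpol.subspace_0[OF F(1)] by auto
    moreover have "comp (mpol_scale c x + y) = mpol_scale c (comp x) + comp y"
      by (rule poly_mapping_eqI) (simp add: lookup lookup_add lookup_mpol_scale)
    ultimately show ?case
      using step(2) by (simp add: mpol.subspace_add[OF F(1)] mpol.subspace_scale[OF F(1)])
  qed
  moreover have "comp f = f"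
    by (rule poly_mapping_eqI)
      (use f(2) in \<open>auto simp: lookup homogeneous_def mdeg_def in_keys_iff\<close>)
  ultimately show ?thesis by simp
qed

lemma prod_forms:
  assumes "finite X" "\<And>i. i \<in> X \<Longrightarrow> g i \<in> forms B 1"
  shows "prod g X \<in> forms B (card X)"
  using assms
proof (induction X)
  case empty
  then show ?case using single_forms[of 0 B 0 1] by (simp add: monomials_0)
next
  case (insert s X)
  then show ?case using forms_mult[of "g s" B 1 "prod g X" "card X"] by simp
qed

lemma homogeneous_products:
  fixes G :: "nat \<Rightarrow> ('x, 'k::field) mpol set"
  assumes X: "finite X" and G: "\<And>i. G i \<subseteq> forms B 1"
  shows "{f \<in> mpol.span (products B G X). homogeneous d f} = mpol.span (products_deg B G X d)"
proof (intro equalityI subsetI)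
  have sub: "mpol.span (products_deg B G X e) \<subseteq> forms B e" for e
  proof (rule mpol.span_minimal[OF _ subspace_forms], rule subsetI)
    fix f assume "f \<in> products_deg B G X e"
    then obtain g r e' where "f = prod g X * r" "\<forall>i\<in>X. g i \<in> G i" "r \<in> forms B e'" "e = card X + e'"
      unfolding products_deg_def by blast
    then show "f \<in> forms B e" using prod_forms[OF X, of g B] G by (auto intro!: forms_mult)
  qed
  {
    fix f assume f: "f \<in> mpol.span (products_deg B G X d)"
    have "products_deg B G X d \<subseteq> products B G X"
      unfolding products_deg_def products_def by (auto simp: forms_eq)
    then have "f \<in> mpol.span (products B G X)" using f mpol.span_mono by blast
    moreover have "homogeneous d f" using f sub[of d] unfolding forms_eq by blast
    ultimately show "f \<in> {f \<in> mpol.span (products B G X). homogeneous d f}" by blast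
  }
  fix f assume "f \<in> {f \<in> mpol.span (products B G X). homogeneous d f}"
  then have f: "f \<in> mpol.span (products B G X)" "homogeneous d f" by auto
  let ?U = "\<Union>e. mpol.span (products_deg B G X e)"
  have "v \<in> mpol.span ?U" if v: "v \<in> products B G X" for v
  proof -
    obtain g r where v: "v = prod g X * r" "\<forall>i\<in>X. g i \<in> G i" "r \<in> carrier (coord_ring B)"
      using v unfolding products_def by blast
    have "v \<in> mpol.span {x * y | x y. x \<in> {prod g X} \<and> y \<in> (\<Union>e. forms B e)}"
      unfolding v(1) using v(3)
        by (intro mpol_span_mult) (auto simp: carrier_eq_span mpol.span_base)
    also have "\<dots> \<subseteq> mpol.span ?U"
    proof (rule mpol.span_mono, rule subsetI)
      fix w assume "w \<in> {x * y | x y. x \<in> {prod g X} \<and> y \<in> (\<Union>e. forms B e)}"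
      then obtain y e where "w = prod g X * y" "y \<in> forms B e" by blast
      then have "w \<in> products_deg B G X (card X + e)" using v(2) unfolding products_deg_def by blast
      then show "w \<in> ?U" using mpol.span_base by blast
    qed
    finally show ?thesis .
  qed
  then have "mpol.span (products B G X) \<subseteq> mpol.span ?U"
    by (intro mpol.span_minimal mpol.subspace_span) blast
  then show "f \<in> mpol.span (products_deg B G X d)"
    using f sub by (intro homogeneous_component[of "\<lambda>e. mpol.span (products_deg B G X e)" B]) (auto simp: mpol.subspace_span)
qed

section \<open>Annihilators and codimensions\<close>

context finite_dimensional_vector_space
begin

definition annihilator :: "'b set \<Rightarrow> ('b, 'a) mpol set" where
  "annihilator W = {linear_form_mpol Basis l | l. Vector_Spaces.linear scale (*) l \<and> (\<forall>w\<in>W. l w = 0)}"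

end

context finite_dimensional_vector_space
begin

abbreviation "lform \<equiv> linear_form_mpol Basis"

lemma lform_forms: "lform l \<in> forms Basis 1"
  unfolding linear_form_mpol_def
  by (intro mpol.subspace_sum[OF subspace_forms] single_forms) (simp add: monomials_1[simplified])

lemma annihilator_forms: "annihilator W \<subseteq> forms Basis 1"
  unfolding annihilator_def using lform_forms by blast

lemma lform_add:
  "lform (\<lambda>v. l v + k v) = lform l + lform k"
  by (simp add: linear_form_mpol_def single_add sum.distrib)

lemma lform_scale:
  "lform (\<lambda>v. c * l v) = mpol_scale c (lform l)"
  by (simp add: linear_form_mpol_def mpol.scale_sum_right mpol_scale_single)

lemma lform_sum:
  "lform (\<lambda>v. \<Sum>i\<in>I. c i * l i v) = (\<Sum>i\<in>I. mpol_scale (c i) (lform (l i)))"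
proof (induction I rule: infinite_finite_induct)
  case (insert i I)
  then show ?case by (simp add: lform_add lform_scale)
qed (simp_all add: linear_form_mpol_def)

lemma lform_inj:
  assumes "Vector_Spaces.linear scale (*) l" "Vector_Spaces.linear scale (*) k"
    and "lform l = lform k"
  shows "l v = k v"
proof -
  interpret p: vector_space_pair scale "(*) :: 'a \<Rightarrow> 'a \<Rightarrow> 'a"
    by unfold_locales (auto simp: algebra_simps)
  have "lookup (lform l) (single b 1) = l b" if "b \<in> Basis" for b l
    unfolding linear_form_mpol_def lookup_sum lookup_single when_def
    using that finite_Basis by (simp add: single_1_eq_iff[where 'r = nat, simplified])
  then have "l b = k b" if "b \<in> Basis" for b using assms(3) that by metis
  then show ?thesis
    using p.linear_eq_on[OF assms(1,2), of v Basis] span_Basis by simp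
qed

lemma subspace_annihilator: "mpol.subspace (annihilator W)"
proof -
  have lin: "Vector_Spaces.linear scale (*) (\<lambda>v. l v + k v)" "Vector_Spaces.linear scale (*) (\<lambda>v. c * l v)"
    if "Vector_Spaces.linear scale (*) l" "Vector_Spaces.linear scale (*) k" for l k c
    using that by (auto simp: Vector_Spaces.linear_iff algebra_simps)
  have zero: "Vector_Spaces.linear scale (*) (\<lambda>_. 0)"
    by unfold_locales (simp_all add: algebra_simps)
  show ?thesis
    unfolding mpol.subspace_def
  proof (intro conjI ballI allI)
    have "0 = lform (\<lambda>_. 0)" by (simp add: linear_form_mpol_def)
    then show "0 \<in> annihilator W" unfolding annihilator_def using zero by blast
  next
    fix f g assume "f \<in> annihilator W" "g \<in> annihilator W"
    then obtain l k where lk: "f = lform l" "g = lform k"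
      "Vector_Spaces.linear scale (*) l" "Vector_Spaces.linear scale (*) k" "\<forall>w\<in>W. l w = 0" "\<forall>w\<in>W. k w = 0"
      unfolding annihilator_def by blast
    have "f + g = lform (\<lambda>v. l v + k v)" by (simp add: lk lform_add)
    moreover have "\<forall>w\<in>W. l w + k w = 0" using lk by simp
    ultimately show "f + g \<in> annihilator W" unfolding annihilator_def
      using lin(1)[OF lk(3,4)] by blast
  next
    fix c f assume "f \<in> annihilator W"
    then obtain l where l: "f = lform l" "Vector_Spaces.linear scale (*) l" "\<forall>w\<in>W. l w = 0"
      unfolding annihilator_def by blast
    have "mpol_scale c f = lform (\<lambda>v. c * l v)" by (simp add: l lform_scale)
    moreover have "\<forall>w\<in>W. c * l w = 0" using l by simp
    ultimately show "mpol_scale c f \<in> annihilator W" unfolding annihilator_def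
      using lin(2)[OF l(2,2)] by blast
  qed
qed

text \<open>
  A form outside of the right-hand side is separated from it by a functional on the linear forms,
  that is, by a point \<open>v\<close>. Every form vanishing on some \<open>V i\<close> vanishes at \<open>v\<close>, so \<open>v\<close> lies in all
  \<open>V i\<close>, yet the given form is nonzero at \<open>v\<close>.
\<close>

lemma annihilator_Inter:
  assumes V: "\<And>i. i \<in> S \<Longrightarrow> subspace (V i)"
  shows "annihilator (\<Inter>i\<in>S. V i) = mpol.span (\<Union>i\<in>S. annihilator (V i))"
proof
  show "mpol.span (\<Union>i\<in>S. annihilator (V i)) \<subseteq> annihilator (\<Inter>i\<in>S. V i)"
    by (rule mpol.span_minimal[OF _ subspace_annihilator]) (auto simp: annihilator_def)
  show "annihilator (\<Inter>i\<in>S. V i) \<subseteq> mpol.span (\<Union>i\<in>S. annihilator (V i))" (is "_ \<subseteq> ?U")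
  proof (rule subsetI, rule ccontr)
    fix f assume "f \<in> annihilator (\<Inter>i\<in>S. V i)" and fU: "f \<notin> ?U"
    then obtain p where p: "f = lform p" "Vector_Spaces.linear scale (*) p"
      "\<forall>w\<in>(\<Inter>i\<in>S. V i). p w = 0"
      unfolding annihilator_def by blast
    obtain m where m: "Vector_Spaces.linear mpol_scale (*) m" "\<forall>u\<in>?U. m u = 0" "m f = 1"
      using mpol.ex_separating_functional[OF mpol.subspace_span fU] by blast
    interpret m: Vector_Spaces.linear mpol_scale "(*)" m by (rule m(1))
    define v where "v = (\<Sum>b\<in>Basis. scale (m (mvar b)) b)"
    have eval: "m (lform l) = l v" if "Vector_Spaces.linear scale (*) l" for l
    proof -
      interpret l: Vector_Spaces.linear scale "(*)" l by (rule that)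
      have "lform l = (\<Sum>b\<in>Basis. mpol_scale (l b) (mvar b))"
        by (simp add: linear_form_mpol_def mpol_scale_single)
      then show ?thesis by (simp add: v_def m.sum m.scale l.sum l.scale mult.commute)
    qed
    have "v \<in> V i" if i: "i \<in> S" for i
    proof (rule ccontr)
      assume "v \<notin> V i"
      then obtain l where l: "Vector_Spaces.linear scale (*) l" "\<forall>u\<in>V i. l u = 0" "l v = 1"
        using ex_separating_functional[OF V[OF i]] by blast
      have "lform l \<in> (\<Union>i\<in>S. annihilator (V i))"
        unfolding annihilator_def using l(1,2) i by blast
      then have "lform l \<in> ?U" by (rule mpol.span_base)
      then have "m (lform l) = 0" using m(2) by blast
      then show False using eval[OF l(1)] l(3) by simp
    qed
    then have "p v = 0" using p(3) by blast
    then show False using eval[OF p(2)] p(1) m(3) by simp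
  qed
qed

text \<open>
  Extend a basis \<open>C\<close> of \<open>W\<close> to a basis \<open>D\<close> of the whole space. The members of the dual basis that
  belong to \<open>D - C\<close> form a basis of the annihilator.
\<close>

lemma dim_annihilator:
  assumes W: "subspace W"
  shows "mpol.dim (annihilator W) = dim (UNIV :: 'b set) - dim W"
proof -
  obtain C where C: "C \<subseteq> W" "independent C" "W \<subseteq> span C" "card C = dim W"
    by (rule basis_exists)
  obtain D where D: "C \<subseteq> D" "independent D" "UNIV \<subseteq> span D"
    using maximal_independent_subset_extend[of C UNIV] C(2) by auto
  have spanD: "span D = UNIV" using D(3) by blast
  have finD: "finite D" by (rule finiteI_independent[OF D(2)])
  define r where "r d v = representation D v d" for d v
  have r: "Vector_Spaces.linear scale (*) (r d)" for d
    unfolding r_def by (rule linear_representation[OF D(2) spanD])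
  have r_basis: "r d e = (if d = e then 1 else 0)" if "e \<in> D" for d e
    unfolding r_def using representation_basis[OF D(2) that] by auto
  have expand: "l v = (\<Sum>d\<in>D. l d * r d v)" if "Vector_Spaces.linear scale (*) l" for l v
  proof -
    interpret l: Vector_Spaces.linear scale "(*)" l by (rule that)
    have "v = (\<Sum>d\<in>D. scale (r d v) d)"
      unfolding r_def using sum_representation_eq[OF D(2) _ finD order_refl, of v] spanD by simp
    then have "l v = l (\<Sum>d\<in>D. scale (r d v) d)" by simp
    then show ?thesis by (simp add: l.sum l.scale mult.commute)
  qed
  let ?lf = "\<lambda>d. lform (r d)"
  have inj: "inj_on ?lf (D - C)"
  proof (rule inj_onI)
    fix d e assume "d \<in> D - C" "e \<in> D - C" "?lf d = ?lf e"
    then have "r d d = r e d" using lform_inj[OF r r] by blast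
    then show "d = e" using \<open>d \<in> D - C\<close> by (auto simp: r_basis split: if_splits)
  qed
  have "mpol.dim (annihilator W) = card (?lf ` (D - C))"
  proof (rule mpol.dim_unique[OF _ _ _ refl])
    show "?lf ` (D - C) \<subseteq> annihilator W"
    proof (rule image_subsetI)
      fix d assume d: "d \<in> D - C"
      have "r d w = 0" if "w \<in> W" for w
      proof -
        interpret p: vector_space_pair scale "(*) :: 'a \<Rightarrow> 'a \<Rightarrow> 'a"
          by unfold_locales (auto simp: algebra_simps)
        have "r d c = 0" if "c \<in> C" for c using that D(1) d r_basis[of c d] by auto
        then show ?thesis using p.linear_eq_0_on_span[OF r, of C d w] C(3) that by blast
      qed
      then show "?lf d \<in> annihilator W" unfolding annihilator_def using r by blast
    qed
    show "annihilator W \<subseteq> mpol.span (?lf ` (D - C))"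
    proof
      fix f assume "f \<in> annihilator W"
      then obtain l where l: "f = lform l" "Vector_Spaces.linear scale (*) l" "\<forall>w\<in>W. l w = 0"
        unfolding annihilator_def by blast
      have "f = lform (\<lambda>v. \<Sum>d\<in>D. l d * r d v)"
        unfolding l(1) by (rule arg_cong[where f = "lform"]) (use expand[OF l(2)] in blast)
      also have "\<dots> = (\<Sum>d\<in>D. mpol_scale (l d) (?lf d))" by (rule lform_sum)
      also have "\<dots> = (\<Sum>d\<in>D - C. mpol_scale (l d) (?lf d))"
        using finD C(1) l(3) by (intro sum.mono_neutral_right) auto
      finally show "f \<in> mpol.span (?lf ` (D - C))"
        by (simp only:) (rule mpol.span_sum, rule mpol.span_scale, rule mpol.span_base, rule imageI)
    qed
    show "mpol.independent (?lf ` (D - C))"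
    proof (rule mpol.independent_if_scalars_zero)
      show "finite (?lf ` (D - C))" using finD by simp
      fix u f assume u: "(\<Sum>f\<in>?lf ` (D - C). mpol_scale (u f) f) = 0" and f: "f \<in> ?lf ` (D - C)"
      obtain e where e: "e \<in> D - C" "f = ?lf e" using f by blast
      have "lform (\<lambda>v. \<Sum>d\<in>D - C. u (?lf d) * r d v) = 0"
        using u unfolding lform_sum by (subst (asm) sum.reindex[OF inj]) simp
      also have "\<dots> = lform (\<lambda>_. 0)" by (simp add: linear_form_mpol_def)
      finally have "(\<Sum>d\<in>D - C. u (?lf d) * r d e) = 0"
      proof (rule lform_inj[rotated 2])
        show "Vector_Spaces.linear scale (*) (\<lambda>v. \<Sum>d\<in>D - C. u (?lf d) * r d v)"
          using r by (simp add: Vector_Spaces.linear_iff sum.distrib distrib_left sum_distrib_left mult.left_commute)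
        show "Vector_Spaces.linear scale (*) (\<lambda>_. 0)"
          by unfold_locales (simp_all add: algebra_simps)
      qed
      then have "(\<Sum>d\<in>D - C. if d = e then u (?lf d) else 0) = 0"
        using e(1) by (simp add: r_basis if_distrib cong: if_cong)
      then show "u f = 0" using e finD by simp
    qed
  qed
  also have "\<dots> = card (D - C)" by (rule card_image[OF inj])
  also have "\<dots> = card D - card C" using finD D(1) by (simp add: card_Diff_subset finite_subset)
  also have "card D = dim (UNIV :: 'b set)"
    using basis_card_eq_dim[of D UNIV] D by simp
  finally show ?thesis using C(4) by simp
qed

lemma codim_eq_dim_annihilators:
  assumes "\<And>i. i \<in> S \<Longrightarrow> subspace (V i)"
  shows "codim scale V S = mpol.dim (\<Union>i\<in>S. annihilator (V i))"
proof -
  have "subspace (\<Inter>i\<in>S. V i)" using assms by (auto simp: subspace_def)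
  then have "codim scale V S = mpol.dim (annihilator (\<Inter>i\<in>S. V i))"
    unfolding codim_def by (rule dim_annihilator[symmetric])
  then show ?thesis using annihilator_Inter[of S V, OF assms] by simp
qed

lemma hilbert_series_product_ideal:
  "hilbert_series (product_ideal scale Basis V m) =
    mpol_series (products_deg Basis (\<lambda>j. annihilator (V j)) {1..m})"
proof -
  have "annihilator W \<subseteq> carrier (coord_ring Basis)" for W
    using annihilator_forms[of W] unfolding forms_eq by blast
  then have "linear_ideal scale Basis W =
      mpol.span {a * r | a r. a \<in> annihilator W \<and> r \<in> carrier (coord_ring Basis)}" for W
    unfolding linear_ideal_def annihilator_def[symmetric] by (rule genideal_eq_span)
  then have "product_ideal scale Basis V m = mpol.span (products Basis (\<lambda>j. annihilator (V j)) (set [1..<Suc m]))"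
    unfolding product_ideal_def by (simp only: foldr_ideal_prod[OF distinct_upt])
  also have "set [1..<Suc m] = {1..m}" by auto
  finally have eq: "product_ideal scale Basis V m = mpol.span (products Basis (\<lambda>j. annihilator (V j)) {1..m})" .
  show ?thesis
    unfolding hilbert_series_def mpol_series_def eq
      homogeneous_products[OF finite_atLeastAtMost annihilator_forms] by simp
qed

end

section \<open>The recursion for the Hilbert series\<close>

lemma degree_less_if_coeffs_vanish:
  assumes "\<And>i. i \<ge> c \<Longrightarrow> coeff q i = 0"
  shows "q = 0 \<or> degree q < c"
  using assms[of "degree q"] by (metis leading_coeff_0_iff not_less)

text \<open>
  Here \<open>P\<close> is \<open>(-1)\<^sup>|\<^sup>S\<^sup>|\<close> times the left-hand side. The alternating sum expresses it by \<open>Q\<close> and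
  the \<open>p X\<close> for smaller \<open>X\<close>, so its degree is less than \<open>card S + c S\<close>; its coefficients below
  \<open>card S\<close> vanish because the product has no elements of such degrees. The expression of \<open>P\<close> by
  \<open>Q\<close> is at the same time the congruence modulo \<open>(1 - t)\<close> to the power \<open>c S\<close>.
\<close>

theorem hilbert_series_recursion:
  fixes G :: "nat \<Rightarrow> ('x, 'k::field) mpol set" and c :: "nat set \<Rightarrow> nat"
  assumes B: "finite B" and G: "\<And>i. G i \<subseteq> forms B 1"
    and fin: "finite S"
    and c: "\<And>X. X \<subseteq> S \<Longrightarrow> c X = mpol.dim (\<Union>i\<in>X. G i)"
  shows "(1 - fps_X) ^ card B * mpol_series (products_deg B G S) =
    fps_of_poly (p_poly c S) * fps_X ^ card S"
  using fin c
proof (induction S rule: finite_psubset_induct)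
  case (psubset S)
  show ?case
  proof (cases "S = {}")
    case True
    then show ?thesis using alternating_mpol_series(2)[of B G, OF B G] by (simp add: p_poly_empty)
  next
    case False
    let ?H = "\<lambda>X. mpol_series (products_deg B G X)"
    let ?D = "1 - fps_X :: rat fps" and ?D' = "[:1, -1:] :: rat poly"
      and ?x = "[:0, -1:] :: rat poly"
    let ?s = "card S"
    have s: "0 < ?s" using False psubset.hyps by (simp add: card_gt_0_iff)
    have D': "fps_of_poly ?D' = ?D" by (simp add: fps_of_poly_pCons)
    have x: "fps_of_poly (?x ^ k) = (- 1) ^ k * fps_X ^ k" for k
      by (simp add: fps_of_poly_pCons fps_of_poly_power flip: power_mult_distrib)
    have fin_forms: "mpol.fin_span (forms B 1 :: ('x, 'k) mpol set)"
      unfolding mpol.fin_span_def forms_span using finite_monomials[OF B] by blast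
    have c_mono: "c X \<le> c S" if "X \<subseteq> S" for X
    proof -
      have "mpol.fin_span (\<Union>i\<in>S. G i)" using G by (intro mpol.fin_span_subset[OF fin_forms]) blast
      then have "mpol.dim (\<Union>i\<in>X. G i) \<le> mpol.dim (\<Union>i\<in>S. G i)"
        by (rule mpol.dim_mono_fin_span) (use that in blast)
      then show ?thesis using psubset.prems that by simp
    qed
    have c_le: "c S \<le> card B"
      using mpol.dim_mono_fin_span[OF fin_forms, of "\<Union>i\<in>S. G i"] G psubset.prems[of S]
        dim_forms_1[OF B, where 'k = 'k] by auto
    obtain Q :: "rat poly" where Q: "Q = 0 \<or> degree Q < ?s"
      "?D ^ (card B - c S) * (\<Sum>X\<in>Pow S. (- 1) ^ card X * ?H X) = fps_of_poly Q"
      using alternating_mpol_series(1)[of B G, OF B G psubset.hyps False] psubset.prems[of S] by auto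
    define P where "P = Q * ?D' ^ c S - (\<Sum>X\<in>Pow S - {S}. ?x ^ card X * p_poly c X)"
    have "fps_of_poly (Q * ?D' ^ c S) = ?D ^ card B * (\<Sum>X\<in>Pow S. (- 1) ^ card X * ?H X)"
    proof -
      have "?D ^ card B = ?D ^ c S * ?D ^ (card B - c S)"
        using c_le by (simp flip: power_add)
      then have "?D ^ card B * (\<Sum>X\<in>Pow S. (- 1) ^ card X * ?H X) = fps_of_poly Q * ?D ^ c S"
        unfolding Q(2)[symmetric] by (simp only: mult_ac)
      then show ?thesis by (simp only: fps_of_poly_mult fps_of_poly_power D')
    qed
    also have "\<dots> = (\<Sum>X\<in>Pow S. (- 1) ^ card X * (?D ^ card B * ?H X))"
      by (simp add: sum_distrib_left mult.left_commute)
    also have "\<dots> = (- 1) ^ ?s * (?D ^ card B * ?H S) + (\<Sum>X\<in>Pow S - {S}. (- 1) ^ card X * (?D ^ card B * ?H X))"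
      using psubset.hyps by (subst sum.remove[of _ S]) auto
    also have "(\<Sum>X\<in>Pow S - {S}. (- 1) ^ card X * (?D ^ card B * ?H X)) =
        fps_of_poly (\<Sum>X\<in>Pow S - {S}. ?x ^ card X * p_poly c X)"
      unfolding fps_of_poly_sum
    proof (intro sum.cong refl)
      fix X assume "X \<in> Pow S - {S}"
      then have X: "X \<subset> S" by blast
      have "?D ^ card B * ?H X = fps_of_poly (p_poly c X) * fps_X ^ card X"
        using psubset.IH[OF X] psubset.prems X by blast
      then show "(- 1) ^ card X * (?D ^ card B * ?H X) = fps_of_poly (?x ^ card X * p_poly c X)"
        by (simp add: fps_of_poly_mult x mult_ac)
    qed
    finally have P: "fps_of_poly P = (- 1) ^ ?s * (?D ^ card B * ?H S)"
      unfolding P_def fps_of_poly_diff by simp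
    have P_low: "coeff P i = 0" if "i < ?s" for i
    proof -
      have "?H S $ j = 0" if "j < ?s" for j
      proof -
        have "products_deg B G S j = {}" unfolding products_deg_def using that by auto
        then show ?thesis
          unfolding mpol_series_def using mpol.dim_le_card[of "{}" "{}"] by simp
      qed
      then have "(?D ^ card B * ?H S) $ i = 0"
        unfolding fps_mult_nth using that by (intro sum.neutral) auto
      moreover have "((- 1) ^ k * f) $ i = (- 1) ^ k * f $ i" for k and f :: "rat fps"
        by (induction k) auto
      ultimately have "fps_of_poly P $ i = 0" unfolding P by simp
      then show ?thesis by simp
    qed
    have P_high: "coeff P i = 0" if i: "i \<ge> ?s + c S" for i
    proof -
      have "coeff (Q * ?D' ^ c S) i = 0"
      proof (cases "Q = 0")
        case False
        have "degree (Q * ?D' ^ c S) \<le> degree Q + c S"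
          by (rule order_trans[OF degree_mult_le]) (simp add: degree_power_eq)
        then show ?thesis using Q(1) False i by (intro coeff_eq_0) simp
      qed simp
      moreover have "coeff (?x ^ card X * p_poly c X) i = 0" if "X \<in> Pow S - {S}" for X
      proof (cases "X = {}")
        case True
        then show ?thesis using s i by (simp add: p_poly_empty)
      next
        case False
        have X: "X \<subset> S" "finite X" using that psubset.hyps finite_subset by auto
        have "p_poly c X = 0 \<or> degree (p_poly c X) < c X"
          using p_condition_p_poly[OF X(2) False, of c] unfolding p_condition_def by blast
        moreover have "card X < ?s" using X(1) psubset.hyps psubset_card_mono by blast
        moreover have "degree (?x ^ card X * p_poly c X) \<le> card X + degree (p_poly c X)"
          by (rule order_trans[OF degree_mult_le]) (simp add: degree_power_eq)
        ultimately show ?thesis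
          using c_mono[of X] X(1) i by (cases "p_poly c X = 0") (auto intro!: coeff_eq_0)
      qed
      ultimately show ?thesis unfolding P_def by (simp add: coeff_sum)
    qed
    define q where "q = (- 1) ^ ?s * poly_shift ?s P"
    have sign: "coeff ((- 1) ^ k * f) i = (- 1) ^ k * coeff f i" for k i and f :: "rat poly"
      by (induction k) auto
    have Pq: "P = ?x ^ ?s * q"
    proof -
      have x_monom: "?x = - monom 1 1" by (simp add: monom_altdef)
      have "?x ^ ?s = (- 1) ^ ?s * monom 1 ?s"
        unfolding x_monom power_minus[of "monom 1 1"] monom_power by simp
      then have "?x ^ ?s * q = ((- 1) ^ ?s * (- 1) ^ ?s) * (monom 1 ?s * poly_shift ?s P)"
        unfolding q_def by (simp only: mult_ac)
      also have "\<dots> = monom 1 ?s * poly_shift ?s P" by (simp flip: power_mult_distrib)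
      also have "\<dots> = P"
        by (rule poly_eqI) (use P_low in \<open>auto simp: coeff_monom_mult coeff_poly_shift\<close>)
      finally show ?thesis ..
    qed
    have "q = 0 \<or> degree q < c S"
    proof (rule degree_less_if_coeffs_vanish)
      fix i assume "i \<ge> c S"
      then show "coeff q i = 0" unfolding q_def sign coeff_poly_shift using P_high by simp
    qed
    moreover have "(\<Sum>X\<in>Pow S. ?x ^ card X * (if X = S then q else p_poly c X)) = Q * ?D' ^ c S"
    proof -
      have "(\<Sum>X\<in>Pow S. ?x ^ card X * (if X = S then q else p_poly c X)) =
          ?x ^ ?s * q + (\<Sum>X\<in>Pow S - {S}. ?x ^ card X * (if X = S then q else p_poly c X))"
        using psubset.hyps by (subst sum.remove[of _ S]) auto
      also have "(\<Sum>X\<in>Pow S - {S}. ?x ^ card X * (if X = S then q else p_poly c X)) =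
          (\<Sum>X\<in>Pow S - {S}. ?x ^ card X * p_poly c X)"
        by (intro sum.cong) auto
      finally show ?thesis unfolding Pq[symmetric] P_def by simp
    qed
    ultimately have "p_condition c (p_poly c) S q"
      unfolding p_condition_def by (simp add: cong_0_iff)
    then have "q = p_poly c S"
      using p_condition_p_poly[OF psubset.hyps False, of c] ex1_p_condition[OF psubset.hyps, of c "p_poly c"] by blast
    moreover have "?D ^ card B * ?H S = (- 1) ^ ?s * fps_of_poly P"
      unfolding P by (simp flip: mult.assoc power_mult_distrib)
    moreover have "(- 1) ^ ?s * fps_of_poly P = fps_X ^ ?s * fps_of_poly q"
      unfolding Pq fps_of_poly_mult x by (simp flip: mult.assoc power_mult_distrib)
    ultimately show ?thesis by (simp add: mult.commute)
  qed
qed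

theorem theorem4p1:
  fixes scale :: "'k::field \<Rightarrow> 'v::ab_group_add \<Rightarrow> 'v"
    and B :: "'v set" and V :: "nat \<Rightarrow> 'v set" and n m :: nat
  assumes "finite_dimensional_vector_space scale B"
    and "vector_space.dim scale (UNIV :: 'v set) = n" and "n \<ge> 1" and "m \<ge> 1"
    and "\<And>j. j \<in> {1..m} \<Longrightarrow> module.subspace scale (V j)"
  shows "(\<forall>S\<subseteq>{1..m}. S \<noteq> {} \<longrightarrow>
            (\<exists>!q. p_condition (codim scale V) (p_poly (codim scale V)) S q)) \<and>
         hilbert_series (product_ideal scale B V m) =
           fps_of_poly (p_poly (codim scale V) {1..m}) * fps_X ^ m / (1 - fps_X) ^ n"
proof
  interpret finite_dimensional_vector_space scale B by (rule assms(1))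
  show "\<forall>S\<subseteq>{1..m}. S \<noteq> {} \<longrightarrow> (\<exists>!q. p_condition (codim scale V) (p_poly (codim scale V)) S q)"
  proof (intro allI impI)
    fix S assume "S \<subseteq> {1..m}"
    then have "finite S" using finite_subset by blast
    then show "\<exists>!q. p_condition (codim scale V) (p_poly (codim scale V)) S q"
      by (rule ex1_p_condition)
  qed
  let ?H = "hilbert_series (product_ideal scale B V m)"
  have "card B = n" using assms(2) by simp
  then have "(1 - fps_X) ^ n * ?H = fps_of_poly (p_poly (codim scale V) {1..m}) * fps_X ^ m"
  proof -
    have "codim scale V X = mpol.dim (\<Union>i\<in>X. annihilator (V i))" if "X \<subseteq> {1..m}" for X
      using that assms(5) by (intro codim_eq_dim_annihilators) blast
    from hilbert_series_recursion[OF finite_Basis annihilator_forms finite_atLeastAtMost this]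
    show ?thesis unfolding hilbert_series_product_ideal \<open>card B = n\<close> by simp
  qed
  moreover have "(1 - fps_X :: rat fps) \<noteq> 0"
  proof
    assume "(1 - fps_X :: rat fps) = 0"
    then have "(1 - fps_X :: rat fps) $ 0 = 0" by simp
    then show False by simp
  qed
  ultimately show "?H = fps_of_poly (p_poly (codim scale V) {1..m}) * fps_X ^ m / (1 - fps_X) ^ n"
    by (metis nonzero_mult_div_cancel_left power_not_zero)
qed

end
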